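(* Let $q\in(0,1)$, $\alpha>0$, $k\in\mathbb{N}$, $k\ge1$, and let $x_1>x_2>\cdots>x_k$ and $i_1<i_2<\cdots<i_k$ be integers. Let $\omega$ be a random permutation of $\mathbb{Z}$ distributed according to the Mallows product measure $\mathcal{M}^p_\alpha$. Then $$\mathbb{P}\left(\omega(i_1)=x_1,\omega(i_2)=x_2,\ldots,\omega(i_k)=x_k\right)=\prod_{j=1}^k\frac{(1-q)\,\alpha\, q^{x_j-i_j-\frac12}}{\left(1+\alpha q^{x_j-i_j-\frac12}\right)\left(1+\alpha q^{x_j-i_j+\frac12}\right)}.$$
   Context: Fix $q\in(0,1)$. Let $\mathfrak{S}$ be the set of all bijections $\omega:\mathbb{Z}\to\mathbb{Z}$ with the $\sigma$-algebra generated by the coordinate maps $\omega\mapsto\omega(i)$. A probability measure $\mathbb{P}$ on $\mathfrak{S}$ is $q$-exchangeable if for every $i\in\mathbb{Z}$, every finite $I\subset\mathbb{Z}$ containing $i,i+1$, and all distinct integers $(y_j)_{j\in I}$: with $y'$ obtained from $y$ by swapping $y_i$ and $y_{i+1}$, one has $\mathbb{P}(\omega(j)=y'_j\ \forall j\in I)=q^{\mathrm{sign}(y_{i+1}-y_i)}\,\mathbb{P}(\omega(j)=y_j\ \forall j\in I)$. A permutation $\sigma\in\mathfrak{S}$ is balanced if $\#\{j>0:\sigma(j)\le 0\}=\#\{j\le 0:\sigma(j)>0\}<\infty$. By a theorem of Gnedin and Olshanski there is a unique $q$-exchangeable probability measure on $\mathfrak{S}$ supported on balanced permutations; it is denoted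 $\mathcal{M}_0$. For $c\in\mathbb{Z}$, $\mathcal{M}_c$ is the law of the permutation $i\mapsto\sigma(i)+c$, where $\sigma\sim\mathcal{M}_0$. With $(q;q)_\infty=\prod_{k\ge1}(1-q^k)$, the Mallows product measure with parameter $\alpha>0$ is $$\mathcal{M}^p_\alpha=\sum_{c\in\mathbb{Z}}\frac{\alpha^c q^{c^2/2}}{(q;q)_\infty\prod_{k=0}^\infty(1+\alpha q^{k+1/2})\prod_{k=0}^\infty(1+\alpha^{-1}q^{k+1/2})}\,\mathcal{M}_c$$ (the coefficients sum to $1$ by the Jacobi triple product identity). *)

theory Defs
  imports "HOL-Probability.Probability"
begin

text \<open>The space of bijections of the integers; its underlying measure (zero) is irrelevant, only
  the space and the \<open>\<sigma>\<close>-algebra generated by the coordinate maps matter.\<close>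

definition perm_space :: "(int \<Rightarrow> int) measure" where
  "perm_space = sigma {\<omega>. bij \<omega>} {{\<omega>. bij \<omega> \<and> \<omega> i \<in> A} | i A. True}"

definition q_exchangeable :: "real \<Rightarrow> (int \<Rightarrow> int) measure \<Rightarrow> bool" where
  "q_exchangeable q P \<longleftrightarrow>
     prob_space P \<and> sets P = sets perm_space \<and>
     (\<forall>i I y. finite I \<longrightarrow> i \<in> I \<longrightarrow> i + 1 \<in> I \<longrightarrow> inj_on y I \<longrightarrow>
        \<P>(\<omega> in P. \<forall>j\<in>I. \<omega> j = (y(i := y (i + 1), i + 1 := y i)) j) =
        q powi sgn (y (i + 1) - y i) * \<P>(\<omega> in P. \<forall>j\<in>I. \<omega> j = y j))"

definition balanced :: "(int \<Rightarrow> int) \<Rightarrow> bool" where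
  "balanced \<sigma> \<longleftrightarrow>
     finite {j. j > 0 \<and> \<sigma> j \<le> 0} \<and> finite {j. j \<le> 0 \<and> \<sigma> j > 0} \<and>
     card {j. j > 0 \<and> \<sigma> j \<le> 0} = card {j. j \<le> 0 \<and> \<sigma> j > 0}"

text \<open>For \<open>0 < q < 1\<close> the description is proper by a theorem of Gnedin and Olshanski.\<close>

definition mallows0 :: "real \<Rightarrow> (int \<Rightarrow> int) measure" where
  "mallows0 q = (THE P. q_exchangeable q P \<and> (AE \<sigma> in P. balanced \<sigma>))"

definition mallows :: "real \<Rightarrow> int \<Rightarrow> (int \<Rightarrow> int) measure" where
  "mallows q c = distr (mallows0 q) perm_space (\<lambda>\<sigma> i. \<sigma> i + c)"

definition mallows_weight :: "real \<Rightarrow> real \<Rightarrow> int \<Rightarrow> real" where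
  "mallows_weight q \<alpha> c =
     \<alpha> powi c * q powr (real_of_int (c^2) / 2) /
     ((\<Prod>k. 1 - q ^ Suc k) *
      (\<Prod>k. 1 + \<alpha> * q powr (real k + 1/2)) *
      (\<Prod>k. 1 + inverse \<alpha> * q powr (real k + 1/2)))"

text \<open>The integral against the counting measure is the sum over \<open>c \<in> \<int>\<close>.\<close>

definition mallows_product :: "real \<Rightarrow> real \<Rightarrow> (int \<Rightarrow> int) measure" where
  "mallows_product q \<alpha> =
     measure_of (space perm_space) (sets perm_space)
       (\<lambda>A. \<integral>\<^sup>+ c. ennreal (mallows_weight q \<alpha> c) * emeasure (mallows q c) A
              \<partial>count_space (UNIV :: int set))"

end

theory Submission
  imports Defs
begin

text \<open>
Why the formula holds. Fix a threshold \<open>m\<close> and record, for a permutation \<open>\<omega>\<close>, the level set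
\<open>S = {j. m \<le> \<omega> j}\<close>. Under the mixture over all charges, the events \<open>j \<in> S\<close> are independent, and the odds of
\<open>j \<in> S\<close> are \<open>\<alpha> * q powr (m - j - 1/2)\<close>. Given \<open>S\<close>, the values at least \<open>m\<close> are laid out on \<open>S\<close> by a random
bijection of the natural numbers that is chosen greedily: the positions of \<open>S\<close> are visited from left
to right, and each skips a geometric number of the values that are still free. The same happens on
the complement, mirrored. For positions \<open>i\<^sub>1 < \<dots> < i\<^sub>k\<close> and values \<open>x\<^sub>1 > \<dots> > x\<^sub>k\<close>, take \<open>m\<close> to be
\<open>x\<^sub>k\<close> or \<open>x\<^sub>k + 1\<close>. Every earlier prescribed value is at least \<open>m\<close>, so whether it is attained depends
only on the part of \<open>S\<close> to the left of \<open>i\<^sub>k\<close> and on the greedy choices, and is therefore independent of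
the event \<open>m \<le> \<omega> i\<^sub>k\<close> (\<open>mixture_level_independent\<close>). Subtracting the two thresholds gives the event
\<open>\<omega> i\<^sub>k = x\<^sub>k\<close> and the factor with index \<open>k\<close> (\<open>mallows_product_next\<close>); induction on \<open>k\<close> gives the product.

What has to be shown is that this description is valid for every \<open>m\<close> simultaneously
(\<open>mallows_product_eq_mixture\<close>). Three facts carry it.

Uniqueness (\<open>q_exchangeable_balanced_unique\<close>): inside a window \<open>{1 - n..n}\<close> the law of a
\<open>q\<close>-exchangeable permutation given the set of values taken there is a finite Mallows measure, which
depends on that set only through its order type. For a balanced permutation the order isomorphism
from a large window onto its set of values is the identity near the origin, so all cylinder
probabilities are limits of quantities that do not depend on the measure.

Existence (\<open>q_exchangeable_mixture\<close>): the random level set and greedy filling give a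
\<open>q\<close>-exchangeable measure, because swapping the values at \<open>i\<close> and \<open>i + 1\<close> is either a swap inside the
greedy sequence or leaves the filling alone and moves one point of \<open>S\<close>, and both change the probability by one factor \<open>q\<close>.

Normalisation (\<open>mallows_weight_eq_prob_charge\<close>): the probability that \<open>S\<close> has a given charge is the
weight of the corresponding term of the mixture. Here the \<open>q\<close>-binomial theorem on windows, in the
limit of large windows, takes the place of the Jacobi triple product identity.
\<close>

section \<open>Cylinders in the space of permutations\<close>

lemma space_perm_space: "space perm_space = {\<omega>. bij \<omega>}"
  unfolding perm_space_def by (rule space_measure_of) auto

lemma sets_perm_space:
  "sets perm_space = sigma_sets {\<omega>. bij \<omega>} {{\<omega>. bij \<omega> \<and> \<omega> i \<in> A} | i A. True}"
  unfolding perm_space_def by (rule sets_measure_of) auto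

lemma measurable_coordinate_perm_space:
  "(\<lambda>\<omega>. \<omega> i) \<in> measurable perm_space (count_space UNIV)"
proof (rule measurableI)
  fix A :: "int set"
  have "(\<lambda>\<omega>. \<omega> i) -` A \<inter> space perm_space = {\<omega>. bij \<omega> \<and> \<omega> i \<in> A}"
    by (auto simp: space_perm_space)
  then show "(\<lambda>\<omega>. \<omega> i) -` A \<inter> space perm_space \<in> sets perm_space"
    unfolding sets_perm_space by (auto intro: sigma_sets.Basic)
qed auto

lemma measurable_into_perm_space:
  assumes "\<And>w. w \<in> space M \<Longrightarrow> bij (f w)"
    and "\<And>i. (\<lambda>w. f w i) \<in> measurable M (count_space UNIV)"
  shows "f \<in> measurable M perm_space"
  unfolding perm_space_def
proof (rule measurable_sigma_sets)
  show "sets (sigma {\<omega>. bij \<omega>} {{\<omega>. bij \<omega> \<and> \<omega> i \<in> A} | i A. True})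
      = sigma_sets {\<omega>. bij \<omega>} {{\<omega>. bij \<omega> \<and> \<omega> i \<in> A} | (i :: int) (A :: int set). True}"
    by (rule sets_measure_of) auto
  fix y assume "y \<in> {{\<omega>. bij \<omega> \<and> \<omega> i \<in> A} | (i :: int) (A :: int set). True}"
  then obtain i :: int and A :: "int set" where y: "y = {\<omega>. bij \<omega> \<and> \<omega> i \<in> A}" by blast
  have "f -` y \<inter> space M = (\<lambda>w. f w i) -` A \<inter> space M"
    using assms(1) y by auto
  then show "f -` y \<inter> space M \<in> sets M"
    using measurable_sets[OF assms(2), of A i] by simp
qed (use assms(1) in auto)

definition cylinder :: "int set \<Rightarrow> (int \<Rightarrow> int) \<Rightarrow> (int \<Rightarrow> int) set" where
  "cylinder V y = {\<omega>. bij \<omega> \<and> (\<forall>j\<in>V. \<omega> j = y j)}"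

lemma cylinder_in_sets [measurable]:
  assumes "finite V" shows "cylinder V y \<in> sets perm_space"
proof -
  have "cylinder V y = {\<omega>\<in>space perm_space. \<forall>j\<in>V. \<omega> j = y j}"
    by (auto simp: cylinder_def space_perm_space)
  also have "\<dots> \<in> sets perm_space"
    using assms measurable_coordinate_perm_space[measurable] by measurable
  finally show ?thesis .
qed

lemma cylinder_eq_empty: "\<not> inj_on y V \<Longrightarrow> cylinder V y = {}"
  unfolding cylinder_def
proof safe
  fix \<omega> :: "int \<Rightarrow> int" assume "bij \<omega>" "\<forall>j\<in>V. \<omega> j = y j" "\<not> inj_on y V"
  then show "\<omega> \<in> {}"
    by (metis bij_is_inj inj_on_cong inj_on_subset subset_UNIV)
qed

lemma prob_eq_cylinder:
  assumes "sets P = sets perm_space"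
  shows "\<P>(\<omega> in P. \<forall>j\<in>V. \<omega> j = y j) = measure P (cylinder V y)"
  using sets_eq_imp_space_eq[OF assms]
  by (simp add: cylinder_def space_perm_space Collect_conj_eq)

text \<open>Finite cylinders form a generator that is stable under intersection: a nonempty intersection of
two cylinders is again a cylinder, through any of its points.\<close>

lemma perm_measure_eqI:
  assumes P: "prob_space P" "sets P = sets perm_space"
    and Q: "prob_space Q" "sets Q = sets perm_space"
    and eq: "\<And>V y. finite V \<Longrightarrow> inj_on y V \<Longrightarrow> measure P (cylinder V y) = measure Q (cylinder V y)"
  shows "P = Q"
proof -
  interpret P: prob_space P by fact
  interpret Q: prob_space Q by fact
  let ?\<Omega> = "{\<omega>::int \<Rightarrow> int. bij \<omega>}"
  let ?E = "insert {} {cylinder V y | V y. finite V}"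
  have cyl: "X \<in> sets perm_space" if "X \<in> ?E" for X
    using that cylinder_in_sets by auto
  have coord: "{\<omega>. bij \<omega> \<and> \<omega> i \<in> A} \<in> sigma_sets ?\<Omega> ?E" for i A
  proof -
    have "{\<omega>. bij \<omega> \<and> \<omega> i \<in> A} = (\<Union>a\<in>A. cylinder {i} (\<lambda>_. a))"
      by (auto simp: cylinder_def)
    also have "\<dots> \<in> sigma_sets ?\<Omega> ?E"
      by (intro sigma_sets_UNION countable_image) (auto intro!: sigma_sets.Basic)
    finally show ?thesis .
  qed
  have sets_eq: "sets perm_space = sigma_sets ?\<Omega> ?E"
  proof (rule antisym)
    show "sets perm_space \<subseteq> sigma_sets ?\<Omega> ?E"
      unfolding sets_perm_space by (rule sigma_sets_mono) (use coord in auto)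
    show "sigma_sets ?\<Omega> ?E \<subseteq> sets perm_space"
      using sets.sigma_sets_subset[of ?E perm_space] cyl by (auto simp: space_perm_space)
  qed
  show ?thesis
  proof (rule measure_eqI_generator_eq[where E = ?E and \<Omega> = ?\<Omega> and A = "\<lambda>_. ?\<Omega>"])
    show "Int_stable ?E"
    proof (rule Int_stableI)
      fix a b assume "a \<in> ?E" "b \<in> ?E"
      show "a \<inter> b \<in> ?E"
      proof (cases "a \<inter> b = {}")
        case False
        then have "a \<noteq> {}" "b \<noteq> {}" by auto
        then obtain V y V' y' where ab: "a = cylinder V y" "finite V" "b = cylinder V' y'" "finite V'"
          using \<open>a \<in> ?E\<close> \<open>b \<in> ?E\<close> by blast
        obtain \<omega>0 where "\<omega>0 \<in> a \<inter> b" using False by blast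
        then have "a \<inter> b = cylinder (V \<union> V') \<omega>0"
          unfolding ab cylinder_def by auto
        moreover have "finite (V \<union> V')" using ab by simp
        ultimately show ?thesis by blast
      qed simp
    qed
    show "?E \<subseteq> Pow ?\<Omega>" by (auto simp: cylinder_def)
    show "emeasure P X = emeasure Q X" if XE: "X \<in> ?E" for X
    proof (cases "X = {}")
      case False
      then obtain V y where X: "X = cylinder V y" "finite V" using XE by blast
      then have "inj_on y V" using False cylinder_eq_empty by blast
      then show ?thesis using eq X by (simp add: P.emeasure_eq_measure Q.emeasure_eq_measure)
    qed simp
    show "sets P = sigma_sets ?\<Omega> ?E" "sets Q = sigma_sets ?\<Omega> ?E"
      using P Q sets_eq by auto
    have "?\<Omega> = cylinder {} (\<lambda>_. 0)" by (auto simp: cylinder_def)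
    then have "?\<Omega> \<in> ?E" by blast
    then show "range (\<lambda>_. ?\<Omega>) \<subseteq> ?E" by blast
    show "(\<Union>i::nat. ?\<Omega>) = ?\<Omega>" by simp
    show "emeasure P ?\<Omega> \<noteq> \<infinity>" by simp
  qed
qed

lemma q_exchangeable_iff_cylinder:
  "q_exchangeable q P \<longleftrightarrow> prob_space P \<and> sets P = sets perm_space \<and>
     (\<forall>i I y. finite I \<longrightarrow> i \<in> I \<longrightarrow> i + 1 \<in> I \<longrightarrow> inj_on y I \<longrightarrow>
        measure P (cylinder I (y \<circ> Transposition.transpose i (i + 1))) =
        q powi sgn (y (i + 1) - y i) * measure P (cylinder I y))"
proof -
  have "y(i := y (i + 1), i + 1 := y i) = y \<circ> Transposition.transpose i (i + 1)" for y :: "int \<Rightarrow> int" and i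
    by (auto simp: fun_eq_iff Transposition.transpose_def)
  then show ?thesis
    unfolding q_exchangeable_def by (intro conj_cong refl) (simp add: prob_eq_cylinder o_def)
qed

section \<open>Uniqueness of the balanced exchangeable measure\<close>

text \<open>The factor picked up by an adjacent swap is \<open>q\<close> or \<open>inverse q\<close> according to the order of two values,
and composing with a strictly increasing \<open>\<theta>\<close> does not change that order. Hence the factor \<open>r\<close> of a
general permutation \<open>\<pi>\<close> of the window can be chosen before the measure and \<open>\<theta>\<close>. The permutations for
which this is true of every starting arrangement are closed under composition, so they contain all
transpositions and hence all permutations of the window.\<close>

lemma exchange_ratio_of_permutation:
  fixes a b :: int
  assumes q: "0 < q" and \<pi>: "\<pi> permutes {a..b}"
  shows "\<exists>r\<ge>0. \<forall>P \<theta>. q_exchangeable q P \<longrightarrow> strict_mono_on {a..b} \<theta> \<longrightarrow>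
     measure P (cylinder {a..b} (\<theta> \<circ> \<pi>)) = r * measure P (cylinder {a..b} \<theta>)"
proof -
  let ?W = "{a..b}"
  define ratio where "ratio \<pi> \<tau> r \<longleftrightarrow> 0 \<le> r \<and> (\<forall>P \<theta>. q_exchangeable q P \<longrightarrow> strict_mono_on ?W \<theta> \<longrightarrow>
     measure P (cylinder ?W (\<theta> \<circ> (\<pi> \<circ> \<tau>))) = r * measure P (cylinder ?W (\<theta> \<circ> \<pi>)))" for \<pi> \<tau> r
  define G where "G = {\<tau>. \<forall>\<pi>. \<pi> permutes ?W \<longrightarrow> (\<exists>r. ratio \<pi> \<tau> r)}"
  have "ratio \<pi> id 1" for \<pi> unfolding ratio_def by simp
  then have id_G: "id \<in> G" unfolding G_def by blast
  have comp: "\<tau> \<circ> \<tau>' \<in> G" if \<tau>: "\<tau> \<in> G" and \<tau>': "\<tau>' \<in> G" and perm: "\<tau> permutes ?W" for \<tau> \<tau>'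
    unfolding G_def
  proof (intro CollectI allI impI)
    fix \<pi> assume \<pi>: "\<pi> permutes ?W"
    obtain r where r: "ratio \<pi> \<tau> r" using \<tau> \<pi> unfolding G_def by blast
    have "\<pi> \<circ> \<tau> permutes ?W" using perm \<pi> by (rule permutes_compose)
    then obtain r' where r': "ratio (\<pi> \<circ> \<tau>) \<tau>' r'" using \<tau>' unfolding G_def by blast
    have "ratio \<pi> (\<tau> \<circ> \<tau>') (r' * r)"
      unfolding ratio_def
    proof (intro conjI allI impI)
      show "0 \<le> r' * r" using r r' by (simp add: ratio_def)
      fix P and \<theta> :: "int \<Rightarrow> int" assume P: "q_exchangeable q P" "strict_mono_on ?W \<theta>"
      have "measure P (cylinder ?W (\<theta> \<circ> (\<pi> \<circ> \<tau> \<circ> \<tau>'))) = r' * measure P (cylinder ?W (\<theta> \<circ> (\<pi> \<circ> \<tau>)))"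
        using r' P by (simp only: ratio_def)
      also have "measure P (cylinder ?W (\<theta> \<circ> (\<pi> \<circ> \<tau>))) = r * measure P (cylinder ?W (\<theta> \<circ> \<pi>))"
        using r P by (simp only: ratio_def)
      finally show "measure P (cylinder ?W (\<theta> \<circ> (\<pi> \<circ> (\<tau> \<circ> \<tau>')))) = r' * r * measure P (cylinder ?W (\<theta> \<circ> \<pi>))"
        by (simp only: o_assoc mult.assoc)
    qed
    then show "\<exists>r. ratio \<pi> (\<tau> \<circ> \<tau>') r" by blast
  qed
  have adj: "Transposition.transpose i (i + 1) \<in> G" if i: "i \<in> ?W" "i + 1 \<in> ?W" for i
    unfolding G_def
  proof (intro CollectI allI impI)
    fix \<pi> assume \<pi>: "\<pi> permutes ?W"
    have "ratio \<pi> (Transposition.transpose i (i + 1)) (q powi sgn (\<pi> (i + 1) - \<pi> i))"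
      unfolding ratio_def
    proof (intro conjI allI impI)
      show "0 \<le> q powi sgn (\<pi> (i + 1) - \<pi> i)" using q by simp
      fix P and \<theta> :: "int \<Rightarrow> int" assume P: "q_exchangeable q P" and \<theta>: "strict_mono_on ?W \<theta>"
      have in_W: "\<pi> i \<in> ?W" "\<pi> (i + 1) \<in> ?W"
        using permutes_in_image[OF \<pi>, of i] permutes_in_image[OF \<pi>, of "i + 1"] i by simp_all
      have "inj_on \<theta> ?W" using \<theta> by (rule strict_mono_on_imp_inj_on)
      then have inj: "inj_on (\<theta> \<circ> \<pi>) ?W"
        using \<pi> by (simp add: comp_inj_on permutes_image permutes_inj_on)
      have sgn: "sgn (\<theta> (\<pi> (i + 1)) - \<theta> (\<pi> i)) = sgn (\<pi> (i + 1) - \<pi> i)"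
        using strict_mono_on_less[OF \<theta> in_W] strict_mono_on_less[OF \<theta> in_W(2,1)]
        by (auto simp: sgn_if)
      have "measure P (cylinder ?W (\<theta> \<circ> \<pi> \<circ> Transposition.transpose i (i + 1))) =
         q powi sgn ((\<theta> \<circ> \<pi>) (i + 1) - (\<theta> \<circ> \<pi>) i) * measure P (cylinder ?W (\<theta> \<circ> \<pi>))"
        using P[unfolded q_exchangeable_iff_cylinder] i inj finite_atLeastAtMost_int by (simp only: )
      then show "measure P (cylinder ?W (\<theta> \<circ> (\<pi> \<circ> Transposition.transpose i (i + 1)))) =
         q powi sgn (\<pi> (i + 1) - \<pi> i) * measure P (cylinder ?W (\<theta> \<circ> \<pi>))"
        by (simp only: sgn o_apply o_assoc)
    qed
    then show "\<exists>r. ratio \<pi> (Transposition.transpose i (i + 1)) r" by blast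
  qed
  have upward: "Transposition.transpose i (i + 1 + int n) \<in> G" if "i \<in> ?W" "i + 1 + int n \<in> ?W" for i n
    using that
  proof (induction n arbitrary: i)
    case 0 then show ?case using adj by simp
  next
    case (Suc n)
    let ?s = "Transposition.transpose i (i + 1)" and ?t = "Transposition.transpose (i + 1) (i + 1 + 1 + int n)"
    \<comment> \<open>a longer transposition is conjugate to a shorter one by an adjacent swap\<close>
    have eq: "Transposition.transpose i (i + 1 + int (Suc n)) = ?s \<circ> (?t \<circ> ?s)"
      by (auto simp: fun_eq_iff Transposition.transpose_def)
    have i: "i + 1 \<in> ?W" using Suc.prems by auto
    have "?s \<in> G" using adj Suc.prems i by blast
    moreover have "?t \<in> G" using Suc.IH[OF i] Suc.prems by (simp add: algebra_simps)
    moreover have "?s permutes ?W" "?t permutes ?W"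
      using Suc.prems i by (auto intro!: permutes_swap_id)
    ultimately show ?case unfolding eq by (intro comp)
  qed
  have transp: "Transposition.transpose i j \<in> G" if ij: "i \<in> ?W" "j \<in> ?W" for i j
  proof (cases i j rule: linorder_cases)
    case less
    then show ?thesis using upward[of i "nat (j - i - 1)"] ij by simp
  next
    case equal then show ?thesis using id_G by simp
  next
    case greater
    then show ?thesis using upward[of j "nat (i - j - 1)"] ij by (simp add: transpose_commute)
  qed
  have "\<pi> \<in> G"
    using \<pi> finite_atLeastAtMost_int
  proof (induction rule: permutes_induct)
    case id show ?case by (rule id_G)
  next
    case (swap c d p)
    then show ?case using transp by (intro comp permutes_swap_id) auto
  qed
  then obtain r where "ratio id \<pi> r" unfolding G_def using permutes_id[of ?W] by blast
  then show ?thesis unfolding ratio_def by (intro exI[of _ r]) simp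
qed

text \<open>The induction matches the two maxima and removes them.\<close>

lemma exists_strict_mono_image:
  fixes A B :: "int set"
  assumes "finite A" "finite B" "card A = card B"
  shows "\<exists>\<theta>. strict_mono_on A \<theta> \<and> \<theta> ` A = B"
  using assms
proof (induction "card A" arbitrary: A B)
  case 0
  then show ?case by (intro exI[of _ id]) (simp add: monotone_on_def)
next
  case (Suc n)
  let ?A = "A - {Max A}" and ?B = "B - {Max B}"
  have ne: "A \<noteq> {}" "B \<noteq> {}" using Suc by force+
  then have Max: "Max A \<in> A" "Max B \<in> B" using Suc by auto
  then obtain \<theta> where \<theta>: "strict_mono_on ?A \<theta>" "\<theta> ` ?A = ?B"
    using Suc.hyps(1)[of ?A ?B] Suc.prems Suc.hyps(2)[symmetric] by (force simp: card_Diff_singleton)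
  have lt: "x < Max A" if "x \<in> ?A" for x using that Suc.prems by (auto simp: less_le)
  have lt': "\<theta> x < Max B" if "x \<in> ?A" for x
  proof -
    have "\<theta> x \<in> ?B" using that \<theta>(2) by blast
    then show ?thesis using Suc.prems by (auto simp: less_le)
  qed
  let ?\<theta> = "\<theta>(Max A := Max B)"
  have "strict_mono_on A ?\<theta>"
  proof (rule strict_mono_onI)
    fix x y assume xy: "x \<in> A" "y \<in> A" "x < y"
    have "y \<le> Max A" using xy Suc.prems by simp
    then have x: "x \<in> ?A" using xy by auto
    show "?\<theta> x < ?\<theta> y"
    proof (cases "y = Max A")
      case True then show ?thesis using x lt' by auto
    next
      case False then show ?thesis using x xy strict_mono_onD[OF \<theta>(1), of x y] by auto
    qed
  qed
  moreover have "?\<theta> ` A = B"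
  proof -
    have "?\<theta> ` A = insert (Max B) (\<theta> ` ?A)" using Max by (auto simp: image_iff)
    then show ?thesis using \<theta>(2) Max by auto
  qed
  ultimately show ?case by blast
qed

lemma window_event_in_sets [measurable]:
  fixes a b :: int
  assumes "finite V"
  shows "{\<omega>. bij \<omega> \<and> \<Phi> (\<omega> ` {a..b}) \<and> (\<forall>j\<in>V. \<omega> j = y j)} \<in> sets perm_space"
proof -
  have "{\<omega>. bij \<omega> \<and> \<omega> ` {a..b} = B} \<in> sets perm_space" for B
  proof -
    have "{\<omega>. bij \<omega> \<and> \<omega> ` {a..b} = B} = 
      {\<omega>\<in>space perm_space. (\<forall>j\<in>{a..b}. \<exists>v\<in>B. \<omega> j = v) \<and> (\<forall>v\<in>B. \<exists>j\<in>{a..b}. \<omega> j = v)}"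
      by (auto simp: space_perm_space)
    also have "\<dots> \<in> sets perm_space"
      using measurable_coordinate_perm_space[measurable] by measurable
    finally show ?thesis .
  qed
  then have "(\<Union>B\<in>{B. finite B \<and> \<Phi> B}. {\<omega>. bij \<omega> \<and> \<omega> ` {a..b} = B}) \<in> sets perm_space"
    by (intro sets.countable_UN') (auto intro: countable_subset[OF _ countable_Collect_finite])
  moreover have "{\<omega>. bij \<omega> \<and> \<Phi> (\<omega> ` {a..b}) \<and> (\<forall>j\<in>V. \<omega> j = y j)} = 
     (\<Union>B\<in>{B. finite B \<and> \<Phi> B}. {\<omega>. bij \<omega> \<and> \<omega> ` {a..b} = B}) \<inter> cylinder V y"
    by (auto simp: cylinder_def)
  ultimately show ?thesis using assms by auto
qed


text \<open>Given that the window is mapped onto \<open>\<theta> ` {a..b}\<close>, the restriction of the permutation to the window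
is a finite Mallows permutation of the window followed by \<open>\<theta>\<close>. If \<open>\<theta>\<close> fixes the prescribed values, prescribing them for \<open>\<omega>\<close> or
for the finite permutation is the same thing, and the conditional probability \<open>\<kappa>\<close> is a ratio of two
sums of exchange ratios in which neither the measure nor \<open>\<theta>\<close> occurs.\<close>

lemma conditional_law_on_window:
  fixes a b :: int
  assumes q: "0 < q" and V: "V \<subseteq> {a..b}"
  shows "\<exists>\<kappa>. 0 \<le> \<kappa> \<and> \<kappa> \<le> 1 \<and> (\<forall>P \<theta>. q_exchangeable q P \<longrightarrow> strict_mono_on {a..b} \<theta> \<longrightarrow>
     (\<forall>j\<in>V. \<forall>w\<in>{a..b}. \<theta> w = y j \<longleftrightarrow> w = y j) \<longrightarrow>
     measure P {\<omega>. bij \<omega> \<and> \<omega> ` {a..b} = \<theta> ` {a..b} \<and> (\<forall>j\<in>V. \<omega> j = y j)} =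
     \<kappa> * measure P {\<omega>. bij \<omega> \<and> \<omega> ` {a..b} = \<theta> ` {a..b}})"
proof -
  let ?W = "{a..b}"
  let ?S = "{\<pi>. \<pi> permutes ?W}"
  let ?T = "{\<pi>. \<pi> permutes ?W \<and> (\<forall>j\<in>V. \<pi> j = y j)}"
  have "\<forall>\<pi>\<in>?S. \<exists>r\<ge>0. \<forall>P \<theta>. q_exchangeable q P \<longrightarrow> strict_mono_on ?W \<theta> \<longrightarrow>
     measure P (cylinder ?W (\<theta> \<circ> \<pi>)) = r * measure P (cylinder ?W \<theta>)"
    using exchange_ratio_of_permutation[OF q] by blast
  then obtain r0 where r0: "\<And>\<pi>. \<pi> \<in> ?S \<Longrightarrow> r0 \<pi> \<ge> 0"
    "\<And>\<pi> P \<theta>. \<pi> \<in> ?S \<Longrightarrow> q_exchangeable q P \<Longrightarrow> strict_mono_on ?W \<theta> \<Longrightarrow>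
     measure P (cylinder ?W (\<theta> \<circ> \<pi>)) = r0 \<pi> * measure P (cylinder ?W \<theta>)"
    by (metis (no_types, lifting) bchoice)
  \<comment> \<open>the ratio of the identity is pinned to 1 to make the denominator positive\<close>
  define r where "r = r0(id := 1)"
  have r: "r \<pi> \<ge> 0" if "\<pi> \<in> ?S" for \<pi> using that r0(1) by (simp add: r_def)
  have ratio: "measure P (cylinder ?W (\<theta> \<circ> \<pi>)) = r \<pi> * measure P (cylinder ?W \<theta>)"
    if "\<pi> \<in> ?S" "q_exchangeable q P" "strict_mono_on ?W \<theta>" for \<pi> P \<theta>
    using r0(2)[OF that] by (cases "\<pi> = id") (simp_all add: r_def)
  have fin: "finite ?S" by (simp add: finite_permutations)
  have "r id \<le> (\<Sum>\<pi>\<in>?S. r \<pi>)" 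
    by (rule member_le_sum[OF _ _ fin]) (use r permutes_id in blast)+
  then have Z: "(\<Sum>\<pi>\<in>?S. r \<pi>) > 0" by (simp add: r_def)
  define \<kappa> where "\<kappa> = (\<Sum>\<pi>\<in>?T. r \<pi>) / (\<Sum>\<pi>\<in>?S. r \<pi>)"
  have "0 \<le> (\<Sum>\<pi>\<in>?T. r \<pi>)" using r by (auto intro!: sum_nonneg)
  moreover have "(\<Sum>\<pi>\<in>?T. r \<pi>) \<le> (\<Sum>\<pi>\<in>?S. r \<pi>)"
    using r fin by (intro sum_mono2) auto
  ultimately have \<kappa>: "0 \<le> \<kappa>" "\<kappa> \<le> 1" using Z unfolding \<kappa>_def by auto
  have law: "measure P {\<omega>. bij \<omega> \<and> \<omega> ` ?W = \<theta> ` ?W \<and> (\<forall>j\<in>V'. \<omega> j = y j)} = 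
      (\<Sum>\<pi>\<in>{\<pi>. \<pi> permutes ?W \<and> (\<forall>j\<in>V'. \<pi> j = y j)}. r \<pi>) * measure P (cylinder ?W \<theta>)"
    if P: "q_exchangeable q P" and \<theta>: "strict_mono_on ?W \<theta>" and V': "V' \<subseteq> ?W"
      and fixed: "\<forall>j\<in>V'. \<forall>w\<in>?W. \<theta> w = y j \<longleftrightarrow> w = y j" for P \<theta> V'
  proof -
    let ?U = "{\<pi>. \<pi> permutes ?W \<and> (\<forall>j\<in>V'. \<pi> j = y j)}"
    have prob: "prob_space P" and sets: "sets P = sets perm_space"
      using P unfolding q_exchangeable_def by auto
    interpret prob_space P by fact
    have inj: "inj_on \<theta> ?W" using \<theta> by (rule strict_mono_on_imp_inj_on)
    have event: "{\<omega>. bij \<omega> \<and> \<omega> ` ?W = \<theta> ` ?W \<and> (\<forall>j\<in>V'. \<omega> j = y j)} = (\<Union>\<pi>\<in>?U. cylinder ?W (\<theta> \<circ> \<pi>))"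
    proof (intro equalityI subsetI)
      fix \<omega> assume "\<omega> \<in> {\<omega>. bij \<omega> \<and> \<omega> ` ?W = \<theta> ` ?W \<and> (\<forall>j\<in>V'. \<omega> j = y j)}"
      then have \<omega>: "bij \<omega>" "\<omega> ` ?W = \<theta> ` ?W" "\<forall>j\<in>V'. \<omega> j = y j" by auto
      define \<pi> where "\<pi> j = (if j \<in> ?W then the_inv_into ?W \<theta> (\<omega> j) else j)" for j
      have in_im: "\<omega> j \<in> \<theta> ` ?W" if "j \<in> ?W" for j using \<omega>(2) that by blast
      have \<theta>\<pi>: "\<theta> (\<pi> j) = \<omega> j" if "j \<in> ?W" for j
        using f_the_inv_into_f[OF inj in_im[OF that]] that by (simp add: \<pi>_def)
      have \<pi>W: "\<pi> j \<in> ?W" if "j \<in> ?W" for j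
        using the_inv_into_into[OF inj in_im[OF that], of ?W] that by (simp add: \<pi>_def)
      have "inj_on \<pi> ?W"
      proof (rule inj_onI)
        fix u v assume "u \<in> ?W" "v \<in> ?W" "\<pi> u = \<pi> v"
        then have "\<omega> u = \<omega> v" using \<theta>\<pi> by metis
        then show "u = v" using \<omega>(1) by (simp add: bij_is_inj inj_eq)
      qed
      then have "bij_betw \<pi> ?W ?W"
        using \<pi>W unfolding bij_betw_def by (intro conjI endo_inj_surj image_subsetI) auto
      then have "\<pi> permutes ?W"
        by (rule bij_imp_permutes) (auto simp: \<pi>_def)
      moreover have "\<pi> j = y j" if j: "j \<in> V'" for j
      proof -
        have "j \<in> ?W" using j V' by blast
        then have "\<theta> (\<pi> j) = y j" "\<pi> j \<in> ?W" using \<theta>\<pi> \<pi>W \<omega>(3) j by auto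
        then show ?thesis using fixed j by blast
      qed
      ultimately have "\<pi> \<in> ?U" by blast
      moreover have "\<omega> \<in> cylinder ?W (\<theta> \<circ> \<pi>)" using \<omega>(1) \<theta>\<pi> by (simp add: cylinder_def)
      ultimately show "\<omega> \<in> (\<Union>\<pi>\<in>?U. cylinder ?W (\<theta> \<circ> \<pi>))" by blast
    next
      fix \<omega> assume "\<omega> \<in> (\<Union>\<pi>\<in>?U. cylinder ?W (\<theta> \<circ> \<pi>))"
      then obtain \<pi> where \<pi>: "\<pi> permutes ?W" "\<forall>j\<in>V'. \<pi> j = y j" and \<omega>: "bij \<omega>" "\<forall>j\<in>?W. \<omega> j = \<theta> (\<pi> j)"
        by (auto simp: cylinder_def)
      have "\<omega> ` ?W = (\<lambda>j. \<theta> (\<pi> j)) ` ?W" using \<omega>(2) by (intro image_cong) auto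
      also have "\<dots> = \<theta> ` (\<pi> ` ?W)" by (simp add: image_image)
      also have "\<dots> = \<theta> ` ?W" using permutes_image[OF \<pi>(1)] by simp
      finally have "\<omega> ` ?W = \<theta> ` ?W" .
      moreover have "\<omega> j = y j" if j: "j \<in> V'" for j
      proof -
        have W: "j \<in> ?W" using j V' by blast
        then have "\<pi> j \<in> ?W" using permutes_in_image[OF \<pi>(1)] by blast
        then show ?thesis using \<omega>(2) \<pi>(2) fixed j W by fastforce
      qed
      ultimately show "\<omega> \<in> {\<omega>. bij \<omega> \<and> \<omega> ` ?W = \<theta> ` ?W \<and> (\<forall>j\<in>V'. \<omega> j = y j)}"
        using \<omega>(1) by simp
    qed
    have "measure P (\<Union>\<pi>\<in>?U. cylinder ?W (\<theta> \<circ> \<pi>)) = (\<Sum>\<pi>\<in>?U. measure P (cylinder ?W (\<theta> \<circ> \<pi>)))"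
    proof (rule finite_measure_finite_Union)
      show "finite ?U" by (rule finite_subset[OF _ fin]) auto
      show "(\<lambda>\<pi>. cylinder ?W (\<theta> \<circ> \<pi>)) ` ?U \<subseteq> events"
        using sets cylinder_in_sets[of ?W] by auto
      show "disjoint_family_on (\<lambda>\<pi>. cylinder ?W (\<theta> \<circ> \<pi>)) ?U"
        unfolding disjoint_family_on_def
      proof (intro ballI impI equals0I)
        fix \<pi> \<pi>' \<omega> assume *: "\<pi> \<in> ?U" "\<pi>' \<in> ?U" "\<pi> \<noteq> \<pi>'" "\<omega> \<in> cylinder ?W (\<theta> \<circ> \<pi>) \<inter> cylinder ?W (\<theta> \<circ> \<pi>')"
        have "\<pi> j = \<pi>' j" for j
        proof (cases "j \<in> ?W")
          case True
          then have "\<theta> (\<pi> j) = \<theta> (\<pi>' j)" using *(4) by (auto simp: cylinder_def)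
          moreover have "\<pi> j \<in> ?W" "\<pi>' j \<in> ?W" 
            using True *(1,2) permutes_in_image[of \<pi> ?W j] permutes_in_image[of \<pi>' ?W j] by simp_all
          ultimately show ?thesis using inj by (auto dest: inj_onD)
        next
          case False
          then have "\<pi> j = j" "\<pi>' j = j"
            using *(1,2) permutes_not_in[of \<pi> ?W j] permutes_not_in[of \<pi>' ?W j] by simp_all
          then show ?thesis by simp
        qed
        then show False using *(3) by auto
      qed
    qed
    also have "\<dots> = (\<Sum>\<pi>\<in>?U. r \<pi> * measure P (cylinder ?W \<theta>))"
    proof (rule sum.cong[OF refl])
      fix \<pi> assume "\<pi> \<in> ?U"
      then have "\<pi> \<in> ?S" by blast
      then show "measure P (cylinder ?W (\<theta> \<circ> \<pi>)) = r \<pi> * measure P (cylinder ?W \<theta>)"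
        by (rule ratio[OF _ P \<theta>])
    qed
    finally show ?thesis unfolding event by (simp add: sum_distrib_right)
  qed
  show ?thesis
  proof (intro exI[of _ \<kappa>] conjI \<kappa> allI impI)
    fix P and \<theta> :: "int \<Rightarrow> int" assume P: "q_exchangeable q P" and \<theta>: "strict_mono_on ?W \<theta>"
      and fixed: "\<forall>j\<in>V. \<forall>w\<in>?W. \<theta> w = y j \<longleftrightarrow> w = y j"
    show "measure P {\<omega>. bij \<omega> \<and> \<omega> ` ?W = \<theta> ` ?W \<and> (\<forall>j\<in>V. \<omega> j = y j)} =
       \<kappa> * measure P {\<omega>. bij \<omega> \<and> \<omega> ` ?W = \<theta> ` ?W}"
      using law[OF P \<theta> V fixed] law[OF P \<theta>, of "{}"] Z by (simp add: \<kappa>_def)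
  qed
qed

text \<open>The set of values on the window \<open>{1 - n..n}\<close> looks, as far as \<open>{- L..L}\<close> is concerned, like the window
itself: it contains \<open>{- L..L}\<close>, and as many of its elements are nonpositive.\<close>

definition saturated :: "nat \<Rightarrow> nat \<Rightarrow> int set \<Rightarrow> bool" where
  "saturated L n B \<longleftrightarrow> finite B \<and> card B = 2 * n \<and> {- int L..int L} \<subseteq> B \<and> card {b \<in> B. b \<le> 0} = n"

text \<open>An element of \<open>{- L..L}\<close> has the same rank in \<open>B\<close> as in the window, since both sets contain
\<open>{- L..L}\<close> and have the same number of nonpositive elements.\<close>

lemma saturated_embedding:
  assumes B: "saturated L n B" and L: "L < n"
  shows "\<exists>\<theta>. strict_mono_on {1 - int n..int n} \<theta> \<and> \<theta> ` {1 - int n..int n} = B \<and>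
    (\<forall>v\<in>{- int L..int L}. \<forall>w\<in>{1 - int n..int n}. \<theta> w = v \<longleftrightarrow> w = v)"
proof -
  let ?W = "{1 - int n..int n}"
  have fin: "finite B" and sub: "{- int L..int L} \<subseteq> B" and card0: "card {b \<in> B. b \<le> 0} = n"
    using B by (auto simp: saturated_def)
  have "card ?W = card B" using B by (simp add: saturated_def)
  then obtain \<theta> where \<theta>: "strict_mono_on ?W \<theta>" "\<theta> ` ?W = B"
    using exists_strict_mono_image[of ?W B] fin by auto
  have rank_B: "int (card {b \<in> B. b < v}) = int n - 1 + v" if v: "v \<in> {- int L..int L}" for v
  proof (cases "v \<le> 0")
    case True
    have "{v..0} \<subseteq> B" using sub v by force
    then have "{b \<in> B. b \<le> 0} = {b \<in> B. b < v} \<union> {v..0}" using True by auto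
    moreover have "card ({b \<in> B. b < v} \<union> {v..0}) = card {b \<in> B. b < v} + card {v..0}"
      using fin by (intro card_Un_disjoint) auto
    ultimately show ?thesis using card0 True by simp
  next
    case False
    have "{1..v - 1} \<subseteq> B" using sub v by force
    then have "{b \<in> B. b < v} = {b \<in> B. b \<le> 0} \<union> {1..v - 1}" using False by auto
    moreover have "card ({b \<in> B. b \<le> 0} \<union> {1..v - 1}) = card {b \<in> B. b \<le> 0} + card {1..v - 1}"
      using fin by (intro card_Un_disjoint) auto
    ultimately show ?thesis using card0 False by simp
  qed
  have rank_W: "u = v" if u: "u \<in> ?W" "\<theta> u = v" and v: "v \<in> {- int L..int L}" for u v
  proof -
    have "w < u \<longleftrightarrow> \<theta> w < v" if "w \<in> ?W" for w
      using strict_mono_on_less[OF \<theta>(1) that u(1)] u(2) by simp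
    then have "\<theta> ` {w \<in> ?W. w < u} = {b \<in> \<theta> ` ?W. b < v}" by auto
    then have "\<theta> ` {w \<in> ?W. w < u} = {b \<in> B. b < v}" using \<theta>(2) by simp
    moreover have "card (\<theta> ` {w \<in> ?W. w < u}) = card {w \<in> ?W. w < u}"
      by (rule card_image[OF inj_on_subset[OF strict_mono_on_imp_inj_on[OF \<theta>(1)]]]) auto
    ultimately have "card {b \<in> B. b < v} = card {w \<in> ?W. w < u}" by simp
    also have "{w \<in> ?W. w < u} = {1 - int n..u - 1}" using u by auto
    finally show ?thesis using rank_B[OF v] u by auto
  qed
  have "\<theta> w = v \<longleftrightarrow> w = v" if v: "v \<in> {- int L..int L}" and w: "w \<in> ?W" for v w
  proof -
    obtain u where "u \<in> ?W" "\<theta> u = v" using v sub \<theta>(2) by blast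
    then show ?thesis using rank_W[OF _ _ v] w by metis
  qed
  then show ?thesis using \<theta> by (intro exI[of _ \<theta>] conjI ballI) simp_all
qed

text \<open>Once the window contains the finitely many positions that cross the origin, the crossings in the
two directions cancel in the count of nonpositive values.\<close>

lemma balanced_imp_eventually_saturated:
  assumes \<omega>: "bij \<omega>" "balanced \<omega>"
  shows "\<exists>N. \<forall>n\<ge>N. saturated L n (\<omega> ` {1 - int n..int n})"
proof -
  let ?D = "{j. j > 0 \<and> \<omega> j \<le> 0}" and ?U = "{j. j \<le> 0 \<and> \<omega> j > 0}" and ?F = "\<omega> -` {- int L..int L}"
  have fin: "finite ?D" "finite ?U" and card_eq: "card ?D = card ?U"
    using \<omega>(2) by (auto simp: balanced_def)
  have inj: "inj \<omega>" using \<omega> by (simp add: bij_is_inj)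
  have "finite (?D \<union> ?U \<union> ?F)" using fin finite_vimageI[OF _ inj] by auto
  then have "finite ((\<lambda>j. nat \<bar>j\<bar>) ` (?D \<union> ?U \<union> ?F))" by simp
  then obtain N where N: "\<forall>k\<in>(\<lambda>j. nat \<bar>j\<bar>) ` (?D \<union> ?U \<union> ?F). k < N"
    using finite_nat_set_iff_bounded by blast
  have "saturated L n (\<omega> ` {1 - int n..int n})" if n: "n \<ge> N" for n
  proof -
    let ?W = "{1 - int n..int n}"
    have W: "?D \<union> ?U \<union> ?F \<subseteq> ?W"
    proof
      fix j assume "j \<in> ?D \<union> ?U \<union> ?F"
      then have "nat \<bar>j\<bar> < N" using N by blast
      then show "j \<in> ?W" using n by auto
    qed
    have "{- int L..int L} \<subseteq> \<omega> ` ?W"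
    proof
      fix v assume v: "v \<in> {- int L..int L}"
      obtain j where "v = \<omega> j" using \<omega>(1) by (meson bij_pointE)
      then show "v \<in> \<omega> ` ?W" using v W by blast
    qed
    moreover have "card (\<omega> ` ?W) = 2 * n"
      using card_image[OF inj_on_subset[OF inj subset_UNIV], of ?W] by simp
    moreover have "card {b \<in> \<omega> ` ?W. b \<le> 0} = n"
    proof -
      have "{b \<in> \<omega> ` ?W. b \<le> 0} = \<omega> ` {j \<in> ?W. \<omega> j \<le> 0}" by auto
      then have "card {b \<in> \<omega> ` ?W. b \<le> 0} = card {j \<in> ?W. \<omega> j \<le> 0}"
        using card_image[OF inj_on_subset[OF inj subset_UNIV]] by simp
      also have "{j \<in> ?W. \<omega> j \<le> 0} = ({1 - int n..0} - ?U) \<union> ?D" using W by auto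
      also have "card \<dots> = card ({1 - int n..0} - ?U) + card ?D"
        using fin by (intro card_Un_disjoint) auto
      finally have *: "card {b \<in> \<omega> ` ?W. b \<le> 0} = card ({1 - int n..0} - ?U) + card ?D" .
      have "?U \<subseteq> {1 - int n..0}" using W by auto
      then have "card ({1 - int n..0} - ?U) = n - card ?U" "card ?U \<le> n"
        using fin card_mono[of "{1 - int n..0}" ?U] by (auto simp: card_Diff_subset)
      then show ?thesis using card_eq * by simp
    qed
    ultimately show ?thesis by (simp add: saturated_def)
  qed
  then show ?thesis by blast
qed

text \<open>The conditional law is summed over the countably many possible sets of values on the window.\<close>

lemma cylinder_prob_saturated:
  assumes q: "0 < q" and L: "L < n" and V: "V \<subseteq> {- int L..int L}" and y: "y ` V \<subseteq> {- int L..int L}"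
  shows "\<exists>\<kappa>. 0 \<le> \<kappa> \<and> \<kappa> \<le> 1 \<and> (\<forall>P. q_exchangeable q P \<longrightarrow>
    measure P {\<omega>. bij \<omega> \<and> saturated L n (\<omega> ` {1 - int n..int n}) \<and> (\<forall>j\<in>V. \<omega> j = y j)} =
    \<kappa> * measure P {\<omega>. bij \<omega> \<and> saturated L n (\<omega> ` {1 - int n..int n})})"
proof -
  let ?W = "{1 - int n..int n}"
  have VW: "V \<subseteq> ?W" using V L by force
  then have finV: "finite V" by (rule finite_subset) simp
  obtain \<kappa> where \<kappa>: "0 \<le> \<kappa>" "\<kappa> \<le> 1" and law: "\<And>P \<theta>. q_exchangeable q P \<Longrightarrow> strict_mono_on ?W \<theta> \<Longrightarrow>
     (\<forall>j\<in>V. \<forall>w\<in>?W. \<theta> w = y j \<longleftrightarrow> w = y j) \<Longrightarrow>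
     measure P {\<omega>. bij \<omega> \<and> \<omega> ` ?W = \<theta> ` ?W \<and> (\<forall>j\<in>V. \<omega> j = y j)} =
     \<kappa> * measure P {\<omega>. bij \<omega> \<and> \<omega> ` ?W = \<theta> ` ?W}"
    using conditional_law_on_window[OF q VW] by blast
  show ?thesis
  proof (intro exI[of _ \<kappa>] conjI \<kappa> allI impI)
    fix P assume P: "q_exchangeable q P"
    then interpret prob_space P by (simp add: q_exchangeable_def)
    have sets: "sets P = sets perm_space" using P by (simp add: q_exchangeable_def)
    let ?\<B> = "{B. saturated L n B}"
    let ?E = "\<lambda>V B. {\<omega>. bij \<omega> \<and> \<omega> ` ?W = B \<and> (\<forall>j\<in>V. \<omega> j = y j)}"
    have count: "countable ?\<B>"
      by (rule countable_subset[OF _ countable_Collect_finite]) (auto simp: saturated_def)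
    have E_sets: "?E V' B \<in> sets P" if "finite V'" for V' B
      using window_event_in_sets[OF that, of "\<lambda>X. X = B"] sets by simp
    have decomp: "emeasure P {\<omega>. bij \<omega> \<and> saturated L n (\<omega> ` ?W) \<and> (\<forall>j\<in>V'. \<omega> j = y j)} =
        (\<integral>\<^sup>+B. emeasure P (?E V' B) \<partial>count_space ?\<B>)" if "finite V'" for V'
    proof -
      have "{\<omega>. bij \<omega> \<and> saturated L n (\<omega> ` ?W) \<and> (\<forall>j\<in>V'. \<omega> j = y j)} = (\<Union>B\<in>?\<B>. ?E V' B)" by auto
      then show ?thesis
        using E_sets[OF that] count
        by (simp only:) (rule emeasure_UN_countable, auto simp: disjoint_family_on_def)
    qed
    have "emeasure P (?E V B) = ennreal \<kappa> * emeasure P (?E {} B)" if B: "B \<in> ?\<B>" for B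
    proof -
      obtain \<theta> where \<theta>: "strict_mono_on ?W \<theta>" "\<theta> ` ?W = B"
        "\<forall>v\<in>{- int L..int L}. \<forall>w\<in>?W. \<theta> w = v \<longleftrightarrow> w = v"
        using saturated_embedding[OF _ L] B by blast
      then have "measure P (?E V B) = \<kappa> * measure P (?E {} B)"
        using law[OF P \<theta>(1)] y by (simp add: image_subset_iff)
      then show ?thesis by (simp add: emeasure_eq_measure ennreal_mult \<kappa>)
    qed
    then have "(\<integral>\<^sup>+B. emeasure P (?E V B) \<partial>count_space ?\<B>) = 
       (\<integral>\<^sup>+B. ennreal \<kappa> * emeasure P (?E {} B) \<partial>count_space ?\<B>)"
      by (intro nn_integral_cong) simp
    also have "\<dots> = ennreal \<kappa> * (\<integral>\<^sup>+B. emeasure P (?E {} B) \<partial>count_space ?\<B>)"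
      by (rule nn_integral_cmult) simp
    finally have "ennreal (measure P {\<omega>. bij \<omega> \<and> saturated L n (\<omega> ` ?W) \<and> (\<forall>j\<in>V. \<omega> j = y j)}) =
        ennreal (\<kappa> * measure P {\<omega>. bij \<omega> \<and> saturated L n (\<omega> ` ?W)})"
      using decomp[OF finV] decomp[of "{}"] by (simp add: emeasure_eq_measure ennreal_mult \<kappa>)
    then show "measure P {\<omega>. bij \<omega> \<and> saturated L n (\<omega> ` ?W) \<and> (\<forall>j\<in>V. \<omega> j = y j)} =
        \<kappa> * measure P {\<omega>. bij \<omega> \<and> saturated L n (\<omega> ` ?W)}"
      by (simp add: \<kappa>)
  qed
qed

lemma prob_saturated_tendsto_1:
  assumes P: "prob_space P" "sets P = sets perm_space" and bal: "AE \<sigma> in P. balanced \<sigma>"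
  shows "(\<lambda>n. measure P {\<omega>. bij \<omega> \<and> saturated L n (\<omega> ` {1 - int n..int n})}) \<longlonglongrightarrow> 1"
proof -
  interpret prob_space P by fact
  have space: "space P = {\<omega>. bij \<omega>}" using sets_eq_imp_space_eq[OF P(2)] space_perm_space by simp
  define S where "S n = {\<omega>. bij \<omega> \<and> saturated L n (\<omega> ` {1 - int n..int n})}" for n
  have S: "S n \<in> events" for n
    using window_event_in_sets[of "{}" "saturated L n" "1 - int n" "int n" "\<lambda>_. 0"] P(2) by (simp add: S_def)
  define H where "H N = (\<Inter>n\<in>{N..}. S n)" for N
  have H: "H N \<in> events" for N unfolding H_def by (intro sets.countable_INT') (use S in auto)
  have inc: "incseq H" unfolding H_def incseq_def by auto
  have "AE \<omega> in P. \<omega> \<in> (\<Union>N. H N)"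
    using bal AE_space
  proof eventually_elim
    case (elim \<omega>)
    then have "bij \<omega>" by (simp add: space)
    then show ?case using balanced_imp_eventually_saturated[OF _ elim(1), of L]
      by (auto simp: H_def S_def)
  qed
  then have "prob (\<Union>N. H N) = 1" using H by (subst prob_eq_1) auto
  then have "(\<lambda>N. prob (H N)) \<longlonglongrightarrow> 1"
    using finite_Lim_measure_incseq[OF _ inc] H by (metis image_subsetI)
  then have "(\<lambda>n. prob (S n)) \<longlonglongrightarrow> 1"
  proof (rule tendsto_sandwich[rotated 2])
    have "prob (H n) \<le> prob (S n)" for n
      using S by (intro finite_measure_mono) (auto simp: H_def)
    then show "\<forall>\<^sub>F n in sequentially. prob (H n) \<le> prob (S n)" by simp
    show "\<forall>\<^sub>F n in sequentially. prob (S n) \<le> 1" by simp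
  qed (rule tendsto_const)
  then show ?thesis unfolding S_def .
qed

text \<open>The probability of a cylinder differs from \<open>\<kappa> n\<close> by at most the probability that the window of size
\<open>n\<close> is not saturated, which tends to zero; and \<open>\<kappa> n\<close> is the same for both measures.\<close>

lemma q_exchangeable_balanced_unique:
  assumes q: "0 < q" and P: "q_exchangeable q P" "AE \<sigma> in P. balanced \<sigma>"
    and Q: "q_exchangeable q Q" "AE \<sigma> in Q. balanced \<sigma>"
  shows "P = Q"
proof (rule perm_measure_eqI)
  show prob: "prob_space P" "prob_space Q" and sets: "sets P = sets perm_space" "sets Q = sets perm_space"
    using P Q by (auto simp: q_exchangeable_def)
  fix V :: "int set" and y :: "int \<Rightarrow> int" assume V: "finite V"
  then have "finite ((\<lambda>j. nat \<bar>j\<bar>) ` (V \<union> y ` V))" by simp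
  then obtain L where L: "\<forall>k\<in>(\<lambda>j. nat \<bar>j\<bar>) ` (V \<union> y ` V). k < L"
    using finite_nat_set_iff_bounded by blast
  have "v \<in> {- int L..int L}" if "v \<in> V \<union> y ` V" for v
  proof -
    have "nat \<bar>v\<bar> < L" using L that by blast
    then show ?thesis by auto
  qed
  then have VL: "V \<subseteq> {- int L..int L}" "y ` V \<subseteq> {- int L..int L}" by blast+
  define S where "S n = {\<omega>. bij \<omega> \<and> saturated L n (\<omega> ` {1 - int n..int n})}" for n
  have "\<forall>n. \<exists>\<kappa>. L < n \<longrightarrow> 0 \<le> \<kappa> \<and> \<kappa> \<le> 1 \<and> (\<forall>P. q_exchangeable q P \<longrightarrow>
    measure P (S n \<inter> cylinder V y) = \<kappa> * measure P (S n))"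
  proof
    fix n
    have "S n \<inter> cylinder V y = {\<omega>. bij \<omega> \<and> saturated L n (\<omega> ` {1 - int n..int n}) \<and> (\<forall>j\<in>V. \<omega> j = y j)}"
      by (auto simp: S_def cylinder_def)
    then show "\<exists>\<kappa>. L < n \<longrightarrow> 0 \<le> \<kappa> \<and> \<kappa> \<le> 1 \<and> (\<forall>P. q_exchangeable q P \<longrightarrow>
      measure P (S n \<inter> cylinder V y) = \<kappa> * measure P (S n))"
      using cylinder_prob_saturated[OF q _ VL, of n] unfolding S_def by auto
  qed
  then obtain \<kappa> where \<kappa>: "\<And>n. L < n \<Longrightarrow> 0 \<le> \<kappa> n \<and> \<kappa> n \<le> 1"
    and law: "\<And>n P. L < n \<Longrightarrow> q_exchangeable q P \<Longrightarrow> measure P (S n \<inter> cylinder V y) = \<kappa> n * measure P (S n)"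
    by (metis (no_types, lifting) choice)
  have lim: "(\<lambda>n. measure R (cylinder V y) - \<kappa> n) \<longlonglongrightarrow> 0"
    if R: "q_exchangeable q R" "AE \<sigma> in R. balanced \<sigma>" for R
  proof -
    interpret prob_space R using R by (simp add: q_exchangeable_def)
    have setsR: "sets R = sets perm_space" using R by (simp add: q_exchangeable_def)
    have Sn: "S n \<in> events" for n
      using window_event_in_sets[of "{}" "saturated L n" "1 - int n" "int n" "\<lambda>_. 0"] setsR by (simp add: S_def)
    have cyl: "cylinder V y \<in> events" using cylinder_in_sets[OF V] setsR by simp
    have "\<bar>prob (cylinder V y) - \<kappa> n\<bar> \<le> 1 - prob (S n)" if n: "L < n" for n
    proof -
      have "prob (cylinder V y) = prob (S n \<inter> cylinder V y) + prob (cylinder V y - S n)"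
        using finite_measure_Diff'[OF cyl Sn[of n]] by (simp add: Int_commute)
      moreover have "prob (cylinder V y - S n) \<le> prob (space R - S n)"
        using cyl Sn sets.sets_into_space[OF cyl] by (intro finite_measure_mono) auto
      moreover have "prob (space R - S n) = 1 - prob (S n)" using Sn by (rule prob_compl)
      moreover have "0 \<le> prob (cylinder V y - S n)" by simp
      moreover have "\<kappa> n - \<kappa> n * prob (S n) = \<kappa> n * (1 - prob (S n))" by (simp add: algebra_simps)
      moreover have "\<kappa> n * (1 - prob (S n)) \<le> 1 - prob (S n)" "0 \<le> \<kappa> n * (1 - prob (S n))"
        using \<kappa>[OF n] by (auto intro!: mult_left_le_one_le mult_nonneg_nonneg)
      ultimately show ?thesis using law[OF n R(1)] by linarith
    qed
    then have ev: "\<forall>\<^sub>F n in sequentially. norm (prob (cylinder V y) - \<kappa> n) \<le> 1 - prob (S n)"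
      unfolding eventually_sequentially by (intro exI[of _ "Suc L"]) auto
    have "(\<lambda>n. prob (S n)) \<longlonglongrightarrow> 1"
      unfolding S_def by (rule prob_saturated_tendsto_1[OF prob_space_axioms setsR R(2)])
    then have "(\<lambda>n. 1 - prob (S n)) \<longlonglongrightarrow> 1 - 1" by (intro tendsto_intros)
    then show ?thesis by (intro Lim_null_comparison[OF ev]) simp
  qed
  from tendsto_diff[OF lim[OF P] lim[OF Q]]
  have "(\<lambda>n::nat. measure P (cylinder V y) - measure Q (cylinder V y)) \<longlonglongrightarrow> 0" by simp
  then show "measure P (cylinder V y) = measure Q (cylinder V y)"
    by (simp add: LIMSEQ_const_iff)
qed

section \<open>The one-sided Mallows permutation\<close>

text \<open>A sequence \<open>g\<close> of numbers drives a greedy choice: step \<open>n\<close> skips \<open>g n\<close> of the values not yet taken and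
takes the next one.\<close>

primrec taken :: "(nat \<Rightarrow> nat) \<Rightarrow> nat \<Rightarrow> nat set" where
  "taken g 0 = {}"
| "taken g (Suc n) = insert (enumerate (- taken g n) (g n)) (taken g n)"

definition pick :: "(nat \<Rightarrow> nat) \<Rightarrow> nat \<Rightarrow> nat" where
  "pick g n = enumerate (- taken g n) (g n)"

lemma taken_eq_image: "taken g n = pick g ` {..<n}"
  by (induction n) (auto simp: pick_def lessThan_Suc)

lemma finite_taken [simp]: "finite (taken g n)"
  by (simp add: taken_eq_image)

lemma infinite_Compl_taken [simp]: "infinite (- taken g n)"
  by (metis finite_taken finite_compl infinite_UNIV_nat)

lemma pick_notin_taken: "pick g n \<notin> taken g n"
  using enumerate_in_set[OF infinite_Compl_taken, of g n "g n"] by (simp add: pick_def)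

lemma pick_neq: "m < n \<Longrightarrow> pick g m \<noteq> pick g n"
  using pick_notin_taken[of g n] unfolding taken_eq_image by (metis imageI lessThan_iff)

lemma inj_pick: "inj (pick g)"
proof (rule injI)
  fix m n assume "pick g m = pick g n"
  then show "m = n" using pick_neq[of m n g] pick_neq[of n m g] by (cases m n rule: linorder_cases) auto
qed

lemma enumerate_eq_iff_card:
  fixes C :: "nat set"
  assumes "infinite C" "v \<in> C"
  shows "enumerate C k = v \<longleftrightarrow> k = card {u \<in> C. u < v}"
proof -
  obtain n where n: "enumerate C n = v" using enumerate_Ex[OF assms] by blast
  have "{u \<in> C. u < v} = enumerate C ` {..<n}"
  proof (intro equalityI subsetI)
    fix u assume "u \<in> {u \<in> C. u < v}"
    then obtain m where m: "enumerate C m = u" "u < v" using enumerate_Ex[OF assms(1)] by auto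
    then have "m < n" using n enumerate_mono_iff[OF assms(1)] by metis
    then show "u \<in> enumerate C ` {..<n}" using m by auto
  next
    fix u assume "u \<in> enumerate C ` {..<n}"
    then show "u \<in> {u \<in> C. u < v}"
      using n assms(1) enumerate_in_set by auto
  qed
  moreover have "inj (enumerate C)" using assms(1) by (simp add: inj_enumerate)
  then have "card (enumerate C ` {..<n}) = n"
    by (metis card_image card_lessThan inj_on_subset subset_UNIV)
  ultimately have card: "card {u \<in> C. u < v} = n" by simp
  show ?thesis
    using n enumerate_mono_iff[OF assms(1)] \<open>inj (enumerate C)\<close> unfolding card by (auto dest: injD)
qed

text \<open>The entry of the driving sequence that makes step \<open>j\<close> take \<open>z j\<close> once the earlier steps have followed \<open>z\<close>.\<close>

definition gap :: "(nat \<Rightarrow> nat) \<Rightarrow> nat \<Rightarrow> nat" where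
  "gap z j = card ({..<z j} - z ` {..<j})"

lemma pick_eq_iff_gap:
  "(\<forall>j<n. pick g j = z j) \<longleftrightarrow> inj_on z {..<n} \<and> (\<forall>j<n. g j = gap z j)"
proof (induction n)
  case (Suc n)
  have "pick g n = z n \<longleftrightarrow> z n \<notin> z ` {..<n} \<and> g n = gap z n" if IH: "\<forall>j<n. pick g j = z j"
  proof -
    have taken: "taken g n = z ` {..<n}" using IH by (auto simp: taken_eq_image)
    have "{u \<in> - taken g n. u < z n} = {..<z n} - z ` {..<n}" using taken by auto
    then show ?thesis
      using enumerate_eq_iff_card[OF infinite_Compl_taken, of "z n" g n "g n"] pick_notin_taken[of g n]
      by (auto simp: pick_def gap_def taken)
  qed
  moreover have "inj_on z {..<Suc n} \<longleftrightarrow> inj_on z {..<n} \<and> z n \<notin> z ` {..<n}"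
    by (auto simp: lessThan_Suc)
  ultimately show ?case using Suc unfolding less_Suc_eq by blast
qed simp

definition geometric_seq :: "real \<Rightarrow> (nat \<Rightarrow> nat) measure" where
  "geometric_seq q = PiM UNIV (\<lambda>_. measure_pmf (geometric_pmf (1 - q)))"

lemma space_geometric_seq [simp]: "space (geometric_seq q) = UNIV"
  by (simp add: geometric_seq_def space_PiM PiE_def)

lemma prob_space_geometric_seq: "prob_space (geometric_seq q)"
  unfolding geometric_seq_def by (intro prob_space_PiM measure_pmf.prob_space_axioms)

lemma measurable_geometric_seq_component [measurable]:
  "(\<lambda>g. g i) \<in> measurable (geometric_seq q) (count_space UNIV)"
proof -
  have "(\<lambda>g. g i) \<in> measurable (geometric_seq q) (measure_pmf (geometric_pmf (1 - q)))"
    unfolding geometric_seq_def by measurable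
  then show ?thesis by simp
qed

text \<open>A function of the first \<open>n\<close> entries factors through a list of numbers, and lists of numbers are countable.\<close>

lemma measurable_geometric_seq_finite_dependence:
  assumes dep: "\<And>g g'. (\<And>i. i < n \<Longrightarrow> g i = g' i) \<Longrightarrow> f g = f g'"
  shows "f \<in> measurable (geometric_seq q) (count_space UNIV)"
proof -
  have "(\<lambda>g. map g [0..<n]) \<in> measurable (geometric_seq q) (count_space UNIV)"
    unfolding measurable_count_space_eq2_countable
  proof (intro conjI ballI)
    fix l :: "nat list"
    have "(\<lambda>g. map g [0..<n]) -` {l} \<inter> space (geometric_seq q) =
      (if length l = n then {g \<in> space (geometric_seq q). \<forall>i\<in>{..<n}. g i = l ! i} else {})"
    proof (cases "length l = n")
      case True
      then have "map g [0..<n] = l \<longleftrightarrow> (\<forall>i<n. g i = l ! i)" for g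
        by (simp only: list_eq_iff_nth_eq) simp
      then show ?thesis using True by (simp add: vimage_def Ball_def)
    next
      case False
      then have "map g [0..<n] \<noteq> l" for g by auto
      then show ?thesis using False by (simp add: vimage_def)
    qed
    also have "\<dots> \<in> sets (geometric_seq q)"
    proof -
      have "{g \<in> space (geometric_seq q). \<forall>i\<in>{..<n}. g i = l ! i} \<in> sets (geometric_seq q)"
        by measurable
      then show ?thesis by simp
    qed
    finally show "(\<lambda>g. map g [0..<n]) -` {l} \<inter> space (geometric_seq q) \<in> sets (geometric_seq q)" .
  qed simp
  then have "(\<lambda>g. (\<lambda>l. f (\<lambda>i. l ! i)) (map g [0..<n])) \<in> measurable (geometric_seq q) (count_space UNIV)"
    by (rule measurable_compose) simp
  moreover have "f (\<lambda>i. map g [0..<n] ! i) = f g" for g by (rule dep) simp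
  ultimately show ?thesis by simp
qed

lemma taken_cong: "(\<And>i. i < n \<Longrightarrow> g i = g' i) \<Longrightarrow> taken g n = taken g' n"
  by (induction n) auto

lemma measurable_pick [measurable]: "(\<lambda>g. pick g n) \<in> measurable (geometric_seq q) (count_space UNIV)"
proof (rule measurable_geometric_seq_finite_dependence[where n = "Suc n"])
  fix g g' :: "nat \<Rightarrow> nat" assume "\<And>i. i < Suc n \<Longrightarrow> g i = g' i"
  then show "pick g n = pick g' n"
    using taken_cong[of n g g'] by (simp add: pick_def)
qed

lemma prob_geometric_seq:
  assumes "finite J"
  shows "measure (geometric_seq q) {g. \<forall>j\<in>J. g j \<in> X j} =
    (\<Prod>j\<in>J. measure (geometric_pmf (1 - q)) (X j))"
proof -
  interpret product_prob_space "\<lambda>_::nat. measure_pmf (geometric_pmf (1 - q))" UNIV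
    by (unfold_locales) 
  interpret prob_space "geometric_seq q" by (rule prob_space_geometric_seq)
  have "emeasure (geometric_seq q) {g \<in> space (geometric_seq q). \<forall>j\<in>J. g j \<in> X j} =
    (\<Prod>j\<in>J. emeasure (geometric_pmf (1 - q)) (X j))"
    unfolding geometric_seq_def by (rule emeasure_PiM_Collect) (use assms in auto)
  then show ?thesis
    by (simp add: emeasure_eq_measure measure_pmf.emeasure_eq_measure prod_ennreal prod_nonneg)
qed

text \<open>Taking the larger of two values first means skipping the smaller one once more; all other steps see
the same set of free values.\<close>

lemma gap_transpose:
  assumes less: "z r < z (Suc r)" and notin: "z r \<notin> z ` {..<r}"
  defines "z' \<equiv> z \<circ> Transposition.transpose r (Suc r)"
  shows "gap z' r = Suc (gap z (Suc r))" "gap z' (Suc r) = gap z r"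
    and "j \<noteq> r \<Longrightarrow> j \<noteq> Suc r \<Longrightarrow> gap z' j = gap z j"
proof -
  have z': "z' r = z (Suc r)" "z' (Suc r) = z r" "j \<noteq> r \<Longrightarrow> j \<noteq> Suc r \<Longrightarrow> z' j = z j" for j
    by (auto simp: z'_def Transposition.transpose_def)
  have init: "z' ` {..<r} = z ` {..<r}" using z'(3) by (intro image_cong) auto
  have "insert (z r) ({..<z (Suc r)} - z ` {..<Suc r}) = {..<z (Suc r)} - z ` {..<r}"
    using less notin by (auto simp: lessThan_Suc)
  then have "card ({..<z (Suc r)} - z ` {..<r}) = Suc (card ({..<z (Suc r)} - z ` {..<Suc r}))"
    by (metis Diff_iff card_insert_disjoint finite_Diff finite_lessThan imageI lessI lessThan_iff)
  then show "gap z' r = Suc (gap z (Suc r))" using init z' by (simp add: gap_def)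
  have "{..<z r} - z' ` {..<Suc r} = {..<z r} - z ` {..<r}"
    using less z' init by (auto simp: lessThan_Suc)
  then show "gap z' (Suc r) = gap z r" using z' by (simp add: gap_def)
  assume j: "j \<noteq> r" "j \<noteq> Suc r"
  have "Transposition.transpose r (Suc r) ` {..<j} = {..<j}"
  proof (cases "j < r")
    case True
    then have "Transposition.transpose r (Suc r) i = i" if "i < j" for i
      using that by (simp add: Transposition.transpose_def)
    then show ?thesis by (auto simp: image_iff)
  next
    case False
    then have "Transposition.transpose r (Suc r) permutes {..<j}"
      using j by (intro permutes_swap_id) auto
    then show ?thesis by (rule permutes_image)
  qed
  then have "z' ` {..<j} = z ` {..<j}" unfolding z'_def by (metis image_comp)
  then show "gap z' j = gap z j" using z' j by (simp add: gap_def)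
qed

context
  fixes q :: real
  assumes q: "0 < q" "q < 1"
begin

interpretation G: prob_space "geometric_seq q" by (rule prob_space_geometric_seq)

lemma prob_pick_initial:
  "measure (geometric_seq q) {g. \<forall>j<n. pick g j = z j} =
    (if inj_on z {..<n} then \<Prod>j<n. (1 - q) * q ^ gap z j else 0)"
proof (cases "inj_on z {..<n}")
  case True
  have "measure (geometric_seq q) {g. \<forall>j\<in>{..<n}. g j \<in> {gap z j}} =
     (\<Prod>j<n. measure (geometric_pmf (1 - q)) {gap z j})"
    by (rule prob_geometric_seq) simp
  then show ?thesis using True q
    by (simp add: pick_eq_iff_gap Ball_def measure_pmf_single mult.commute)
qed (simp add: pick_eq_iff_gap)

lemma prob_pick_initial_transpose:
  assumes n: "Suc r < n" and less: "z r < z (Suc r)"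
  shows "measure (geometric_seq q) {g. \<forall>j<n. pick g j = (z \<circ> Transposition.transpose r (Suc r)) j} =
    q * measure (geometric_seq q) {g. \<forall>j<n. pick g j = z j}"
proof -
  let ?\<tau> = "Transposition.transpose r (Suc r)"
  let ?w = "\<lambda>z j. (1 - q) * q ^ gap z j"
  have \<tau>: "?\<tau> permutes {..<n}" using n by (intro permutes_swap_id) auto
  have inj: "inj_on (z \<circ> ?\<tau>) {..<n} \<longleftrightarrow> inj_on z {..<n}"
    using comp_inj_on_iff[OF permutes_inj_on[OF \<tau>], of z "{..<n}"] permutes_image[OF \<tau>] by simp
  show ?thesis
  proof (cases "inj_on z {..<n}")
    case True
    then have "z r \<notin> z ` {..<r}" using n by (force dest: inj_onD)
    note gap = gap_transpose[OF less this]
    have split: "{..<n} = insert r (insert (Suc r) ({..<n} - {r, Suc r}))" using n by auto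
    have "(\<Prod>j<n. ?w (z \<circ> ?\<tau>) j) = ?w (z \<circ> ?\<tau>) r * (?w (z \<circ> ?\<tau>) (Suc r) * (\<Prod>j\<in>{..<n} - {r, Suc r}. ?w (z \<circ> ?\<tau>) j))"
      by (subst split) simp
    also have "\<dots> = q * (?w z r * (?w z (Suc r) * (\<Prod>j\<in>{..<n} - {r, Suc r}. ?w z j)))"
      using gap by simp
    also have "\<dots> = q * (\<Prod>j<n. ?w z j)"
      by (subst (2) split) simp
    finally show ?thesis using True inj by (simp only: prob_pick_initial if_True)
  next
    case False
    then show ?thesis using inj by (simp only: prob_pick_initial if_False mult_zero_right)
  qed
qed

text \<open>For an initial segment of indices this is a comparison of two explicit products. An index that is
missing from \<open>J\<close> is restored by summing over the value taken there; it differs from \<open>r\<close> and \<open>Suc r\<close>, so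
the factor is the same in every summand.\<close>

lemma prob_pick_transpose:
  assumes J: "finite J" "r \<in> J" "Suc r \<in> J" and neq: "z r \<noteq> z (Suc r)"
  shows "measure (geometric_seq q) {g. \<forall>j\<in>J. pick g j = (z \<circ> Transposition.transpose r (Suc r)) j} =
    q powi sgn (int (z (Suc r)) - int (z r)) * measure (geometric_seq q) {g. \<forall>j\<in>J. pick g j = z j}"
proof -
  let ?\<tau> = "Transposition.transpose r (Suc r)"
  let ?M = "\<lambda>J z. measure (geometric_seq q) {g. \<forall>j\<in>J. pick g j = z j}"
  obtain n where n: "J \<subseteq> {..<n}" using J(1) finite_nat_iff_bounded by auto
  have step: "(\<lambda>v. ?M (insert l J) (z(l := v))) sums ?M J z" if J: "finite J" "l \<notin> J" for l J and z :: "nat \<Rightarrow> nat"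
  proof -
    have "(\<lambda>v. measure (geometric_seq q) {g. \<forall>j\<in>insert l J. pick g j = (z(l := v)) j}) sums
      measure (geometric_seq q) (\<Union>v. {g. \<forall>j\<in>insert l J. pick g j = (z(l := v)) j})"
    proof (rule G.finite_measure_UNION)
      have "{g \<in> space (geometric_seq q). \<forall>j\<in>insert l J. pick g j = (z(l := v)) j} \<in> sets (geometric_seq q)" for v
        using J(1) by measurable
      then have "{g. \<forall>j\<in>insert l J. pick g j = (z(l := v)) j} \<in> G.events" for v
        by (simp only: space_geometric_seq UNIV_I simp_thms)
      then show "range (\<lambda>v. {g. \<forall>j\<in>insert l J. pick g j = (z(l := v)) j}) \<subseteq> G.events" by blast
      show "disjoint_family (\<lambda>v. {g. \<forall>j\<in>insert l J. pick g j = (z(l := v)) j})"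
        by (auto simp: disjoint_family_on_def)
    qed
    moreover have "(\<Union>v. {g. \<forall>j\<in>insert l J. pick g j = (z(l := v)) j}) = {g. \<forall>j\<in>J. pick g j = z j}"
      using J(2) by (auto split: if_splits)
    ultimately show ?thesis by simp
  qed
  have "?M J (z \<circ> ?\<tau>) = q powi sgn (int (z (Suc r)) - int (z r)) * ?M J z"
    if "finite D" "J \<inter> D = {}" "J \<union> D = {..<n}" "r \<in> J" "Suc r \<in> J" "z r \<noteq> z (Suc r)" for D J and z :: "nat \<Rightarrow> nat"
    using that
  proof (induction D arbitrary: J z rule: finite_induct)
    case empty
    then have J: "J = {..<n}" and n: "Suc r < n" by auto
    show ?case
    proof (cases "z r < z (Suc r)")
      case True
      then show ?thesis using prob_pick_initial_transpose[OF n, of z] by (simp add: J Ball_def)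
    next
      case False
      have "z \<circ> ?\<tau> \<circ> ?\<tau> = z" by (simp add: fun_eq_iff)
      then show ?thesis using prob_pick_initial_transpose[OF n, of "z \<circ> ?\<tau>"] False empty.prems q
        by (simp add: J Ball_def sgn_if power_int_minus field_simps)
    qed
  next
    case (insert l D)
    have fin: "finite J" by (rule finite_subset[of _ "{..<n}"]) (use insert.prems in auto)
    have l: "l \<notin> J" "l \<noteq> r" "l \<noteq> Suc r" using insert.prems by auto
    have "?M (insert l J) (z(l := v) \<circ> ?\<tau>) =
        q powi sgn (int ((z(l := v)) (Suc r)) - int ((z(l := v)) r)) * ?M (insert l J) (z(l := v))" for v
      by (rule insert.IH) (use insert.prems insert.hyps l in auto)
    moreover have "z(l := v) \<circ> ?\<tau> = (z \<circ> ?\<tau>)(l := v)" for v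
      using l by (auto simp: fun_eq_iff Transposition.transpose_def)
    ultimately have eq: "?M (insert l J) ((z \<circ> ?\<tau>)(l := v)) =
        q powi sgn (int (z (Suc r)) - int (z r)) * ?M (insert l J) (z(l := v))" for v
      using l by simp
    have "(\<lambda>v. ?M (insert l J) ((z \<circ> ?\<tau>)(l := v))) sums ?M J (z \<circ> ?\<tau>)"
      by (rule step[OF fin l(1)])
    moreover have "(\<lambda>v. q powi sgn (int (z (Suc r)) - int (z r)) * ?M (insert l J) (z(l := v))) sums
        (q powi sgn (int (z (Suc r)) - int (z r)) * ?M J z)"
      by (intro sums_mult step[OF fin l(1)])
    ultimately show ?case unfolding eq by (rule sums_unique2)
  qed
  from this[of "{..<n} - J" J z] show ?thesis using n J neq by auto
qed

text \<open>Almost surely infinitely many steps skip nothing. Such a step takes the least free value, so a value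
\<open>v\<close> that is never taken would force infinitely many distinct values below \<open>v\<close>.\<close>

lemma AE_surj_pick: "AE g in geometric_seq q. surj (pick g)"
proof -
  have "AE g in geometric_seq q. \<exists>n\<ge>N. g n = 0" for N
  proof -
    let ?A = "{g. \<forall>n\<ge>N. g n \<noteq> 0}"
    have A: "?A \<in> sets (geometric_seq q)"
    proof -
      have "{g \<in> space (geometric_seq q). \<forall>n\<in>{N..}. g n \<noteq> 0} \<in> sets (geometric_seq q)" by measurable
      then show ?thesis by (simp add: Ball_def)
    qed
    have "measure (geometric_seq q) ?A \<le> q ^ K" for K
    proof -
      have "measure (geometric_pmf (1 - q)) (- {0}) = 1 - measure (geometric_pmf (1 - q)) {0}"
        by (subst measure_pmf.prob_compl[symmetric]) (auto simp: Compl_eq_Diff_UNIV)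
      then have nz: "measure (geometric_pmf (1 - q)) (- {0}) = q"
        using q by (simp add: measure_pmf_single)
      have "measure (geometric_seq q) ?A \<le> measure (geometric_seq q) {g. \<forall>n\<in>{N..<N + K}. g n \<in> - {0}}"
      proof (rule G.finite_measure_mono)
        have "{g \<in> space (geometric_seq q). \<forall>n\<in>{N..<N + K}. g n \<noteq> 0} \<in> sets (geometric_seq q)"
          by measurable
        then show "{g. \<forall>n\<in>{N..<N + K}. g n \<in> - {0}} \<in> G.events" by simp
      qed auto
      also have "\<dots> = q ^ K" by (subst prob_geometric_seq) (simp_all add: nz)
      finally show ?thesis .
    qed
    moreover have "(\<lambda>K. q ^ K) \<longlonglongrightarrow> 0" using q by (intro LIMSEQ_realpow_zero) auto
    ultimately have "measure (geometric_seq q) ?A \<le> 0"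
      by (intro LIMSEQ_le_const[where X = "\<lambda>K. q ^ K"]) auto
    then have "?A \<in> null_sets (geometric_seq q)"
      using A by (simp add: G.emeasure_eq_measure null_setsI measure_le_0_iff)
    then show ?thesis by (rule AE_I') auto
  qed
  then have "AE g in geometric_seq q. \<forall>N. \<exists>n\<ge>N. g n = 0" by (simp add: AE_all_countable)
  then show ?thesis
  proof eventually_elim
    case (elim g)
    show "surj (pick g)"
    proof (rule ccontr)
      assume "\<not> surj (pick g)"
      then obtain v where v: "v \<notin> range (pick g)" by auto
      have "pick g n < v" if "g n = 0" for n
      proof -
        have "v \<in> - taken g n" using v by (auto simp: taken_eq_image)
        then have "(LEAST u. u \<in> - taken g n) \<le> v" by (rule Least_le)
        then have "pick g n \<le> v" using that by (simp add: pick_def enumerate_0)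
        then show ?thesis using v by (metis le_neq_implies_less rangeI)
      qed
      then have "pick g ` {n. g n = 0} \<subseteq> {..<v}" by auto
      then have "finite (pick g ` {n. g n = 0})" by (rule finite_subset) simp
      then have "finite {n. g n = 0}" using finite_imageD[of "pick g"] inj_pick inj_on_subset by blast
      then obtain b where "\<forall>n\<in>{n. g n = 0}. n < b" using finite_nat_set_iff_bounded by blast
      moreover obtain n where "n \<ge> b" "g n = 0" using elim by blast
      ultimately show False by (metis (mono_tags, lifting) mem_Collect_eq not_less)
    qed
  qed
qed

end

text \<open>On the null set where the greedy choice misses a value it is replaced by the identity, so that a
bijection is obtained for every driving sequence.\<close>

definition shuffle :: "(nat \<Rightarrow> nat) \<Rightarrow> nat \<Rightarrow> nat" where
  "shuffle g = (if surj (pick g) then pick g else id)"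

lemma bij_shuffle: "bij (shuffle g)"
  using inj_pick by (simp add: shuffle_def bij_def)

lemma measurable_shuffle [measurable]:
  "(\<lambda>g. shuffle g n) \<in> measurable (geometric_seq q) (count_space UNIV)"
proof -
  have "shuffle g n = (if \<forall>v. \<exists>m. v = pick g m then pick g n else n)" for g
    unfolding shuffle_def surj_def by auto
  then show ?thesis by simp
qed

lemma prob_shuffle_transpose:
  fixes z :: "nat \<Rightarrow> int"
  assumes q: "0 < q" "q < 1" and J: "finite J" "r \<in> J" "Suc r \<in> J" and neq: "z r \<noteq> z (Suc r)"
  shows "measure (geometric_seq q) {g. \<forall>j\<in>J. int (shuffle g j) = z (Transposition.transpose r (Suc r) j)} =
    q powi sgn (z (Suc r) - z r) * measure (geometric_seq q) {g. \<forall>j\<in>J. int (shuffle g j) = z j}"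
proof -
  let ?\<tau> = "Transposition.transpose r (Suc r)"
  have \<tau>J: "?\<tau> j \<in> J" if "j \<in> J" for j using J that by (simp add: Transposition.transpose_def)
  show ?thesis
  proof (cases "\<forall>j\<in>J. 0 \<le> z j")
    case False
    then obtain j where j: "j \<in> J" "z j < 0" by force
    have "{g. \<forall>j\<in>J. int (shuffle g j) = z j} = {}" using j by force
    moreover have "{g. \<forall>j\<in>J. int (shuffle g j) = z (?\<tau> j)} = {}"
    proof (intro equals0I)
      fix g assume "g \<in> {g. \<forall>j\<in>J. int (shuffle g j) = z (?\<tau> j)}"
      then have "int (shuffle g (?\<tau> j)) = z (?\<tau> (?\<tau> j))" using \<tau>J[OF j(1)] by blast
      then show False using j(2) by simp
    qed
    ultimately show ?thesis by (simp only: measure_empty mult_zero_right)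
  next
    case True
    have int_z: "int (nat (z j)) = z j" if "j \<in> J" for j using True that by simp
    have law: "measure (geometric_seq q) {g. \<forall>j\<in>J. int (shuffle g j) = y j} =
        measure (geometric_seq q) {g. \<forall>j\<in>J. pick g j = nat (y j)}" if "\<forall>j\<in>J. 0 \<le> y j" for y
    proof (rule measure_eq_AE)
      show "AE g in geometric_seq q. g \<in> {g. \<forall>j\<in>J. int (shuffle g j) = y j} \<longleftrightarrow> g \<in> {g. \<forall>j\<in>J. pick g j = nat (y j)}"
        using AE_surj_pick[OF q]
      proof eventually_elim
        case (elim g)
        then have "int (shuffle g j) = y j \<longleftrightarrow> pick g j = nat (y j)" if "j \<in> J" for j
          using that \<open>\<forall>j\<in>J. 0 \<le> y j\<close> by (auto simp: shuffle_def)
        then show ?case by simp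
      qed
      have "{g \<in> space (geometric_seq q). \<forall>j\<in>J. int (shuffle g j) = y j} \<in> sets (geometric_seq q)"
        "{g \<in> space (geometric_seq q). \<forall>j\<in>J. pick g j = nat (y j)} \<in> sets (geometric_seq q)"
        using J(1) by measurable
      then show "{g. \<forall>j\<in>J. int (shuffle g j) = y j} \<in> sets (geometric_seq q)"
        "{g. \<forall>j\<in>J. pick g j = nat (y j)} \<in> sets (geometric_seq q)" by simp_all
    qed
    have "nat (z r) \<noteq> nat (z (Suc r))" using neq int_z J by metis
    from prob_pick_transpose[OF q J, of "\<lambda>j. nat (z j)", OF this]
    show ?thesis using law[of z] law[of "\<lambda>j. z (?\<tau> j)"] True \<tau>J int_z J by (simp add: o_def)
  qed
qed

section \<open>Random level sets\<close>

text \<open>The possible level sets: those that differ from the positive integers by a finite set. For a balanced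
permutation the level set at threshold \<open>1\<close> has charge \<open>0\<close>.\<close>

definition tame :: "int set \<Rightarrow> bool" where
  "tame S \<longleftrightarrow> finite {i \<in> S. i \<le> 0} \<and> finite {i. i \<notin> S \<and> 0 < i}"

definition charge :: "int set \<Rightarrow> int" where
  "charge S = int (card {i \<in> S. i \<le> 0}) - int (card {i. i \<notin> S \<and> 0 < i})"

lemma insert_split:
  "{i \<in> insert p S. i \<le> (0::int)} = (if p \<le> 0 then insert p {i \<in> S. i \<le> 0} else {i \<in> S. i \<le> 0})"
  "{i. i \<notin> insert p S \<and> (0::int) < i} = {i. i \<notin> S \<and> 0 < i} - {p}"
  by auto

lemma tame_insert [simp]: "tame (insert p S) \<longleftrightarrow> tame S"
  unfolding tame_def insert_split by simp

lemma charge_insert: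
  assumes "tame S" "p \<notin> S"
  shows "charge (insert p S) = charge S + 1"
proof (cases "p \<le> 0")
  case True
  then have "{i. i \<notin> S \<and> 0 < i} - {p} = {i. i \<notin> S \<and> 0 < i}" by auto
  moreover have "p \<notin> {i \<in> S. i \<le> 0}" "finite {i \<in> S. i \<le> 0}" using assms by (auto simp: tame_def)
  ultimately show ?thesis using True unfolding charge_def insert_split by simp
next
  case False
  then have "p \<in> {i. i \<notin> S \<and> 0 < i}" using assms by auto
  from card_Suc_Diff1[OF _ this]
  have "int (card ({i. i \<notin> S \<and> 0 < i} - {p})) = int (card {i. i \<notin> S \<and> 0 < i}) - 1"
    using assms by (simp add: tame_def)
  then show ?thesis using False by (simp only: charge_def insert_split if_False)
qed

definition odds :: "real \<Rightarrow> real \<Rightarrow> int \<Rightarrow> real" where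
  "odds q \<beta> i = \<beta> * q powr (- real_of_int i)"

text \<open>The Bernoulli weight of \<open>S\<close> relative to that of the positive integers. Only finitely many factors
differ from \<open>1\<close>, because the odds are attached to the points where \<open>S\<close> deviates from them.\<close>

definition weight :: "real \<Rightarrow> real \<Rightarrow> int set \<Rightarrow> real" where
  "weight q \<beta> S = (if tame S then (\<Prod>i\<in>{i \<in> S. i \<le> 0}. odds q \<beta> i) *
     (\<Prod>i\<in>{i. i \<notin> S \<and> 0 < i}. inverse (odds q \<beta> i)) else 0)"

text \<open>The sets that agree with the positive integers outside \<open>{1 - n..n}\<close>; finitely many for each \<open>n\<close>, and
they exhaust the tame sets.\<close>

definition window_sets :: "nat \<Rightarrow> int set set" where
  "window_sets n = (\<lambda>T. T \<union> {int n<..}) ` Pow {1 - int n..int n}"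

lemma finite_window_sets [simp]: "finite (window_sets n)"
  by (simp add: window_sets_def)

lemma inj_on_window: "inj_on (\<lambda>T. T \<union> {int n<..}) (Pow {1 - int n..int n})"
proof (rule inj_onI)
  fix S T assume "S \<in> Pow {1 - int n..int n}" "T \<in> Pow {1 - int n..int n}" "S \<union> {int n<..} = T \<union> {int n<..}"
  then have "S = (S \<union> {int n<..}) - {int n<..}" "T = (T \<union> {int n<..}) - {int n<..}" by auto
  then show "S = T" using \<open>S \<union> {int n<..} = T \<union> {int n<..}\<close> by simp
qed

lemma sum_window_sets: "(\<Sum>S\<in>window_sets n. f S) = (\<Sum>T\<in>Pow {1 - int n..int n}. f (T \<union> {int n<..}))"
  unfolding window_sets_def by (simp add: sum.reindex[OF inj_on_window])

lemma window_split:
  assumes "T \<subseteq> {1 - int n..int n}"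
  shows "{i \<in> T \<union> {int n<..}. i \<le> 0} = {i \<in> T. i \<le> 0}"
    "{i. i \<notin> T \<union> {int n<..} \<and> 0 < i} = {1..int n} - T"
  using assms by auto

lemma window_sets_iff: "S \<in> window_sets n \<longleftrightarrow> {int n<..} \<subseteq> S \<and> (\<forall>i\<in>S. 1 - int n \<le> i)"
proof
  assume "S \<in> window_sets n"
  then show "{int n<..} \<subseteq> S \<and> (\<forall>i\<in>S. 1 - int n \<le> i)" by (auto simp: window_sets_def)
next
  assume *: "{int n<..} \<subseteq> S \<and> (\<forall>i\<in>S. 1 - int n \<le> i)"
  then have "S = (S \<inter> {1 - int n..int n}) \<union> {int n<..}" by force
  then show "S \<in> window_sets n" unfolding window_sets_def by blast
qed

lemma incseq_window_sets: "incseq window_sets"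
  by (force simp: incseq_def window_sets_iff)

lemma tame_iff_window: "tame S \<longleftrightarrow> (\<exists>n. S \<in> window_sets n)"
proof
  assume "tame S"
  then have "finite ((\<lambda>i. nat \<bar>i\<bar>) ` ({i \<in> S. i \<le> 0} \<union> {i. i \<notin> S \<and> 0 < i}))"
    by (simp add: tame_def)
  then obtain n where n: "\<forall>k\<in>(\<lambda>i. nat \<bar>i\<bar>) ` ({i \<in> S. i \<le> 0} \<union> {i. i \<notin> S \<and> 0 < i}). k < n"
    using finite_nat_set_iff_bounded by blast
  have "i \<in> S" if "int n < i" for i
  proof (rule ccontr)
    assume "i \<notin> S"
    then have "i \<in> {i \<in> S. i \<le> 0} \<union> {i. i \<notin> S \<and> 0 < i}" using that by simp
    then have "nat \<bar>i\<bar> < n" using n by blast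
    then show False using that by simp
  qed
  moreover have "1 - int n \<le> i" if "i \<in> S" for i
  proof (cases "i \<le> 0")
    case True
    then have "i \<in> {i \<in> S. i \<le> 0} \<union> {i. i \<notin> S \<and> 0 < i}" using that by simp
    then have "nat \<bar>i\<bar> < n" using n by blast
    then show ?thesis by simp
  qed auto
  ultimately show "\<exists>n. S \<in> window_sets n" by (auto simp: window_sets_iff)
next
  assume "\<exists>n. S \<in> window_sets n"
  then obtain n where "{int n<..} \<subseteq> S" "\<forall>i\<in>S. 1 - int n \<le> i" by (auto simp: window_sets_iff)
  then have "{i \<in> S. i \<le> 0} \<subseteq> {1 - int n..0}" "{i. i \<notin> S \<and> 0 < i} \<subseteq> {1..int n}"
    by (auto simp: subset_iff not_less[symmetric])
  then show "tame S" unfolding tame_def using finite_subset by blast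
qed

lemma charge_window:
  assumes T: "T \<subseteq> {1 - int n..int n}"
  shows "charge (T \<union> {int n<..}) = int (card T) - int n"
proof -
  have fin: "finite T" using T by (rule finite_subset) simp
  have "card T = card {i \<in> T. i \<le> 0} + card ({1..int n} \<inter> T)"
    using fin T by (subst card_Un_disjoint[symmetric]) (auto intro!: arg_cong[of _ _ card])
  moreover have "card ({1..int n} - T) = n - card ({1..int n} \<inter> T)"
    by (simp add: card_Diff_subset_Int)
  moreover have "card ({1..int n} \<inter> T) \<le> n"
    using card_mono[of "{1..int n}" "{1..int n} \<inter> T"] by simp
  ultimately show ?thesis unfolding charge_def window_split[OF T] by simp
qed

text \<open>Sums over all tame sets are limits of finite sums over windows, by monotone convergence.\<close>

lemma nn_integral_tame:
  assumes f: "\<And>S. 0 \<le> f S" "\<And>S. \<not> tame S \<Longrightarrow> f S = 0"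
    and lim: "(\<lambda>n. \<Sum>S\<in>window_sets n. f S) \<longlonglongrightarrow> c"
  shows "(\<integral>\<^sup>+S. ennreal (f S) \<partial>count_space UNIV) = ennreal c"
proof -
  let ?M = "density (count_space UNIV) (\<lambda>S. ennreal (f S))"
  have "(\<lambda>n. emeasure ?M (window_sets n)) \<longlonglongrightarrow> emeasure ?M (\<Union>n. window_sets n)"
    by (rule Lim_emeasure_incseq) (auto simp: incseq_window_sets)
  moreover have "emeasure ?M (window_sets n) = ennreal (\<Sum>S\<in>window_sets n. f S)" for n
    using f by (simp add: emeasure_density nn_integral_count_space_indicator[symmetric] nn_integral_count_space_finite sum_ennreal)
  moreover have "(\<lambda>n. ennreal (\<Sum>S\<in>window_sets n. f S)) \<longlonglongrightarrow> ennreal c"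
    using lim by (rule tendsto_ennrealI)
  ultimately have "emeasure ?M (\<Union>n. window_sets n) = ennreal c"
    using LIMSEQ_unique by simp
  moreover have "emeasure ?M (\<Union>n. window_sets n) = (\<integral>\<^sup>+S. ennreal (f S) \<partial>count_space UNIV)"
    using f(2) by (auto simp: emeasure_density tame_iff_window indicator_def intro!: nn_integral_cong)
  ultimately show ?thesis by simp
qed

section \<open>The q-binomial theorem and the mass of a charge\<close>

definition qpoch :: "real \<Rightarrow> nat \<Rightarrow> real" where
  "qpoch q n = (\<Prod>k<n. 1 - q ^ Suc k)"

text \<open>The elementary symmetric polynomial of degree \<open>k\<close> in \<open>1, q, \<dots>, q ^ (n - 1)\<close>.\<close>

definition subset_sum :: "real \<Rightarrow> nat \<Rightarrow> nat \<Rightarrow> real" where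
  "subset_sum q n k = (\<Sum>U\<in>{U. U \<subseteq> {..<n} \<and> card U = k}. \<Prod>u\<in>U. q ^ u)"

lemma subset_sum_0: "subset_sum q n 0 = 1"
proof -
  have "{U. U \<subseteq> {..<n} \<and> card U = 0} = {{}}" using finite_subset by fastforce
  then show ?thesis by (simp add: subset_sum_def)
qed

lemma subset_sum_empty: "n < k \<Longrightarrow> subset_sum q n k = 0"
proof -
  assume "n < k"
  have "card U \<noteq> k" if "U \<subseteq> {..<n}" for U
    using card_mono[OF _ that] \<open>n < k\<close> by simp
  then have "{U. U \<subseteq> {..<n} \<and> card U = k} = {}" by blast
  then show ?thesis unfolding subset_sum_def by (simp only: sum.empty)
qed

text \<open>A subset of \<open>{..<Suc n}\<close> either omits \<open>n\<close> or is obtained by inserting it.\<close>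

lemma subset_sum_Suc_Suc:
  "subset_sum q (Suc n) (Suc k) = subset_sum q n (Suc k) + q ^ n * subset_sum q n k"
proof -
  let ?A = "{U. U \<subseteq> {..<n} \<and> card U = Suc k}" and ?B = "{U. U \<subseteq> {..<n} \<and> card U = k}"
  have fin: "finite U" if "U \<subseteq> {..<n}" for U using that finite_subset by blast
  have "{U. U \<subseteq> {..<Suc n} \<and> card U = Suc k} = ?A \<union> insert n ` ?B"
  proof (intro equalityI subsetI)
    fix U assume U: "U \<in> {U. U \<subseteq> {..<Suc n} \<and> card U = Suc k}"
    show "U \<in> ?A \<union> insert n ` ?B"
    proof (cases "n \<in> U")
      case True
      then have "U = insert n (U - {n})" "U - {n} \<subseteq> {..<n}" "card (U - {n}) = k"
        using U by (auto simp: lessThan_Suc)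
      then show ?thesis by blast
    next
      case False
      then show ?thesis using U by (auto simp: lessThan_Suc)
    qed
  next
    fix U assume "U \<in> ?A \<union> insert n ` ?B"
    then consider "U \<in> ?A" | V where "V \<in> ?B" "U = insert n V" by blast
    then show "U \<in> {U. U \<subseteq> {..<Suc n} \<and> card U = Suc k}"
    proof cases
      case 2
      then have "n \<notin> V" "finite V" using fin by auto
      then show ?thesis using 2 by (auto simp: lessThan_Suc)
    qed (auto simp: lessThan_Suc)
  qed
  moreover have "?A \<inter> insert n ` ?B = {}" by auto
  moreover have "finite ?A" "finite ?B" by (auto intro: finite_subset[of _ "Pow {..<n}"])
  ultimately have "subset_sum q (Suc n) (Suc k) = subset_sum q n (Suc k) + (\<Sum>U\<in>insert n ` ?B. \<Prod>u\<in>U. q ^ u)"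
    unfolding subset_sum_def by (simp add: sum.union_disjoint)
  also have "(\<Sum>U\<in>insert n ` ?B. \<Prod>u\<in>U. q ^ u) = (\<Sum>U\<in>?B. \<Prod>u\<in>insert n U. q ^ u)"
  proof (rule sum.reindex_cong[OF _ refl refl])
    show "inj_on (insert n) ?B"
    proof (rule inj_onI)
      fix S T assume "S \<in> ?B" "T \<in> ?B" "insert n S = insert n T"
      moreover have "n \<notin> S" "n \<notin> T" using \<open>S \<in> ?B\<close> \<open>T \<in> ?B\<close> by auto
      ultimately show "S = T" by (metis Diff_insert_absorb)
    qed
  qed
  also have "\<dots> = (\<Sum>U\<in>?B. q ^ n * (\<Prod>u\<in>U. q ^ u))"
  proof (rule sum.cong[OF refl])
    fix U assume "U \<in> ?B"
    then have "n \<notin> U" "finite U" using fin by auto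
    then show "(\<Prod>u\<in>insert n U. q ^ u) = q ^ n * (\<Prod>u\<in>U. q ^ u)" by simp
  qed
  also have "\<dots> = q ^ n * subset_sum q n k" by (simp add: subset_sum_def sum_distrib_left)
  finally show ?thesis .
qed

text \<open>The \<open>q\<close>-binomial theorem, with the denominators multiplied out to keep division out of the induction.\<close>

lemma q_binomial:
  "k \<le> n \<Longrightarrow> subset_sum q n k * (qpoch q k * qpoch q (n - k)) = (\<Prod>u<k. q ^ u) * qpoch q n"
proof (induction n arbitrary: k)
  case 0
  then show ?case by (simp add: subset_sum_0 qpoch_def)
next
  case (Suc n)
  show ?case
  proof (cases k)
    case 0
    then show ?thesis by (simp add: subset_sum_0 qpoch_def)
  next
    case (Suc k')
    then have k': "k' \<le> n" using Suc.prems by simp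
    have Suc_poch: "qpoch q (Suc m) = qpoch q m * (1 - q ^ Suc m)" for m
      by (simp add: qpoch_def lessThan_Suc mult.commute)
    have prod_Suc: "(\<Prod>u<Suc k'. q ^ u) = (\<Prod>u<k'. q ^ u) * q ^ k'" by simp
    have IH: "subset_sum q n k' * (qpoch q k' * qpoch q (n - k')) = (\<Prod>u<k'. q ^ u) * qpoch q n"
      by (rule Suc.IH[OF k'])
    have first: "subset_sum q n (Suc k') * (qpoch q (Suc k') * qpoch q (n - k')) =
      (\<Prod>u<Suc k'. q ^ u) * qpoch q n * (1 - q ^ (n - k'))"
    proof (cases "Suc k' \<le> n")
      case True
      then have "n - k' = Suc (n - Suc k')" by simp
      then have "qpoch q (n - k') = qpoch q (n - Suc k') * (1 - q ^ (n - k'))"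
        using Suc_poch[of "n - Suc k'"] by simp
      then show ?thesis using Suc.IH[OF True] by simp
    next
      case False
      then show ?thesis using k' by (simp add: subset_sum_empty)
    qed
    have "subset_sum q (Suc n) (Suc k') * (qpoch q (Suc k') * qpoch q (n - k')) =
      subset_sum q n (Suc k') * (qpoch q (Suc k') * qpoch q (n - k')) +
      q ^ n * (1 - q ^ Suc k') * (subset_sum q n k' * (qpoch q k' * qpoch q (n - k')))"
      by (simp add: subset_sum_Suc_Suc Suc_poch algebra_simps)
    also have "\<dots> = (\<Prod>u<k'. q ^ u) * qpoch q n * (q ^ k' * (1 - q ^ (n - k')) + q ^ n * (1 - q ^ Suc k'))"
      unfolding first IH prod_Suc by (simp add: algebra_simps)
    also have "q ^ k' * (1 - q ^ (n - k')) + q ^ n * (1 - q ^ Suc k') = q ^ k' * (1 - q ^ Suc n)"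
    proof -
      have "q ^ k' * q ^ (n - k') = q ^ n" using k' by (simp add: power_add[symmetric])
      moreover have "q ^ n * q ^ Suc k' = q ^ k' * q ^ Suc n" by (simp add: power_add[symmetric] add.commute)
      ultimately show ?thesis by (simp only: right_diff_distrib mult_1_right) 
    qed
    also have "(\<Prod>u<k'. q ^ u) * qpoch q n * (q ^ k' * (1 - q ^ Suc n)) = (\<Prod>u<Suc k'. q ^ u) * qpoch q (Suc n)"
      by (simp only: prod_Suc Suc_poch) (simp only: ac_simps)
    finally show ?thesis using Suc by simp
  qed
qed


lemma powr_triangle:
  assumes "0 < q"
  shows "(\<Prod>u<k. q ^ u) = q powr (real k * (real k - 1) / 2)"
proof (induction k)
  case (Suc k)
  have "q ^ k = q powr real k" using assms by (simp add: powr_realpow)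
  then show ?case using Suc assms by (simp add: powr_add[symmetric] field_simps)
qed (use assms in simp)

lemma powr_minus_Suc:
  assumes "0 < q"
  shows "q powr (- real_of_int (int k + 1)) = inverse (q ^ Suc k)"
proof -
  have "- real_of_int (int k + 1) = - real (Suc k)" by simp
  then show ?thesis using assms by (simp only: powr_minus powr_realpow)
qed

lemma prod_int_interval: "(\<Prod>i\<in>{1..int n}. f i) = (\<Prod>k<n. f (int k + 1))"
  by (rule prod.reindex_bij_witness[of _ "\<lambda>k. int k + 1" "\<lambda>i. nat (i - 1)"]) auto

lemma prod_nonpos_interval: "(\<Prod>i\<in>{1 - int n..0}. f i) = (\<Prod>k<n. f (- int k))"
  by (rule prod.reindex_bij_witness[of _ "\<lambda>k. - int k" "\<lambda>i. nat (- i)"]) auto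

lemma convergent_prod_geometric:
  assumes q: "0 < q" "q < 1" and a: "0 \<le> a"
  shows "convergent_prod (\<lambda>k. 1 + a * q ^ k :: real)"
proof (rule summable_imp_convergent_prod_real)
  have "summable (\<lambda>k. a * q ^ k)" using q by (intro summable_mult summable_geometric) simp
  then show "summable (\<lambda>k. \<bar>a * q ^ k\<bar>)" using q a by (simp add: abs_mult)
  show "a * q ^ k \<noteq> -1" for k
  proof -
    have "0 \<le> a * q ^ k" using a q by simp
    then show ?thesis by linarith
  qed
qed

lemma convergent_prod_qpoch:
  assumes q: "0 < q" "q < 1"
  shows "convergent_prod (\<lambda>k. 1 - q ^ Suc k :: real)"
proof -
  have "summable (\<lambda>k. q * q ^ k)" using q by (intro summable_mult summable_geometric) simp
  then have "summable (\<lambda>k. \<bar>- (q ^ Suc k)\<bar>)" using q by (simp add: abs_mult)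
  moreover have "- (q ^ Suc k) \<noteq> - 1" for k using power_Suc_less_one[OF q, of k] by simp
  ultimately have "convergent_prod (\<lambda>k. 1 + - (q ^ Suc k))" by (rule summable_imp_convergent_prod_real)
  then show ?thesis by simp
qed

lemma prod_lessThan_LIMSEQ:
  assumes "convergent_prod f"
  shows "(\<lambda>n. \<Prod>k<n. f k) \<longlonglongrightarrow> (prodinf f :: real)"
  using convergent_prod_LIMSEQ[OF assms] by (simp add: LIMSEQ_lessThan_iff_atMost)

lemma qpoch_inf_pos:
  assumes q: "0 < q" "q < 1"
  shows "0 < (\<Prod>k. 1 - q ^ Suc k :: real)"
  using power_Suc_less_one[OF q] by (intro less_0_prodinf convergent_prod_qpoch[OF q]) (simp del: power_Suc)

text \<open>The total weight of all tame sets. As a function of \<open>\<beta>\<close> it is a Jacobi theta function in product form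
without the factor that does not depend on \<open>\<beta>\<close>.\<close>

definition theta_norm :: "real \<Rightarrow> real \<Rightarrow> real" where
  "theta_norm q \<beta> = (\<Prod>k. 1 + \<beta> * q ^ k) * (\<Prod>k. 1 + q ^ Suc k / \<beta>)"

context
  fixes q \<beta> :: real
  assumes q: "0 < q" "q < 1" and \<beta>: "0 < \<beta>"
begin

lemma odds_pos: "0 < odds q \<beta> i"
  using q \<beta> by (simp add: odds_def)

lemma weight_nonneg: "0 \<le> weight q \<beta> S"
  using less_imp_le[OF odds_pos] by (simp add: weight_def prod_nonneg)

lemma weight_insert:
  assumes "p \<notin> S"
  shows "weight q \<beta> (insert p S) = odds q \<beta> p * weight q \<beta> S"
proof (cases "tame S")
  case True
  then have fin: "finite {i \<in> S. i \<le> 0}" "finite {i. i \<notin> S \<and> 0 < i}" by (auto simp: tame_def)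
  show ?thesis
  proof (cases "p \<le> 0")
    case p: True
    then have "{i. i \<notin> S \<and> 0 < i} - {p} = {i. i \<notin> S \<and> 0 < i}" by auto
    moreover have "p \<notin> {i \<in> S. i \<le> 0}" using assms by simp
    ultimately show ?thesis using True p fin
      unfolding weight_def tame_insert insert_split by simp
  next
    case False
    then have "p \<in> {i. i \<notin> S \<and> 0 < i}" using assms by simp
    then have "(\<Prod>i\<in>{i. i \<notin> S \<and> 0 < i}. inverse (odds q \<beta> i)) =
        inverse (odds q \<beta> p) * (\<Prod>i\<in>{i. i \<notin> S \<and> 0 < i} - {p}. inverse (odds q \<beta> i))"
      using fin by (intro prod.remove) auto
    then show ?thesis using True False odds_pos[of p]
      unfolding weight_def tame_insert insert_split by simp
  qed
qed (simp add: weight_def)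

text \<open>Inside a window it is more convenient to measure weights relative to the empty set. The positive
points of \<open>T\<close> then contribute their odds, which the second product takes back.\<close>

lemma weight_window:
  assumes T: "T \<subseteq> {1 - int n..int n}"
  shows "weight q \<beta> (T \<union> {int n<..}) = (\<Prod>i\<in>T. odds q \<beta> i) * (\<Prod>i\<in>{1..int n}. inverse (odds q \<beta> i))"
proof -
  have fin: "finite T" using T by (rule finite_subset) simp
  have "tame (T \<union> {int n<..})" unfolding tame_iff_window using T by (auto simp: window_sets_def)
  then have "weight q \<beta> (T \<union> {int n<..}) =
    (\<Prod>i\<in>{i \<in> T. i \<le> 0}. odds q \<beta> i) * (\<Prod>i\<in>{1..int n} - T. inverse (odds q \<beta> i))"
    unfolding weight_def window_split[OF T] by simp
  moreover have "(\<Prod>i\<in>T. odds q \<beta> i) = (\<Prod>i\<in>{i \<in> T. i \<le> 0}. odds q \<beta> i) * (\<Prod>i\<in>{1..int n} \<inter> T. odds q \<beta> i)"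
    using fin T by (subst prod.union_disjoint[symmetric]) (auto intro!: prod.cong)
  moreover have "(\<Prod>i\<in>{1..int n}. inverse (odds q \<beta> i)) =
     (\<Prod>i\<in>{1..int n} - T. inverse (odds q \<beta> i)) * (\<Prod>i\<in>{1..int n} \<inter> T. inverse (odds q \<beta> i))"
    by (subst prod.union_disjoint[symmetric]) (auto intro!: prod.cong)
  moreover have "(\<Prod>i\<in>{1..int n} \<inter> T. odds q \<beta> i) * (\<Prod>i\<in>{1..int n} \<inter> T. inverse (odds q \<beta> i)) = 1"
    using odds_pos by (simp add: prod.distrib[symmetric] less_imp_neq[symmetric])
  ultimately show ?thesis by (simp add: mult_ac)
qed

lemma sum_weight_window:
  "(\<Sum>S\<in>window_sets n. weight q \<beta> S) = (\<Prod>k<n. 1 + \<beta> * q ^ k) * (\<Prod>k<n. 1 + q ^ Suc k / \<beta>)"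
proof -
  let ?W = "{1 - int n..int n}"
  have "(\<Sum>S\<in>window_sets n. weight q \<beta> S) =
      (\<Sum>T\<in>Pow ?W. (\<Prod>i\<in>T. odds q \<beta> i) * (\<Prod>i\<in>{1..int n}. inverse (odds q \<beta> i)))"
    unfolding sum_window_sets by (intro sum.cong refl weight_window) simp
  also have "\<dots> = (\<Prod>i\<in>?W. odds q \<beta> i + 1) * (\<Prod>i\<in>{1..int n}. inverse (odds q \<beta> i))"
    by (simp add: prod_add sum_distrib_right)
  also have "?W = {1 - int n..0} \<union> {1..int n}" by auto
  also have "(\<Prod>i\<in>{1 - int n..0} \<union> {1..int n}. odds q \<beta> i + 1) =
      (\<Prod>i\<in>{1 - int n..0}. odds q \<beta> i + 1) * (\<Prod>i\<in>{1..int n}. odds q \<beta> i + 1)"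
    by (rule prod.union_disjoint) auto
  also have "\<dots> * (\<Prod>i\<in>{1..int n}. inverse (odds q \<beta> i)) =
      (\<Prod>i\<in>{1 - int n..0}. odds q \<beta> i + 1) * (\<Prod>i\<in>{1..int n}. (odds q \<beta> i + 1) * inverse (odds q \<beta> i))"
    by (simp add: prod.distrib mult.assoc)
  also have "(\<Prod>i\<in>{1 - int n..0}. odds q \<beta> i + 1) = (\<Prod>k<n. 1 + \<beta> * q ^ k)"
    unfolding prod_nonpos_interval using q by (simp add: odds_def powr_realpow add.commute)
  also have "(\<Prod>i\<in>{1..int n}. (odds q \<beta> i + 1) * inverse (odds q \<beta> i)) = (\<Prod>k<n. 1 + q ^ Suc k / \<beta>)"
    unfolding prod_int_interval
  proof (rule prod.cong[OF refl])
    fix k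
    show "(odds q \<beta> (int k + 1) + 1) * inverse (odds q \<beta> (int k + 1)) = 1 + q ^ Suc k / \<beta>"
      unfolding odds_def powr_minus_Suc[OF q(1)] using q \<beta> by (simp add: field_simps)
  qed
  finally show ?thesis .
qed

text \<open>The subsets of the window with \<open>n + d\<close> elements are reflected to subsets \<open>U\<close> of \<open>{..<2 * n}\<close>, where the
odds become \<open>q ^ u\<close> up to a common factor and the \<open>q\<close>-binomial theorem applies.\<close>

lemma sum_weight_window_charge:
  assumes n: "- int n \<le> d" "d \<le> int n"
  shows "(\<Sum>S\<in>window_sets n. if charge S = d then weight q \<beta> S else 0) =
    \<beta> powi d * q powr (real_of_int (d * (d - 1)) / 2) *
    (qpoch q (2 * n) / (qpoch q (nat (int n + d)) * qpoch q (nat (int n - d))))"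
proof -
  let ?W = "{1 - int n..int n}"
  define k where "k = nat (int n + d)"
  have k: "int k = int n + d" "k \<le> 2 * n" "2 * n - k = nat (int n - d)" using n by (auto simp: k_def)
  define R where "R = (\<Prod>i\<in>{1..int n}. inverse (odds q \<beta> i))"
  have "(\<Sum>S\<in>window_sets n. if charge S = d then weight q \<beta> S else 0) =
      (\<Sum>T\<in>Pow ?W. if card T = k then (\<Prod>i\<in>T. odds q \<beta> i) * R else 0)"
    unfolding sum_window_sets
  proof (rule sum.cong[OF refl])
    fix T assume "T \<in> Pow ?W"
    then have T: "T \<subseteq> ?W" by simp
    show "(if charge (T \<union> {int n<..}) = d then weight q \<beta> (T \<union> {int n<..}) else 0) =
       (if card T = k then (\<Prod>i\<in>T. odds q \<beta> i) * R else 0)"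
      using k charge_window[OF T] weight_window[OF T] by (auto simp: R_def)
  qed
  also have "\<dots> = (\<Sum>T\<in>{T. T \<subseteq> ?W \<and> card T = k}. (\<Prod>i\<in>T. odds q \<beta> i) * R)"
    by (rule sum.mono_neutral_cong_right) auto
  also have "\<dots> = (\<Sum>T\<in>{T. T \<subseteq> ?W \<and> card T = k}. \<Prod>i\<in>T. odds q \<beta> i) * R"
    by (simp add: sum_distrib_right)
  also have "(\<Sum>T\<in>{T. T \<subseteq> ?W \<and> card T = k}. \<Prod>i\<in>T. odds q \<beta> i) =
      (\<Sum>U\<in>{U. U \<subseteq> {..<2 * n} \<and> card U = k}. odds q \<beta> (int n) ^ k * (\<Prod>u\<in>U. q ^ u))"
  proof (rule sum.reindex_bij_witness[of _ "\<lambda>U. (\<lambda>u. int n - int u) ` U" "\<lambda>T. (\<lambda>i. nat (int n - i)) ` T"])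
    fix U assume U: "U \<in> {U. U \<subseteq> {..<2 * n} \<and> card U = k}"
    have inj: "inj_on (\<lambda>u. int n - int u) U" by (auto simp: inj_on_def)
    show "(\<lambda>i. nat (int n - i)) ` (\<lambda>u. int n - int u) ` U = U" by (simp add: image_image)
    show "(\<lambda>u. int n - int u) ` U \<in> {T. T \<subseteq> ?W \<and> card T = k}"
      using U card_image[OF inj] by auto
  next
    fix T assume T: "T \<in> {T. T \<subseteq> ?W \<and> card T = k}"
    have inj: "inj_on (\<lambda>i. nat (int n - i)) T"
    proof (rule inj_onI)
      fix i j assume "i \<in> T" "j \<in> T" "nat (int n - i) = nat (int n - j)"
      moreover have "i \<le> int n" "j \<le> int n" using T \<open>i \<in> T\<close> \<open>j \<in> T\<close> by auto
      ultimately show "i = j" by simp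
    qed
    have "(\<lambda>i. int n - int (nat (int n - i))) ` T = (\<lambda>i. i) ` T"
      by (rule image_cong) (use T in auto)
    then show "(\<lambda>u. int n - int u) ` (\<lambda>i. nat (int n - i)) ` T = T" by (simp add: image_image)
    have "nat (int n - i) < 2 * n" if "i \<in> T" for i
    proof -
      have "1 - int n \<le> i" "i \<le> int n" using T that by auto
      then show ?thesis by linarith
    qed
    then have "(\<lambda>i. nat (int n - i)) ` T \<subseteq> {..<2 * n}" by auto
    then show "(\<lambda>i. nat (int n - i)) ` T \<in> {U. U \<subseteq> {..<2 * n} \<and> card U = k}"
      using T card_image[OF inj] by simp
    have "(\<Prod>i\<in>T. odds q \<beta> i) = (\<Prod>i\<in>T. odds q \<beta> (int n) * q ^ nat (int n - i))"
    proof (rule prod.cong[OF refl])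
      fix i assume "i \<in> T"
      then have i: "real (nat (int n - i)) = real n - real_of_int i" using T by auto
      have "q ^ nat (int n - i) = q powr (real n - real_of_int i)"
        using q by (simp add: powr_realpow[symmetric] i)
      then show "odds q \<beta> i = odds q \<beta> (int n) * q ^ nat (int n - i)"
        using q by (simp add: odds_def powr_add[symmetric])
    qed
    also have "\<dots> = odds q \<beta> (int n) ^ k * (\<Prod>i\<in>T. q ^ nat (int n - i))"
      using T by (simp add: prod.distrib)
    also have "(\<Prod>i\<in>T. q ^ nat (int n - i)) = (\<Prod>u\<in>(\<lambda>i. nat (int n - i)) ` T. q ^ u)"
      by (simp add: prod.reindex[OF inj])
    finally show "odds q \<beta> (int n) ^ k * (\<Prod>u\<in>(\<lambda>i. nat (int n - i)) ` T. q ^ u) = (\<Prod>i\<in>T. odds q \<beta> i)"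
      by simp
  qed
  also have "\<dots> = odds q \<beta> (int n) ^ k * subset_sum q (2 * n) k"
    by (simp add: subset_sum_def sum_distrib_left)
  finally have lhs: "(\<Sum>S\<in>window_sets n. if charge S = d then weight q \<beta> S else 0) =
    odds q \<beta> (int n) ^ k * subset_sum q (2 * n) k * R" .
  have poch_pos: "0 < qpoch q m" for m
    unfolding qpoch_def using q by (intro prod_pos) (simp add: power_Suc_less_one del: power_Suc)
  have "subset_sum q (2 * n) k * (qpoch q k * qpoch q (2 * n - k)) = (\<Prod>u<k. q ^ u) * qpoch q (2 * n)"
    by (rule q_binomial[OF k(2)])
  then have binom: "subset_sum q (2 * n) k = q powr (real k * (real k - 1) / 2) *
      (qpoch q (2 * n) / (qpoch q (nat (int n + d)) * qpoch q (nat (int n - d))))"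
    using poch_pos[of k] poch_pos[of "2 * n - k"]
    unfolding k_def[symmetric] k(3)[symmetric] powr_triangle[OF q(1)]
    by (simp only: times_divide_eq_right eq_divide_eq) simp
  have "R = (\<Prod>j<n. inverse \<beta> * q ^ Suc j)"
    unfolding R_def prod_int_interval
  proof (rule prod.cong[OF refl])
    fix j
    show "inverse (odds q \<beta> (int j + 1)) = inverse \<beta> * q ^ Suc j"
      unfolding odds_def powr_minus_Suc[OF q(1)] by simp
  qed
  also have "\<dots> = inverse \<beta> ^ n * (\<Prod>j<n. q ^ Suc j)" by (simp only: prod.distrib) simp
  also have "(\<Prod>j<n. q ^ Suc j) = (\<Prod>u<Suc n. q ^ u)"
    by (simp only: prod.lessThan_Suc_shift) simp
  also have "\<dots> = q powr (real n * (real n + 1) / 2)"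
    using powr_triangle[OF q(1), of "Suc n"] by (simp add: mult.commute add.commute)
  finally have R: "R = inverse \<beta> ^ n * q powr (real n * (real n + 1) / 2)" .
  have odds_k: "odds q \<beta> (int n) ^ k = \<beta> ^ k * q powr (- real n * real k)"
    using q by (simp add: odds_def power_mult_distrib powr_power mult.commute)
  have "\<beta> ^ k * inverse \<beta> ^ n = \<beta> powi (int k - int n)"
    using \<beta> by (simp add: power_int_diff field_simps)
  then have \<beta>_d: "\<beta> ^ k * inverse \<beta> ^ n = \<beta> powi d" using k by simp
  have real_k: "real k = real n + real_of_int d" using k(1) by (metis of_int_add of_int_of_nat_eq)
  have q_d: "q powr (- real n * real k) * q powr (real k * (real k - 1) / 2) * q powr (real n * (real n + 1) / 2)
     = q powr (real_of_int (d * (d - 1)) / 2)"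
    unfolding powr_add[symmetric] real_k by (rule arg_cong[where f = "\<lambda>x. q powr x"]) (simp add: field_simps)
  let ?b = "qpoch q (2 * n) / (qpoch q (nat (int n + d)) * qpoch q (nat (int n - d)))"
  have "odds q \<beta> (int n) ^ k * subset_sum q (2 * n) k * R = (\<beta> ^ k * inverse \<beta> ^ n) *
    (q powr (- real n * real k) * q powr (real k * (real k - 1) / 2) * q powr (real n * (real n + 1) / 2)) * ?b"
    unfolding binom R odds_k by (simp only: ac_simps)
  then show ?thesis unfolding lhs \<beta>_d q_d .
qed



lemma convergent_prod_theta: "convergent_prod (\<lambda>k. 1 + q ^ Suc k / \<beta>)"
  using convergent_prod_geometric[OF q, of "q / \<beta>"] q \<beta> by (simp add: field_simps)

lemma theta_factor_pos: "0 < (\<Prod>k. 1 + \<beta> * q ^ k)" "0 < (\<Prod>k. 1 + q ^ Suc k / \<beta>)"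
  using q \<beta> by (auto intro!: less_0_prodinf convergent_prod_geometric[OF q] convergent_prod_theta add_pos_pos simp del: power_Suc)

lemma theta_norm_pos: "0 < theta_norm q \<beta>"
  using theta_factor_pos by (simp add: theta_norm_def del: power_Suc)

text \<open>Passing from \<open>\<beta>\<close> to \<open>\<beta> * q\<close> moves one factor from the first product to the second.\<close>

lemma theta_norm_mult_q: "theta_norm q (\<beta> * q) = theta_norm q \<beta> / \<beta>"
proof -
  have "(\<Prod>k. 1 + \<beta> * q ^ Suc k) = (\<Prod>k. 1 + \<beta> * q ^ k) / (1 + \<beta>)"
    using prodinf_split_head[OF convergent_prod_geometric[OF q, of \<beta>]] \<beta> by simp
  then have A: "(\<Prod>k. 1 + \<beta> * q * q ^ k) = (\<Prod>k. 1 + \<beta> * q ^ k) / (1 + \<beta>)"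
    by (simp add: mult.assoc)
  have "convergent_prod (\<lambda>k. 1 + 1 / \<beta> * q ^ k)" using \<beta> by (intro convergent_prod_geometric[OF q]) simp
  from prodinf_split_head[OF this]
  have "(\<Prod>k. 1 + q ^ Suc k / \<beta>) = (\<Prod>k. 1 + 1 / \<beta> * q ^ k) / (1 + 1 / \<beta>)"
    using \<beta> add_pos_pos[of 1 "1 / \<beta>"] by (simp add: field_simps)
  moreover have "(\<Prod>k. 1 + q ^ Suc k / (\<beta> * q)) = (\<Prod>k. 1 + 1 / \<beta> * q ^ k)"
    using q \<beta> by (simp add: field_simps)
  moreover have "1 + 1 / \<beta> > 0" using \<beta> by (simp add: add_pos_pos)
  ultimately have B: "(\<Prod>k. 1 + q ^ Suc k / (\<beta> * q)) = (1 + 1 / \<beta>) * (\<Prod>k. 1 + q ^ Suc k / \<beta>)"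
    by (simp add: field_simps)
  have "1 + 1 / \<beta> = (1 + \<beta>) / \<beta>" using \<beta> by (simp add: add_divide_distrib)
  then show ?thesis unfolding theta_norm_def A B using \<beta> by simp
qed

lemma sum_weight_LIMSEQ: "(\<lambda>n. \<Sum>S\<in>window_sets n. weight q \<beta> S) \<longlonglongrightarrow> theta_norm q \<beta>"
  unfolding sum_weight_window theta_norm_def
  using \<beta> by (intro tendsto_mult prod_lessThan_LIMSEQ convergent_prod_geometric[OF q] convergent_prod_theta) simp

lemma sum_weight_charge_LIMSEQ:
  "(\<lambda>n. \<Sum>S\<in>window_sets n. if charge S = d then weight q \<beta> S else 0) \<longlonglongrightarrow>
    \<beta> powi d * q powr (real_of_int (d * (d - 1)) / 2) / (\<Prod>k. 1 - q ^ Suc k)"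
proof -
  let ?\<phi> = "\<Prod>k. 1 - q ^ Suc k"
  have poch: "qpoch q \<longlonglongrightarrow> ?\<phi>"
    using prod_lessThan_LIMSEQ[OF convergent_prod_qpoch[OF q]] by (simp add: qpoch_def[abs_def])
  \<comment> \<open>all three indices in the quotient below tend to infinity with the window\<close>
  have shift: "(\<lambda>n. qpoch q (f n)) \<longlonglongrightarrow> ?\<phi>" if "\<And>n. n - nat \<bar>d\<bar> \<le> f n" for f
  proof -
    have "filterlim f at_top sequentially"
    proof (rule filterlim_at_top_mono)
      show "filterlim (\<lambda>n. n - nat \<bar>d\<bar>) at_top sequentially"
        by (rule filterlim_minus_const_nat_at_top)
    qed (use that in simp)
    then show ?thesis by (rule filterlim_compose[OF poch])
  qed
  have lim: "(\<lambda>n. qpoch q (2 * n) / (qpoch q (nat (int n + d)) * qpoch q (nat (int n - d)))) \<longlonglongrightarrow> ?\<phi> / (?\<phi> * ?\<phi>)"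
    by (intro tendsto_divide tendsto_mult shift) (use qpoch_inf_pos[OF q] in auto)
  have "(\<lambda>n. \<beta> powi d * q powr (real_of_int (d * (d - 1)) / 2) *
     (qpoch q (2 * n) / (qpoch q (nat (int n + d)) * qpoch q (nat (int n - d))))) \<longlonglongrightarrow> 
     \<beta> powi d * q powr (real_of_int (d * (d - 1)) / 2) * (?\<phi> / (?\<phi> * ?\<phi>))"
    by (intro tendsto_mult tendsto_const lim)
  moreover have "\<forall>\<^sub>F n in sequentially. \<beta> powi d * q powr (real_of_int (d * (d - 1)) / 2) *
     (qpoch q (2 * n) / (qpoch q (nat (int n + d)) * qpoch q (nat (int n - d)))) =
     (\<Sum>S\<in>window_sets n. if charge S = d then weight q \<beta> S else 0)"
    unfolding eventually_sequentially
  proof (intro exI[of _ "nat \<bar>d\<bar>"] allI impI)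
    fix n assume "nat \<bar>d\<bar> \<le> n"
    then have "- int n \<le> d" "d \<le> int n" by auto
    then show "\<beta> powi d * q powr (real_of_int (d * (d - 1)) / 2) *
     (qpoch q (2 * n) / (qpoch q (nat (int n + d)) * qpoch q (nat (int n - d)))) =
     (\<Sum>S\<in>window_sets n. if charge S = d then weight q \<beta> S else 0)"
      by (rule sum_weight_window_charge[symmetric])
  qed
  ultimately have "(\<lambda>n. \<Sum>S\<in>window_sets n. if charge S = d then weight q \<beta> S else 0) \<longlonglongrightarrow>
     \<beta> powi d * q powr (real_of_int (d * (d - 1)) / 2) * (?\<phi> / (?\<phi> * ?\<phi>))"
    by (rule Lim_transform_eventually)
  then show ?thesis using qpoch_inf_pos[OF q] by simp
qed

end

definition level_pmf :: "real \<Rightarrow> real \<Rightarrow> int set pmf" where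
  "level_pmf q \<beta> = embed_pmf (\<lambda>S. weight q \<beta> S / theta_norm q \<beta>)"

context
  fixes q \<beta> :: real
  assumes q: "0 < q" "q < 1" and \<beta>: "0 < \<beta>"
begin

lemma pmf_level: "pmf (level_pmf q \<beta>) S = weight q \<beta> S / theta_norm q \<beta>"
  unfolding level_pmf_def
proof (rule pmf_embed_pmf)
  have pos: "0 < theta_norm q \<beta>" by (rule theta_norm_pos[OF q \<beta>])
  show "0 \<le> weight q \<beta> S / theta_norm q \<beta>" for S
    using weight_nonneg[OF q \<beta>] pos by simp
  have "(\<lambda>n. (\<Sum>S\<in>window_sets n. weight q \<beta> S) / theta_norm q \<beta>) \<longlonglongrightarrow> theta_norm q \<beta> / theta_norm q \<beta>"
    using pos by (intro tendsto_divide sum_weight_LIMSEQ[OF q \<beta>] tendsto_const) simp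
  then have "(\<integral>\<^sup>+S. ennreal (weight q \<beta> S / theta_norm q \<beta>) \<partial>count_space UNIV) = ennreal (theta_norm q \<beta> / theta_norm q \<beta>)"
    using weight_nonneg[OF q \<beta>] pos
    by (intro nn_integral_tame) (simp_all add: sum_divide_distrib weight_def)
  then show "(\<integral>\<^sup>+S. ennreal (weight q \<beta> S / theta_norm q \<beta>) \<partial>count_space UNIV) = 1"
    using pos by simp
qed

lemma set_pmf_level: "S \<in> set_pmf (level_pmf q \<beta>) \<Longrightarrow> tame S"
  by (auto simp: set_pmf_eq pmf_level weight_def split: if_splits)

lemma prob_level_charge:
  "measure (level_pmf q \<beta>) {S. charge S = d} =
    \<beta> powi d * q powr (real_of_int (d * (d - 1)) / 2) / ((\<Prod>k. 1 - q ^ Suc k) * theta_norm q \<beta>)"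
    (is "_ = ?r")
proof -
  have pos: "0 < theta_norm q \<beta>" by (rule theta_norm_pos[OF q \<beta>])
  let ?f = "\<lambda>S. (if charge S = d then weight q \<beta> S else 0) / theta_norm q \<beta>"
  have "emeasure (level_pmf q \<beta>) {S. charge S = d} = (\<integral>\<^sup>+S. ennreal (pmf (level_pmf q \<beta>) S) * indicator {S. charge S = d} S \<partial>count_space UNIV)"
    by (subst nn_integral_measure_pmf[symmetric]) simp
  also have "\<dots> = (\<integral>\<^sup>+S. ennreal (?f S) \<partial>count_space UNIV)"
    by (intro nn_integral_cong) (simp add: pmf_level indicator_def)
  also have "\<dots> = ennreal ?r"
  proof (rule nn_integral_tame)
    have "(\<lambda>n. (\<Sum>S\<in>window_sets n. if charge S = d then weight q \<beta> S else 0) / theta_norm q \<beta>) \<longlonglongrightarrow>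
      (\<beta> powi d * q powr (real_of_int (d * (d - 1)) / 2) / (\<Prod>k. 1 - q ^ Suc k)) / theta_norm q \<beta>"
      using pos by (intro tendsto_divide sum_weight_charge_LIMSEQ[OF q \<beta>] tendsto_const) simp
    then show "(\<lambda>n. \<Sum>S\<in>window_sets n. ?f S) \<longlonglongrightarrow> ?r" by (simp add: sum_divide_distrib)
  qed (use weight_nonneg[OF q \<beta>] pos in \<open>auto simp: weight_def\<close>)
  finally have "ennreal (measure (level_pmf q \<beta>) {S. charge S = d}) = ennreal ?r"
    by (simp add: measure_pmf.emeasure_eq_measure)
  moreover have "0 \<le> ?r" using q \<beta> pos qpoch_inf_pos[OF q] by simp
  ultimately show ?thesis by (simp del: power_Suc)
qed

end

text \<open>For \<open>m = 1\<close> the two sides agree factor by factor. Raising the threshold by one multiplies \<open>\<beta>\<close> by \<open>q\<close> and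
lowers the charge by one; the quasi-periodicity of the theta function shows that the right-hand side
does not change.\<close>

lemma mallows_weight_eq_prob_charge:
  assumes q: "0 < q" "q < 1" and \<alpha>: "0 < \<alpha>"
  shows "mallows_weight q \<alpha> c = measure (level_pmf q (\<alpha> * q powr (real_of_int m - 1/2))) {S. charge S = c - m + 1}"
proof -
  define \<beta> where "\<beta> m = \<alpha> * q powr (real_of_int m - 1/2)" for m
  have \<beta>: "0 < \<beta> m" for m using q \<alpha> by (simp add: \<beta>_def)
  define M where "M m = measure (level_pmf q (\<beta> m)) {S. charge S = c - m + 1}" for m
  have step: "M (m + 1) = M m" for m
  proof -
    let ?d = "c - m"
    have "real_of_int (m + 1) - 1/2 = (real_of_int m - 1/2) + 1" by simp
    then have "q powr (real_of_int (m + 1) - 1/2) = q powr (real_of_int m - 1/2) * q"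
      using q by (simp only: powr_add powr_one)
    then have \<beta>_Suc: "\<beta> (m + 1) = \<beta> m * q" by (simp only: \<beta>_def mult.assoc)
    have powr_d: "q powr real_of_int ?d = q powi ?d"
      using q by (intro powr_real_of_int') auto
    have "\<beta> (m + 1) powi ?d * q powr (real_of_int (?d * (?d - 1)) / 2) = 
       \<beta> m powi ?d * (q powr real_of_int ?d * q powr (real_of_int (?d * (?d - 1)) / 2))"
      unfolding powr_d by (simp add: \<beta>_Suc power_int_mult_distrib)
    also have "q powr real_of_int ?d * q powr (real_of_int (?d * (?d - 1)) / 2) = q powr (real_of_int ((?d + 1) * (?d + 1 - 1)) / 2)"
      unfolding powr_add[symmetric] by (rule arg_cong[where f = "\<lambda>x. q powr x"]) (simp add: field_simps)
    finally have num: "\<beta> (m + 1) powi ?d * q powr (real_of_int (?d * (?d - 1)) / 2) * \<beta> m = 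
       \<beta> m powi (?d + 1) * q powr (real_of_int ((?d + 1) * (?d + 1 - 1)) / 2)"
      using \<beta>[of m] by (simp add: power_int_add)
    have norm: "theta_norm q (\<beta> (m + 1)) = theta_norm q (\<beta> m) / \<beta> m"
      unfolding \<beta>_Suc by (rule theta_norm_mult_q[OF q \<beta>])
    have "M (m + 1) = \<beta> (m + 1) powi ?d * q powr (real_of_int (?d * (?d - 1)) / 2) / ((\<Prod>k. 1 - q ^ Suc k) * theta_norm q (\<beta> (m + 1)))"
      unfolding M_def by (subst prob_level_charge[OF q \<beta>]) simp
    also have "\<dots> = (\<beta> (m + 1) powi ?d * q powr (real_of_int (?d * (?d - 1)) / 2) * \<beta> m) / ((\<Prod>k. 1 - q ^ Suc k) * theta_norm q (\<beta> m))"
      unfolding norm by simp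
    also have "\<dots> = M m"
      unfolding num M_def by (subst prob_level_charge[OF q \<beta>]) simp
    finally show ?thesis .
  qed
  have "M m = M 1" 
  proof (induction m rule: int_induct[where k = 1])
    case (step1 i) then show ?case using step by simp
  next
    case (step2 i) then show ?case using step[of "i - 1"] by simp
  qed simp
  moreover have "mallows_weight q \<alpha> c = M 1"
  proof -
    have b: "\<beta> 1 = \<alpha> * q powr (1/2)" by (simp add: \<beta>_def)
    have "\<beta> 1 powi c * q powr (real_of_int (c * (c - 1)) / 2) = \<alpha> powi c * (q powr (real_of_int c / 2) * q powr (real_of_int (c * (c - 1)) / 2))"
      using q by (simp add: b power_int_mult_distrib powr_real_of_int'[symmetric] powr_powr)
    also have "q powr (real_of_int c / 2) * q powr (real_of_int (c * (c - 1)) / 2) = q powr (real_of_int (c^2) / 2)"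
      unfolding powr_add[symmetric] by (rule arg_cong[where f = "\<lambda>x. q powr x"]) (simp add: field_simps power2_eq_square)
    finally have num: "\<beta> 1 powi c * q powr (real_of_int (c * (c - 1)) / 2) = \<alpha> powi c * q powr (real_of_int (c^2) / 2)" .
    have "\<beta> 1 * q ^ k = \<alpha> * q powr (real k + 1/2)" for k
      using q by (simp add: b powr_add powr_realpow)
    moreover have "q ^ Suc k / \<beta> 1 = inverse \<alpha> * q powr (real k + 1/2)" for k
    proof -
      have "real (Suc k) = (real k + 1/2) + 1/2" by simp
      moreover have "q ^ Suc k = q powr real (Suc k)" using q by (simp only: powr_realpow)
      ultimately have "q ^ Suc k = q powr (real k + 1/2) * q powr (1/2)" by (simp only: powr_add)
      then have "q ^ Suc k / \<beta> 1 = q powr (real k + 1/2) * q powr (1/2) / (\<alpha> * q powr (1/2))"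
        by (simp only: b)
      also have "\<dots> = inverse \<alpha> * q powr (real k + 1/2)"
        using q by (simp only: mult_divide_mult_cancel_right powr_eq_0_iff divide_inverse mult.commute) simp
      finally show ?thesis .
    qed
    ultimately have norm: "theta_norm q (\<beta> 1) = (\<Prod>k. 1 + \<alpha> * q powr (real k + 1/2)) * (\<Prod>k. 1 + inverse \<alpha> * q powr (real k + 1/2))"
      by (simp add: theta_norm_def del: power_Suc)
    have c: "c - 1 + 1 = c" by simp
    show ?thesis
      unfolding M_def mallows_weight_def c prob_level_charge[OF q \<beta>] num norm by (simp only: mult.assoc)
  qed
  ultimately show ?thesis by (simp add: M_def \<beta>_def)
qed

section \<open>Filling a level set\<close>

definition rank_in :: "int set \<Rightarrow> int \<Rightarrow> nat" where
  "rank_in S i = card {j \<in> S. j < i}"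

text \<open>Reflection turns the complement of a tame set into a tame set, so the values below the threshold can
be treated like those above it, read from right to left and from top to bottom.\<close>

definition reflect :: "int set \<Rightarrow> int set" where
  "reflect S = uminus ` (- S)"

lemma mem_reflect [simp]: "i \<in> reflect S \<longleftrightarrow> - i \<notin> S"
  unfolding reflect_def by (metis ComplD ComplI add.inverse_inverse image_iff)

lemma tame_finite_below: "tame S \<Longrightarrow> finite {j \<in> S. j < i}"
  by (rule finite_subset[of _ "{j \<in> S. j \<le> 0} \<union> {0..i}"]) (auto simp: tame_def)

lemma tame_infinite: "tame S \<Longrightarrow> infinite S"
proof
  assume S: "tame S" "finite S"
  have "{0<..} \<subseteq> S \<union> {i. i \<notin> S \<and> 0 < i}" by auto
  then have "finite {0::int<..}" by (rule finite_subset) (use S in \<open>simp add: tame_def\<close>)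
  then show False by (simp add: infinite_Ioi)
qed

lemma tame_reflect [simp]:
  assumes "tame S" shows "tame (reflect S)"
proof -
  have "{i \<in> reflect S. i \<le> 0} \<subseteq> insert 0 (uminus ` {i. i \<notin> S \<and> 0 < i})"
  proof
    fix i assume "i \<in> {i \<in> reflect S. i \<le> 0}"
    then have "- i \<in> insert 0 {i. i \<notin> S \<and> 0 < i}" by auto
    then show "i \<in> insert 0 (uminus ` {i. i \<notin> S \<and> 0 < i})" by force
  qed
  moreover have "{i. i \<notin> reflect S \<and> 0 < i} \<subseteq> uminus ` {i \<in> S. i \<le> 0}"
  proof
    fix i assume "i \<in> {i. i \<notin> reflect S \<and> 0 < i}"
    then have "- i \<in> {i \<in> S. i \<le> 0}" by auto
    then show "i \<in> uminus ` {i \<in> S. i \<le> 0}" by force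
  qed
  moreover have "finite (insert 0 (uminus ` {i. i \<notin> S \<and> 0 < i}))" "finite (uminus ` {i \<in> S. i \<le> 0})"
    using assms by (auto simp: tame_def)
  ultimately show ?thesis unfolding tame_def using finite_subset by blast
qed

lemma rank_less:
  assumes "tame S" "i \<in> S" "i < j" shows "rank_in S i < rank_in S j"
  unfolding rank_in_def
proof (rule psubset_card_mono)
  show "{l \<in> S. l < i} \<subset> {l \<in> S. l < j}" using assms by auto
qed (rule tame_finite_below[OF assms(1)])

lemma inj_on_rank: "tame S \<Longrightarrow> inj_on (rank_in S) S"
  by (rule linorder_inj_onI') (use rank_less in fastforce)

lemma rank_Suc:
  assumes "tame S" "i \<in> S" shows "rank_in S (i + 1) = Suc (rank_in S i)"
proof -
  have "{j \<in> S. j < i + 1} = insert i {j \<in> S. j < i}" using assms by auto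
  then show ?thesis using tame_finite_below[OF assms(1), of i] by (simp add: rank_in_def)
qed

lemma bij_betw_rank:
  assumes S: "tame S" shows "bij_betw (rank_in S) S UNIV"
proof -
  have inf: "infinite (rank_in S ` S)"
    using tame_infinite[OF S] inj_on_rank[OF S] finite_imageD by blast
  have down: "n \<in> rank_in S ` S" if Suc_n: "Suc n \<in> rank_in S ` S" for n
  proof -
    obtain i where i: "i \<in> S" "rank_in S i = Suc n" using Suc_n by force
    let ?A = "{j \<in> S. j < i}"
    have fin: "finite ?A" by (rule tame_finite_below[OF S])
    have "?A \<noteq> {}" using i(2) by (auto simp: rank_in_def simp del: Collect_empty_eq)
    then have Max: "Max ?A \<in> ?A" using fin Max_in by blast
    have "{j \<in> S. j < Max ?A} = ?A - {Max ?A}"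
    proof (intro equalityI subsetI)
      fix j assume "j \<in> ?A - {Max ?A}"
      then have "j \<in> S" "j \<le> Max ?A" "j \<noteq> Max ?A" using fin by auto
      then show "j \<in> {j \<in> S. j < Max ?A}" by simp
    qed (use Max in auto)
    then have "rank_in S (Max ?A) = n"
      using i(2) Max fin by (simp add: rank_in_def card_Diff_singleton)
    then show ?thesis using Max by blast
  qed
  have "n \<in> rank_in S ` S" for n
  proof -
    obtain k where "n \<le> k" "k \<in> rank_in S ` S"
      using inf by (meson infinite_nat_iff_unbounded_le)
    then show ?thesis by (induction rule: inc_induct) (use down in auto)
  qed
  then show ?thesis using inj_on_rank[OF S] by (auto simp: bij_betw_def)
qed

lemma transpose_image_unchanged:
  assumes "i \<in> S \<longleftrightarrow> i + 1 \<in> S"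
  shows "Transposition.transpose i (i + 1) ` S = (S :: int set)"
proof (cases "i \<in> S")
  case True
  then show ?thesis using assms by (intro transpose_image_eq) auto
next
  case False
  then show ?thesis using assms by (intro transpose_image_eq) auto
qed

lemma transpose_image_moved:
  assumes "i \<in> S" "i + 1 \<notin> (S :: int set)"
  shows "Transposition.transpose i (i + 1) ` S = insert (i + 1) (S - {i})"
proof -
  have "S = insert i (S - {i})" using assms by auto
  moreover have "Transposition.transpose i (i + 1) ` (S - {i}) = S - {i}"
    using assms by (intro transpose_image_eq) auto
  ultimately show ?thesis by (metis image_insert transpose_apply_first)
qed

lemma transpose_image_invol: "Transposition.transpose i j ` Transposition.transpose i j ` S = S"
  by (simp add: image_image)

text \<open>In the last case \<open>S\<close> is written as the image of a set of the second kind, so that only one direction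
has to be computed.\<close>

lemma transpose_cases:
  fixes S :: "int set"
  obtains (same) "i \<in> S \<longleftrightarrow> i + 1 \<in> S" | (moved) "i \<in> S" "i + 1 \<notin> S"
  | (swapped) T where "S = Transposition.transpose i (i + 1) ` T" "i \<in> T" "i + 1 \<notin> T"
proof -
  have "\<exists>T. S = Transposition.transpose i (i + 1) ` T \<and> i \<in> T \<and> i + 1 \<notin> T" if "i \<notin> S" "i + 1 \<in> S"
  proof (intro exI conjI)
    let ?T = "Transposition.transpose i (i + 1) ` S"
    show "S = Transposition.transpose i (i + 1) ` ?T" by (simp only: transpose_image_invol)
    have mem: "x \<in> ?T \<longleftrightarrow> Transposition.transpose i (i + 1) x \<in> S" for x
      using inj_image_mem_iff[OF inj_transpose, of i "i + 1" "Transposition.transpose i (i + 1) x" S] by simp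
    show "i \<in> ?T" "i + 1 \<notin> ?T"
      using that by (simp_all only: mem transpose_apply_first transpose_apply_second not_False_eq_True)
  qed
  then show thesis using that by blast
qed

lemma tame_transpose [simp]: "tame (Transposition.transpose i (i + 1) ` S) \<longleftrightarrow> tame S"
proof -
  have moved: "tame (Transposition.transpose i (i + 1) ` T) \<longleftrightarrow> tame T" if "i \<in> T" "i + 1 \<notin> T" for T
    using tame_insert[of i "T - {i}"] that by (simp add: transpose_image_moved insert_absorb)
  show ?thesis
    by (cases rule: transpose_cases[of i S]) (simp_all add: transpose_image_unchanged moved transpose_image_invol)
qed

lemma charge_transpose:
  assumes "tame S" shows "charge (Transposition.transpose i (i + 1) ` S) = charge S"
proof -
  have moved: "charge (Transposition.transpose i (i + 1) ` T) = charge T" if "tame T" "i \<in> T" "i + 1 \<notin> T" for T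
  proof -
    have T: "T = insert i (T - {i})" using that by auto
    then have "tame (T - {i})" using tame_insert[of i "T - {i}"] that by simp
    then have "charge (insert i (T - {i})) = charge (T - {i}) + 1"
      "charge (insert (i + 1) (T - {i})) = charge (T - {i}) + 1"
      using that by (intro charge_insert; simp)+
    then show ?thesis using T transpose_image_moved[OF that(2,3)] by simp
  qed
  show ?thesis
  proof (cases rule: transpose_cases[of i S])
    case (swapped T)
    then show ?thesis using assms moved[of T] by (simp add: transpose_image_invol)
  qed (use assms moved in \<open>simp_all add: transpose_image_unchanged\<close>)
qed

text \<open>The two swapped positions are not both in \<open>S\<close>, so the swap is increasing on \<open>S\<close>.\<close>

lemma rank_transpose:
  assumes i: "i \<in> S \<longleftrightarrow> i + 1 \<notin> S" and j: "j \<in> S"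
  shows "rank_in (Transposition.transpose i (i + 1) ` S) (Transposition.transpose i (i + 1) j) = rank_in S j"
proof -
  let ?\<tau> = "Transposition.transpose i (i + 1)"
  have mono: "?\<tau> l < ?\<tau> j \<longleftrightarrow> l < j" if "l \<in> S" for l
    using i j that by (cases "i \<in> S") (auto simp: Transposition.transpose_def)
  have "{l \<in> ?\<tau> ` S. l < ?\<tau> j} = ?\<tau> ` {l \<in> S. l < j}" using mono by auto
  moreover have "inj_on ?\<tau> {l \<in> S. l < j}" by (rule inj_on_subset[OF inj_transpose]) simp
  ultimately show ?thesis unfolding rank_in_def by (metis card_image)
qed

lemma reflect_transpose:
  "reflect (Transposition.transpose i (i + 1) ` S) = Transposition.transpose (- i - 1) (- i - 1 + 1) ` reflect S"
proof -
  have "- (Transposition.transpose i (i + 1) ` S) = Transposition.transpose i (i + 1) ` (- S)"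
    by (simp add: bij_image_Compl_eq)
  moreover have "- Transposition.transpose i (i + 1) j = Transposition.transpose (- i - 1) (- i - 1 + 1) (- j)" for j
    by (auto simp: Transposition.transpose_def)
  ultimately show ?thesis by (simp only: reflect_def image_image)
qed

definition fill :: "int \<Rightarrow> int set \<Rightarrow> (nat \<Rightarrow> nat) \<Rightarrow> (nat \<Rightarrow> nat) \<Rightarrow> int \<Rightarrow> int" where
  "fill m S b a i = (if i \<in> S then m + int (b (rank_in S i)) else m - 1 - int (a (rank_in (reflect S) (- i))))"

lemma fill_ge_iff: "m \<le> fill m S b a i \<longleftrightarrow> i \<in> S"
  by (simp add: fill_def)

lemma bij_fill:
  assumes S: "tame S" and "bij b" "bij a"
  shows "bij (fill m S b a)"
proof -
  have "bij_betw (\<lambda>n. m + int n) UNIV {m..}"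
    by (rule bij_betw_byWitness[where f' = "\<lambda>v. nat (v - m)"]) auto
  then have "bij_betw ((\<lambda>n. m + int n) \<circ> (b \<circ> rank_in S)) S {m..}"
    using bij_betw_rank[OF S] \<open>bij b\<close> by (blast intro: bij_betw_trans)
  then have 1: "bij_betw (fill m S b a) S {m..}"
    by (rule bij_betw_cong[THEN iffD1, rotated]) (simp add: fill_def)
  have "bij_betw uminus (- S) (reflect S)" by (simp add: bij_betw_def reflect_def)
  moreover have "bij_betw (\<lambda>n. m - 1 - int n) UNIV {..<m}"
    by (rule bij_betw_byWitness[where f' = "\<lambda>v. nat (m - 1 - v)"]) auto
  ultimately have "bij_betw ((\<lambda>n. m - 1 - int n) \<circ> (a \<circ> (rank_in (reflect S) \<circ> uminus))) (- S) {..<m}"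
    using bij_betw_rank[OF tame_reflect[OF S]] \<open>bij a\<close> by (blast intro: bij_betw_trans)
  then have 2: "bij_betw (fill m S b a) (- S) {..<m}"
    by (rule bij_betw_cong[THEN iffD1, rotated]) (simp add: fill_def)
  have "bij_betw (fill m S b a) (S \<union> - S) ({m..} \<union> {..<m})"
    by (rule bij_betw_combine[OF 1 2]) auto
  moreover have "{m..} \<union> {..<m} = (UNIV :: int set)" by auto
  ultimately show ?thesis by simp
qed

text \<open>Moving a point of the level set to a neighbouring free position changes no rank, so the filled
permutation is merely composed with the swap.\<close>

lemma fill_transpose:
  assumes "i \<in> S \<longleftrightarrow> i + 1 \<notin> S"
  shows "fill m (Transposition.transpose i (i + 1) ` S) b a (Transposition.transpose i (i + 1) j) = fill m S b a j"
proof (cases "j \<in> S")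
  case True
  then show ?thesis using rank_transpose[OF assms] by (simp add: fill_def)
next
  case False
  let ?\<tau> = "Transposition.transpose i (i + 1)" and ?\<tau>' = "Transposition.transpose (- i - 1) (- i - 1 + 1)"
  have "?\<tau> j \<notin> ?\<tau> ` S" using False by (simp add: inj_image_mem_iff)
  moreover have "- ?\<tau> j = ?\<tau>' (- j)" by (auto simp: Transposition.transpose_def)
  moreover have "rank_in (?\<tau>' ` reflect S) (?\<tau>' (- j)) = rank_in (reflect S) (- j)"
    by (rule rank_transpose) (use assms False in \<open>auto simp: algebra_simps\<close>)
  ultimately show ?thesis using False unfolding fill_def reflect_transpose by simp
qed

text \<open>For sets that are not tame the ranks are meaningless, and the identity serves as a default that makes
the kernel total.\<close>

definition filling :: "real \<Rightarrow> int \<Rightarrow> int set \<Rightarrow> (int \<Rightarrow> int) measure" where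
  "filling q m S = distr (geometric_seq q \<Otimes>\<^sub>M geometric_seq q) perm_space
     (\<lambda>(g, h). if tame S then fill m S (shuffle g) (shuffle h) else id)"

lemma space_pair_geometric [simp]: "space (geometric_seq q \<Otimes>\<^sub>M geometric_seq q) = UNIV"
  by (simp add: space_pair_measure)

lemma measurable_filling:
  "(\<lambda>(g, h). if tame S then fill m S (shuffle g) (shuffle h) else id)
    \<in> measurable (geometric_seq q \<Otimes>\<^sub>M geometric_seq q) perm_space"
proof (rule measurable_into_perm_space)
  fix w show "bij (case w of (g, h) \<Rightarrow> if tame S then fill m S (shuffle g) (shuffle h) else id)"
    by (cases w) (simp add: bij_fill bij_shuffle)
next
  fix i
  show "(\<lambda>w. (case w of (g, h) \<Rightarrow> if tame S then fill m S (shuffle g) (shuffle h) else id) i)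
    \<in> measurable (geometric_seq q \<Otimes>\<^sub>M geometric_seq q) (count_space UNIV)"
  proof (cases "tame S")
    case True
    have meas: "(\<lambda>w. shuffle (fst w) n) \<in> measurable (geometric_seq q \<Otimes>\<^sub>M geometric_seq q) (count_space UNIV)"
      "(\<lambda>w. shuffle (snd w) n) \<in> measurable (geometric_seq q \<Otimes>\<^sub>M geometric_seq q) (count_space UNIV)" for n
      by (rule measurable_compose[OF measurable_fst measurable_shuffle])
         (rule measurable_compose[OF measurable_snd measurable_shuffle])
    have "(\<lambda>w. m + int (shuffle (fst w) n)) \<in> measurable (geometric_seq q \<Otimes>\<^sub>M geometric_seq q) (count_space UNIV)"
      "(\<lambda>w. m - 1 - int (shuffle (snd w) n)) \<in> measurable (geometric_seq q \<Otimes>\<^sub>M geometric_seq q) (count_space UNIV)" for n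
      by (rule measurable_compose[OF meas(1), where g = "\<lambda>k. m + int k"], simp)
         (rule measurable_compose[OF meas(2), where g = "\<lambda>k. m - 1 - int k"], simp)
    then show ?thesis using True
      by (cases "i \<in> S") (simp_all add: fill_def case_prod_beta)
  qed (simp add: case_prod_beta)
qed

lemma prob_space_filling: "prob_space (filling q m S)"
proof -
  interpret G: prob_space "geometric_seq q" by (rule prob_space_geometric_seq)
  interpret pair_prob_space "geometric_seq q" "geometric_seq q" ..
  show ?thesis unfolding filling_def by (rule prob_space_distr[OF measurable_filling])
qed

lemma sets_filling [simp]: "sets (filling q m S) = sets perm_space"
  by (simp add: filling_def)

lemma measure_filling:
  assumes "tame S" "A \<in> sets perm_space"
  shows "measure (filling q m S) A =
    measure (geometric_seq q \<Otimes>\<^sub>M geometric_seq q) {(g, h). fill m S (shuffle g) (shuffle h) \<in> A}"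
  unfolding filling_def
  by (subst measure_distr[OF measurable_filling assms(2)])
     (use assms(1) in \<open>auto intro!: arg_cong2[where f = measure]\<close>)

text \<open>One of the two factors of a cylinder probability: it serves \<open>S\<close> and, after reflection, the complement.\<close>

definition partial_law :: "real \<Rightarrow> int set \<Rightarrow> int set \<Rightarrow> (int \<Rightarrow> int) \<Rightarrow> real" where
  "partial_law q S J w = measure (geometric_seq q) {g. \<forall>j\<in>J. int (shuffle g (rank_in S j)) = w j}"

text \<open>The values on \<open>S\<close> and those on its complement are driven by two independent sequences.\<close>

lemma filling_cylinder:
  assumes S: "tame S" and I: "finite I"
  shows "measure (filling q m S) (cylinder I y) =
    partial_law q S (I \<inter> S) (\<lambda>j. y j - m) *
    partial_law q (reflect S) (uminus ` (I - S)) (\<lambda>j. m - 1 - y (- j))"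
proof -
  interpret G: prob_space "geometric_seq q" by (rule prob_space_geometric_seq)
  interpret pair_prob_space "geometric_seq q" "geometric_seq q" ..
  let ?A = "{g. \<forall>j\<in>I \<inter> S. int (shuffle g (rank_in S j)) = y j - m}"
  let ?B = "{h. \<forall>j\<in>uminus ` (I - S). int (shuffle h (rank_in (reflect S) j)) = m - 1 - y (- j)}"
  have "{(g, h). fill m S (shuffle g) (shuffle h) \<in> cylinder I y} = ?A \<times> ?B"
    using bij_fill[OF S bij_shuffle bij_shuffle] by (force simp: cylinder_def fill_def)
  moreover have "{g \<in> space (geometric_seq q). \<forall>j\<in>J. int (shuffle g (f j)) = w j} \<in> sets (geometric_seq q)"
    if "finite J" for J :: "int set" and f :: "int \<Rightarrow> nat" and w :: "int \<Rightarrow> int" using that by measurable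
  then have "?A \<in> sets (geometric_seq q)" "?B \<in> sets (geometric_seq q)" using I by simp_all
  moreover from this have "measure (geometric_seq q \<Otimes>\<^sub>M geometric_seq q) (?A \<times> ?B) =
      measure (geometric_seq q) ?A * measure (geometric_seq q) ?B"
    by (simp add: measure_def G.emeasure_pair_measure_Times enn2real_mult)
  ultimately show ?thesis
    by (simp only: measure_filling[OF S cylinder_in_sets[OF I]] partial_law_def)
qed

lemma partial_law_transpose:
  assumes q: "0 < q" "q < 1" and S: "tame S" and p: "p \<in> J" "p + 1 \<in> J" and J: "J \<subseteq> S" "finite J"
    and w: "w p \<noteq> w (p + 1)"
  shows "partial_law q S J (\<lambda>j. w (Transposition.transpose p (p + 1) j)) =
    q powi sgn (w (p + 1) - w p) * partial_law q S J w"
proof -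
  let ?\<tau> = "Transposition.transpose p (p + 1)" and ?r = "rank_in S p"
  define z where "z k = w (inv_into S (rank_in S) k)" for k
  have z: "z (rank_in S j) = w j" if "j \<in> S" for j
    using that inj_on_rank[OF S] by (simp add: z_def)
  have pS: "p \<in> S" "p + 1 \<in> S" using p J by auto
  have Suc: "rank_in S (p + 1) = Suc ?r" by (rule rank_Suc[OF S pS(1)])
  have \<tau>: "Transposition.transpose ?r (Suc ?r) (rank_in S j) = rank_in S (?\<tau> j)" if "j \<in> S" for j
    using inj_on_eq_iff[OF inj_on_rank[OF S] that pS(1)] inj_on_eq_iff[OF inj_on_rank[OF S] that pS(2)] Suc
    by (auto simp: Transposition.transpose_def)
  have \<tau>S: "?\<tau> j \<in> S" if "j \<in> S" for j using that pS by (auto simp: Transposition.transpose_def)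
  have "measure (geometric_seq q) {g. \<forall>k\<in>rank_in S ` J. int (shuffle g k) = z (Transposition.transpose ?r (Suc ?r) k)} =
    q powi sgn (z (Suc ?r) - z ?r) * measure (geometric_seq q) {g. \<forall>k\<in>rank_in S ` J. int (shuffle g k) = z k}"
  proof (rule prob_shuffle_transpose[OF q])
    show "z ?r \<noteq> z (Suc ?r)" using w z pS Suc by metis
    show "?r \<in> rank_in S ` J" using p by blast
    show "Suc ?r \<in> rank_in S ` J" using p(2) unfolding Suc[symmetric] by (rule imageI)
  qed (use J in simp)
  moreover have "z (Suc ?r) = w (p + 1)" "z ?r = w p" using z pS Suc by metis+
  moreover have "(\<forall>k\<in>rank_in S ` J. int (shuffle g k) = z k) \<longleftrightarrow> (\<forall>j\<in>J. int (shuffle g (rank_in S j)) = w j)" for g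
    using z J by (auto simp: subset_iff)
  moreover have "(\<forall>k\<in>rank_in S ` J. int (shuffle g k) = z (Transposition.transpose ?r (Suc ?r) k)) \<longleftrightarrow>
      (\<forall>j\<in>J. int (shuffle g (rank_in S j)) = w (?\<tau> j))" for g
    using z \<tau> \<tau>S J by (auto simp: subset_iff)
  ultimately show ?thesis by (simp only: partial_law_def)
qed

section \<open>Exchangeability of the filled level set\<close>

text \<open>If both or neither of \<open>i\<close> and \<open>i + 1\<close> belong to \<open>S\<close>, then \<open>S\<close> is unchanged and the factor comes from the
one-sided permutation. Otherwise the conditional law is merely transported and the factor comes from
the weight \<open>r\<close>; its direction is forced, since the position in \<open>S\<close> carries the larger value.\<close>

lemma filling_transpose:
  assumes q: "0 < q" "q < 1" and S: "tame S" and I: "finite I" "i \<in> I" "i + 1 \<in> I" and y: "y i \<noteq> y (i + 1)"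
    and \<rho>: "\<And>S. tame S \<Longrightarrow> i \<in> S \<Longrightarrow> i + 1 \<notin> S \<Longrightarrow> r (Transposition.transpose i (i + 1) ` S) = r S / q"
  defines "\<tau> \<equiv> Transposition.transpose i (i + 1)"
  shows "r (\<tau> ` S) * measure (filling q m (\<tau> ` S)) (cylinder I (y \<circ> \<tau>)) =
    q powi sgn (y (i + 1) - y i) * (r S * measure (filling q m S) (cylinder I y))"
proof -
  have \<tau>I: "\<tau> j \<in> I \<longleftrightarrow> j \<in> I" for j using I by (auto simp: \<tau>_def Transposition.transpose_def)
  have \<tau>\<tau>: "\<tau> (\<tau> j) = j" for j by (simp add: \<tau>_def)
  have y_\<tau>: "y (\<tau> j) = y j" if "j \<noteq> i" "j \<noteq> i + 1" for j using that by (simp add: \<tau>_def)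
  have crossing: "measure (filling q m (\<tau> ` S)) (cylinder I (y \<circ> \<tau>)) = measure (filling q m S) (cylinder I y)"
    if "i \<in> S \<longleftrightarrow> i + 1 \<notin> S"
  proof -
    have tame: "tame (\<tau> ` S)" using S by (simp add: \<tau>_def)
    have "fill m (\<tau> ` S) b a \<in> cylinder I (y \<circ> \<tau>) \<longleftrightarrow> fill m S b a \<in> cylinder I y" if "bij a" "bij b" for a b
    proof -
      have "(\<forall>j\<in>I. fill m (\<tau> ` S) b a j = y (\<tau> j)) \<longleftrightarrow> (\<forall>j\<in>I. fill m (\<tau> ` S) b a (\<tau> j) = y (\<tau> (\<tau> j)))"
        using \<tau>I \<tau>\<tau> by metis
      also have "\<dots> \<longleftrightarrow> (\<forall>j\<in>I. fill m S b a j = y j)"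
        using fill_transpose[OF \<open>i \<in> S \<longleftrightarrow> i + 1 \<notin> S\<close>] \<tau>\<tau> by (simp add: \<tau>_def)
      finally show ?thesis
        using bij_fill[OF S that(2,1)] bij_fill[OF tame that(2,1)] by (simp add: cylinder_def)
    qed
    then show ?thesis
      by (simp add: measure_filling[OF S] measure_filling[OF tame] cylinder_in_sets[OF I(1)] bij_shuffle)
  qed
  have zero: "measure (filling q m S) (cylinder I y) = 0" if "j \<in> I" "j \<in> S \<longleftrightarrow> y j < m" for j
  proof -
    have "fill m S b a j \<noteq> y j" for a b using that fill_ge_iff[of m S b a j] by auto
    then have "{(g, h). fill m S (shuffle g) (shuffle h) \<in> cylinder I y} = {}"
      using that(1) by (auto simp: cylinder_def)
    then show ?thesis by (simp add: measure_filling[OF S cylinder_in_sets[OF I(1)]])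
  qed
  consider (both) "i \<in> S" "i + 1 \<in> S" | (neither) "i \<notin> S" "i + 1 \<notin> S"
    | (left) "i \<in> S" "i + 1 \<notin> S" | (right) "i \<notin> S" "i + 1 \<in> S" by blast
  then show ?thesis
  proof cases
    case both
    then have \<tau>S: "\<tau> ` S = S" unfolding \<tau>_def by (intro transpose_image_unchanged) simp
    have "partial_law q S (I \<inter> S) (\<lambda>j. y (\<tau> j) - m) =
      q powi sgn ((y (i + 1) - m) - (y i - m)) * partial_law q S (I \<inter> S) (\<lambda>j. y j - m)"
      unfolding \<tau>_def by (rule partial_law_transpose[OF q S]) (use I both y in auto)
    moreover have "partial_law q (reflect S) (uminus ` (I - S)) (\<lambda>j. m - 1 - y (\<tau> (- j))) =
      partial_law q (reflect S) (uminus ` (I - S)) (\<lambda>j. m - 1 - y (- j))"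
    proof -
      have "y (\<tau> j) = y j" if "j \<notin> S" for j using that both y_\<tau>[of j] by auto
      then show ?thesis by (simp add: partial_law_def)
    qed
    ultimately show ?thesis unfolding \<tau>S filling_cylinder[OF S I(1)] by simp
  next
    case neither
    then have \<tau>S: "\<tau> ` S = S" unfolding \<tau>_def by (intro transpose_image_unchanged) simp
    let ?p = "- i - 1"
    have neg: "- Transposition.transpose ?p (?p + 1) j = \<tau> (- j)" for j
      by (auto simp: \<tau>_def Transposition.transpose_def)
    have "partial_law q (reflect S) (uminus ` (I - S)) (\<lambda>j. m - 1 - y (- Transposition.transpose ?p (?p + 1) j)) =
      q powi sgn ((m - 1 - y (- (?p + 1))) - (m - 1 - y (- ?p))) *
      partial_law q (reflect S) (uminus ` (I - S)) (\<lambda>j. m - 1 - y (- j))"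
    proof (rule partial_law_transpose[OF q tame_reflect[OF S]])
      show "?p \<in> uminus ` (I - S)" using I neither by (intro image_eqI[of _ _ "i + 1"]) auto
      show "?p + 1 \<in> uminus ` (I - S)" using I neither by (intro image_eqI[of _ _ i]) auto
      show "uminus ` (I - S) \<subseteq> reflect S" by auto
      show "m - 1 - y (- ?p) \<noteq> m - 1 - y (- (?p + 1))" using y by (simp add: add.commute)
    qed (use I in simp)
    moreover have "- ?p = i + 1" "- (?p + 1) = i" by simp_all
    moreover have "partial_law q S (I \<inter> S) (\<lambda>j. y (\<tau> j) - m) = partial_law q S (I \<inter> S) (\<lambda>j. y j - m)"
    proof -
      have "y (\<tau> j) = y j" if "j \<in> S" for j using that neither y_\<tau>[of j] by auto
      then show ?thesis by (simp add: partial_law_def)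
    qed
    ultimately show ?thesis unfolding \<tau>S filling_cylinder[OF S I(1)] neg by (simp add: add.commute)
  next
    case left
    then have r: "r (\<tau> ` S) = r S / q" using \<rho>[OF S] by (simp add: \<tau>_def)
    show ?thesis
    proof (cases "y (i + 1) < y i")
      case True
      then show ?thesis using crossing left r q by (simp add: sgn_if power_int_minus field_simps)
    next
      case False
      then have "y i < m \<or> m \<le> y (i + 1)" by auto
      then have "measure (filling q m S) (cylinder I y) = 0" using zero[of i] zero[of "i + 1"] left I by auto
      then show ?thesis using crossing left by simp
    qed
  next
    case right
    have "\<tau> ` \<tau> ` S = S" unfolding \<tau>_def by (rule transpose_image_invol)
    moreover have "i \<in> \<tau> ` S" "i + 1 \<notin> \<tau> ` S"
    proof -
      have "\<tau> j \<in> \<tau> ` S \<longleftrightarrow> j \<in> S" for j unfolding \<tau>_def by (rule inj_image_mem_iff) simp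
      from this[of i] this[of "i + 1"] show "i \<in> \<tau> ` S" "i + 1 \<notin> \<tau> ` S" using right by (simp_all add: \<tau>_def)
    qed
    moreover have "tame (\<tau> ` S)" using S by (simp add: \<tau>_def)
    ultimately have r: "r S = r (\<tau> ` S) / q" using \<rho>[of "\<tau> ` S"] by (simp add: \<tau>_def)
    show ?thesis
    proof (cases "y i < y (i + 1)")
      case True
      then show ?thesis using crossing right r q by (simp add: sgn_if)
    next
      case False
      then have "y (i + 1) < m \<or> m \<le> y i" by auto
      then have "measure (filling q m S) (cylinder I y) = 0" using zero[of i] zero[of "i + 1"] right I by auto
      then show ?thesis using crossing right by simp
    qed
  qed
qed

definition mixture :: "real \<Rightarrow> int \<Rightarrow> int set pmf \<Rightarrow> (int \<Rightarrow> int) measure" where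
  "mixture q m \<rho> = measure_pmf \<rho> \<bind> filling q m"

lemma measurable_filling_kernel: "filling q m \<in> measurable (measure_pmf \<rho>) (subprob_algebra perm_space)"
proof (rule measurableI)
  fix S show "filling q m S \<in> space (subprob_algebra perm_space)"
    using prob_space_filling[of q m S] by (simp add: space_subprob_algebra prob_space_imp_subprob_space)
qed simp

lemma emeasure_mixture:
  assumes "X \<in> sets perm_space"
  shows "emeasure (mixture q m \<rho>) X = (\<integral>\<^sup>+S. emeasure (filling q m S) X \<partial>measure_pmf \<rho>)"
  unfolding mixture_def by (rule emeasure_bind[OF _ measurable_filling_kernel assms]) simp

lemma sets_mixture [simp]: "sets (mixture q m \<rho>) = sets perm_space"
  unfolding mixture_def by (rule sets_bind) simp_all

lemma prob_space_mixture: "prob_space (mixture q m \<rho>)"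
  unfolding mixture_def
  by (rule measure_pmf.prob_space_bind[OF _ measurable_filling_kernel])
     (simp add: prob_space_filling)

lemma emeasure_mixture_count_space:
  assumes "X \<in> sets perm_space"
  shows "emeasure (mixture q m \<rho>) X = (\<integral>\<^sup>+S. ennreal (pmf \<rho> S * measure (filling q m S) X) \<partial>count_space UNIV)"
proof -
  have "emeasure (filling q m S) X = ennreal (measure (filling q m S) X)" for S
  proof -
    interpret prob_space "filling q m S" by (rule prob_space_filling)
    show ?thesis by (rule emeasure_eq_measure)
  qed
  then show ?thesis
    by (simp add: emeasure_mixture[OF assms] nn_integral_measure_pmf ennreal_mult)
qed

text \<open>The exchange relation holds term by term when \<open>S\<close> is paired with its image under the swap.\<close>

lemma q_exchangeable_mixture:
  assumes q: "0 < q" "q < 1" and tame: "\<And>S. S \<in> set_pmf \<rho> \<Longrightarrow> tame S"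
    and \<rho>: "\<And>S i. tame S \<Longrightarrow> i \<in> S \<Longrightarrow> i + 1 \<notin> S \<Longrightarrow> pmf \<rho> (Transposition.transpose i (i + 1) ` S) = pmf \<rho> S / q"
  shows "q_exchangeable q (mixture q m \<rho>)"
  unfolding q_exchangeable_iff_cylinder
proof (intro conjI allI impI)
  fix i I and y :: "int \<Rightarrow> int" assume I: "finite I" "i \<in> I" "i + 1 \<in> I" and inj: "inj_on y I"
  let ?\<tau> = "Transposition.transpose i (i + 1)"
  let ?s = "q powi sgn (y (i + 1) - y i)"
  interpret prob_space "mixture q m \<rho>" by (rule prob_space_mixture)
  have y: "y i \<noteq> y (i + 1)" using inj I by (auto dest: inj_onD)
  have eq: "pmf \<rho> (?\<tau> ` S) * measure (filling q m (?\<tau> ` S)) (cylinder I (y \<circ> ?\<tau>)) =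
    ?s * (pmf \<rho> S * measure (filling q m S) (cylinder I y))" for S
  proof (cases "tame S")
    case True
    show ?thesis by (rule filling_transpose[where r = "pmf \<rho>", OF q True I y \<rho>])
  next
    case False
    then have "pmf \<rho> S = 0" "pmf \<rho> (?\<tau> ` S) = 0" using tame tame_transpose by (metis set_pmf_iff)+
    then show ?thesis by simp
  qed
  have "bij (image ?\<tau>)" by (rule involuntory_imp_bij) (rule transpose_image_invol)
  then have "emeasure (mixture q m \<rho>) (cylinder I (y \<circ> ?\<tau>)) =
    (\<integral>\<^sup>+S. ennreal (pmf \<rho> (?\<tau> ` S) * measure (filling q m (?\<tau> ` S)) (cylinder I (y \<circ> ?\<tau>))) \<partial>count_space UNIV)"
    unfolding emeasure_mixture_count_space[OF cylinder_in_sets[OF I(1)]]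
    by (subst nn_integral_bij_count_space[of "image ?\<tau>" UNIV UNIV, symmetric]) auto
  also have "\<dots> = ennreal ?s * emeasure (mixture q m \<rho>) (cylinder I y)"
    using q unfolding eq emeasure_mixture_count_space[OF cylinder_in_sets[OF I(1)]]
    by (subst nn_integral_cmult[symmetric]) (simp_all add: ennreal_mult')
  finally have "ennreal (prob (cylinder I (y \<circ> ?\<tau>))) = ennreal (?s * prob (cylinder I y))"
    using q by (simp add: emeasure_eq_measure ennreal_mult)
  then show "prob (cylinder I (y \<circ> ?\<tau>)) = ?s * prob (cylinder I y)"
    using q by simp
qed (simp_all add: prob_space_mixture)

lemma countable_tame: "countable {S. tame S}"
proof -
  have "{S. tame S} = (\<Union>n. window_sets n)" by (auto simp: tame_iff_window)
  then show ?thesis by (simp add: countable_finite)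
qed

text \<open>There are only countably many tame sets.\<close>

lemma level_set_event:
  "{\<omega> \<in> space perm_space. tame {j. m \<le> \<omega> j} \<and> Q {j. m \<le> \<omega> j}} \<in> sets perm_space"
proof -
  have "{\<omega> \<in> space perm_space. {j. m \<le> \<omega> j} = S} \<in> sets perm_space" for S
  proof -
    have "{\<omega> \<in> space perm_space. {j. m \<le> \<omega> j} = S} = {\<omega> \<in> space perm_space. \<forall>j. m \<le> \<omega> j \<longleftrightarrow> j \<in> S}"
      by auto
    also have "\<dots> \<in> sets perm_space"
      using measurable_coordinate_perm_space[measurable] by measurable
    finally show ?thesis .
  qed
  then have "(\<Union>S\<in>{S. tame S \<and> Q S}. {\<omega> \<in> space perm_space. {j. m \<le> \<omega> j} = S}) \<in> sets perm_space"
    by (intro sets.countable_UN') (auto intro: countable_subset[OF _ countable_tame])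
  moreover have "(\<Union>S\<in>{S. tame S \<and> Q S}. {\<omega> \<in> space perm_space. {j. m \<le> \<omega> j} = S}) =
    {\<omega> \<in> space perm_space. tame {j. m \<le> \<omega> j} \<and> Q {j. m \<le> \<omega> j}}" by auto
  ultimately show ?thesis by simp
qed

lemma AE_level_set_mixture:
  assumes \<rho>: "\<And>S. S \<in> set_pmf \<rho> \<Longrightarrow> tame S \<and> Q S"
  shows "AE \<omega> in mixture q m \<rho>. tame {j. m \<le> \<omega> j} \<and> Q {j. m \<le> \<omega> j}"
proof -
  let ?X = "{\<omega> \<in> space perm_space. tame {j. m \<le> \<omega> j} \<and> Q {j. m \<le> \<omega> j}}"
  interpret prob_space "mixture q m \<rho>" by (rule prob_space_mixture)
  have X: "?X \<in> sets perm_space" by (rule level_set_event)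
  have "emeasure (filling q m S) ?X = 1" if S: "S \<in> set_pmf \<rho>" for S
  proof -
    interpret F: prob_space "filling q m S" by (rule prob_space_filling)
    have tame: "tame S" "Q S" using \<rho>[OF S] by auto
    have "{j. m \<le> fill m S b a j} = S" for a b by (simp add: fill_ge_iff)
    then have "{(g, h). fill m S (shuffle g) (shuffle h) \<in> ?X} = UNIV"
      using tame bij_fill[OF tame(1) bij_shuffle bij_shuffle] by (auto simp: space_perm_space)
    moreover have "space perm_space \<in> sets perm_space" by simp
    moreover have "{(g, h). fill m S (shuffle g) (shuffle h) \<in> space perm_space} = UNIV"
      using bij_fill[OF tame(1) bij_shuffle bij_shuffle] by (auto simp: space_perm_space)
    ultimately have "measure (filling q m S) ?X = measure (filling q m S) (space perm_space)"
      by (simp only: measure_filling[OF tame(1) X] measure_filling[OF tame(1)])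
    also have "\<dots> = 1" using F.prob_space sets_eq_imp_space_eq[OF sets_filling[of q m S]] by simp
    finally show ?thesis by (simp add: F.emeasure_eq_measure)
  qed
  then have "AE S in measure_pmf \<rho>. emeasure (filling q m S) ?X = 1" by (simp add: AE_measure_pmf_iff)
  then have "emeasure (mixture q m \<rho>) ?X = (\<integral>\<^sup>+S. 1 \<partial>measure_pmf \<rho>)"
    unfolding emeasure_mixture[OF X] by (rule nn_integral_cong_AE)
  then have "prob ?X = 1" by (simp add: emeasure_eq_measure)
  then have "AE \<omega> in mixture q m \<rho>. \<omega> \<in> ?X" using X by (subst prob_eq_1[symmetric]) auto
  then show ?thesis by eventually_elim auto
qed

text \<open>Each value is attained exactly once, so raising the threshold by one removes exactly one point.\<close>

lemma level_set_shift:
  assumes "bij \<omega>" "tame {j. m \<le> \<omega> j}"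
  shows "tame {j. m + d \<le> \<omega> j} \<and> charge {j. m + d \<le> \<omega> j} = charge {j. m \<le> \<omega> j} - d"
proof -
  have step: "\<exists>p. p \<notin> {j. k + 1 \<le> \<omega> j} \<and> {j. k \<le> \<omega> j} = insert p {j. k + 1 \<le> \<omega> j}" for k
  proof -
    obtain p where p: "\<omega> p = k" using assms(1) by (metis bij_pointE)
    have "k \<le> \<omega> j \<longleftrightarrow> j = p \<or> k + 1 \<le> \<omega> j" for j
    proof (cases "\<omega> j = k")
      case True
      then have "j = p" using assms(1) p by (metis bij_is_inj injD)
      then show ?thesis using True by simp
    next
      case False
      then have "j \<noteq> p" using p by metis
      then show ?thesis using False by simp linarith
    qed
    then have "{j. k \<le> \<omega> j} = insert p {j. k + 1 \<le> \<omega> j}" by blast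
    moreover have "p \<notin> {j. k + 1 \<le> \<omega> j}" using p by simp
    ultimately show ?thesis by blast
  qed
  have Suc: "(tame {j. k \<le> \<omega> j} \<longleftrightarrow> tame {j. k + 1 \<le> \<omega> j}) \<and>
      (tame {j. k \<le> \<omega> j} \<longrightarrow> charge {j. k \<le> \<omega> j} = charge {j. k + 1 \<le> \<omega> j} + 1)" for k
    using step[of k] charge_insert tame_insert by metis
  show ?thesis
  proof (induction d rule: int_induct[where k = 0])
    case base then show ?case using assms by simp
  next
    case (step1 d)
    then show ?case using Suc[of "m + d"] by (simp add: algebra_simps)
  next
    case (step2 d)
    then show ?case using Suc[of "m + d - 1"] by (simp add: algebra_simps)
  qed
qed

lemma balanced_iff_charge:
  "balanced \<sigma> \<longleftrightarrow> tame {j. 1 \<le> \<sigma> j} \<and> charge {j. 1 \<le> \<sigma> j} = 0"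
proof -
  have "{i \<in> {j. 1 \<le> \<sigma> j}. i \<le> 0} = {j. j \<le> 0 \<and> \<sigma> j > 0}" by auto
  moreover have "{i. i \<notin> {j. 1 \<le> \<sigma> j} \<and> 0 < i} = {j. j > 0 \<and> \<sigma> j \<le> 0}" by auto
  ultimately show ?thesis unfolding balanced_def tame_def charge_def by auto
qed

section \<open>Identification of the Mallows measures\<close>

context
  fixes q \<beta> :: real
  assumes q: "0 < q" "q < 1" and \<beta>: "0 < \<beta>"
begin

lemma pmf_level_transpose:
  assumes "i \<in> S" "i + 1 \<notin> S"
  shows "pmf (level_pmf q \<beta>) (Transposition.transpose i (i + 1) ` S) = pmf (level_pmf q \<beta>) S / q"
proof -
  have S: "S = insert i (S - {i})" using assms by auto
  have "weight q \<beta> S = odds q \<beta> i * weight q \<beta> (S - {i})"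
    by (subst S, rule weight_insert[OF q \<beta>]) simp
  moreover have "weight q \<beta> (insert (i + 1) (S - {i})) = odds q \<beta> (i + 1) * weight q \<beta> (S - {i})"
    by (rule weight_insert[OF q \<beta>]) (use assms in simp)
  moreover have "odds q \<beta> (i + 1) = odds q \<beta> i / q"
    using q by (simp add: odds_def powr_diff)
  ultimately show ?thesis
    by (simp add: pmf_level[OF q \<beta>] transpose_image_moved[OF assms])
qed

lemma level_charge_nonempty: "set_pmf (level_pmf q \<beta>) \<inter> {S. charge S = d} \<noteq> {}"
proof -
  have "measure (level_pmf q \<beta>) {S. charge S = d} \<noteq> 0"
    using q \<beta> qpoch_inf_pos[OF q] theta_norm_pos[OF q \<beta>]
    by (simp add: prob_level_charge[OF q \<beta>] del: power_Suc)
  then show ?thesis by (simp add: measure_pmf_zero_iff)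
qed

lemma pmf_level_charge:
  "pmf (cond_pmf (level_pmf q \<beta>) {S. charge S = d}) S =
    (if charge S = d then pmf (level_pmf q \<beta>) S / measure (level_pmf q \<beta>) {S. charge S = d} else 0)"
  using pmf_cond[OF level_charge_nonempty] by simp

text \<open>The swap of two positions preserves the charge, so conditioning on it keeps the exchange relation of
the weights.\<close>

lemma q_exchangeable_mixture_charge:
  "q_exchangeable q (mixture q m (cond_pmf (level_pmf q \<beta>) {S. charge S = d}))"
proof (rule q_exchangeable_mixture[OF q])
  show "tame S" if "S \<in> set_pmf (cond_pmf (level_pmf q \<beta>) {S. charge S = d})" for S
    using that set_pmf_level[OF q \<beta>] by (simp add: set_cond_pmf[OF level_charge_nonempty])
  show "pmf (cond_pmf (level_pmf q \<beta>) {S. charge S = d}) (Transposition.transpose i (i + 1) ` S) =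
    pmf (cond_pmf (level_pmf q \<beta>) {S. charge S = d}) S / q" if "tame S" "i \<in> S" "i + 1 \<notin> S" for S i
    using that by (simp add: pmf_level_charge charge_transpose pmf_level_transpose)
qed

lemma AE_balanced_mixture_charge:
  "AE \<omega> in mixture q m (cond_pmf (level_pmf q \<beta>) {S. charge S = c - m + 1}). balanced (\<lambda>i. \<omega> i - c)"
proof -
  let ?M = "mixture q m (cond_pmf (level_pmf q \<beta>) {S. charge S = c - m + 1})"
  have "AE \<omega> in ?M. tame {j. m \<le> \<omega> j} \<and> charge {j. m \<le> \<omega> j} = c - m + 1"
    by (rule AE_level_set_mixture)
       (use set_pmf_level[OF q \<beta>] in \<open>simp add: set_cond_pmf[OF level_charge_nonempty]\<close>)
  then show ?thesis using AE_space
  proof eventually_elim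
    case (elim \<omega>)
    then have "bij \<omega>" using sets_eq_imp_space_eq[OF sets_mixture] space_perm_space by blast
    from level_set_shift[OF this, of m "c + 1 - m"] elim
    have "tame {j. c + 1 \<le> \<omega> j} \<and> charge {j. c + 1 \<le> \<omega> j} = 0" by simp
    moreover have "{j. c + 1 \<le> \<omega> j} = {j. 1 \<le> \<omega> j - c}" by auto
    ultimately show ?case by (simp add: balanced_iff_charge)
  qed
qed

end

lemma measurable_shift: "(\<lambda>\<omega> i. \<omega> i + c) \<in> measurable perm_space perm_space"
proof (rule measurable_into_perm_space)
  fix \<omega> :: "int \<Rightarrow> int" assume "\<omega> \<in> space perm_space"
  then have "bij ((\<lambda>v. v + c) \<circ> \<omega>)"
    by (intro bij_comp) (auto simp: space_perm_space bij_plus_right)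
  then show "bij (\<lambda>i. \<omega> i + c)" by (simp add: o_def)
next
  fix i show "(\<lambda>\<omega>. \<omega> i + c) \<in> measurable perm_space (count_space UNIV)"
    by (rule measurable_compose[OF measurable_coordinate_perm_space, where g = "\<lambda>v. v + c"]) simp
qed

lemma q_exchangeable_shift:
  assumes M: "q_exchangeable q M"
  shows "q_exchangeable q (distr M perm_space (\<lambda>\<omega> i. \<omega> i + c))"
proof -
  have prob: "prob_space M" and sets: "sets M = sets perm_space"
    using M by (auto simp: q_exchangeable_def)
  interpret prob_space M by fact
  have meas: "(\<lambda>\<omega> i. \<omega> i + c) \<in> measurable M perm_space"
    using measurable_shift[of c] measurable_cong_sets[OF sets refl] by blast
  have cyl: "measure (distr M perm_space (\<lambda>\<omega> i. \<omega> i + c)) (cylinder I y) = measure M (cylinder I (\<lambda>j. y j - c))"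
    if "finite I" for I y
  proof -
    have "bij (\<lambda>i. \<omega> i + c) \<longleftrightarrow> bij \<omega>" for \<omega> :: "int \<Rightarrow> int"
    proof -
      have "bij (\<lambda>v. v + c)" by (rule bij_plus_right)
      then have "bij ((\<lambda>v. v + c) \<circ> \<omega>) \<longleftrightarrow> bij \<omega>"
        by (metis bij_betw_comp_iff2 bij_is_surj subset_UNIV)
      then show ?thesis by (simp add: o_def)
    qed
    then have "(\<lambda>\<omega> i. \<omega> i + c) -` cylinder I y \<inter> space M = cylinder I (\<lambda>j. y j - c)"
      using sets_eq_imp_space_eq[OF sets] by (auto simp: cylinder_def space_perm_space)
    then show ?thesis
      using that by (simp add: measure_distr[OF meas] cylinder_in_sets)
  qed
  show ?thesis
    unfolding q_exchangeable_iff_cylinder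
  proof (intro conjI allI impI)
    show "prob_space (distr M perm_space (\<lambda>\<omega> i. \<omega> i + c))" by (rule prob_space_distr[OF meas])
    fix i I and y :: "int \<Rightarrow> int" assume I: "finite I" "i \<in> I" "i + 1 \<in> I" "inj_on y I"
    then have "inj_on (\<lambda>j. y j - c) I" by (auto simp: inj_on_def)
    then have "measure M (cylinder I ((\<lambda>j. y j - c) \<circ> Transposition.transpose i (i + 1))) =
      q powi sgn ((y (i + 1) - c) - (y i - c)) * measure M (cylinder I (\<lambda>j. y j - c))"
      using M I unfolding q_exchangeable_iff_cylinder by blast
    then show "measure (distr M perm_space (\<lambda>\<omega> i. \<omega> i + c)) (cylinder I (y \<circ> Transposition.transpose i (i + 1))) =
      q powi sgn (y (i + 1) - y i) * measure (distr M perm_space (\<lambda>\<omega> i. \<omega> i + c)) (cylinder I y)"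
      by (simp add: cyl I(1) o_def)
  qed simp
qed

text \<open>The filled level set of charge \<open>c - m + 1\<close>, shifted by \<open>- c\<close>, is \<open>q\<close>-exchangeable and balanced and hence has
the law \<open>mallows0\<close>, whatever the threshold \<open>m\<close> and the parameter \<open>\<beta>\<close> used to build it.\<close>

lemma mallows_eq_mixture:
  assumes q: "0 < q" "q < 1" and \<beta>: "0 < \<beta>"
  shows "mallows q c = mixture q m (cond_pmf (level_pmf q \<beta>) {S. charge S = c - m + 1})"
proof -
  define M where "M = mixture q m (cond_pmf (level_pmf q \<beta>) {S. charge S = c - m + 1})"
  define N where "N = distr M perm_space (\<lambda>\<omega> i. \<omega> i + (- c))"
  have M: "q_exchangeable q M" unfolding M_def by (rule q_exchangeable_mixture_charge[OF q \<beta>])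
  have sets: "sets M = sets perm_space" by (simp add: M_def)
  have meas: "(\<lambda>\<omega> i. \<omega> i + d) \<in> measurable M perm_space" for d
    using measurable_shift[of d] measurable_cong_sets[OF sets refl] by blast
  have N: "q_exchangeable q N" unfolding N_def by (rule q_exchangeable_shift[OF M])
  have bal: "AE \<sigma> in N. balanced \<sigma>"
    unfolding N_def
  proof (subst AE_distr_iff[OF meas])
    show "{\<sigma> \<in> space perm_space. balanced \<sigma>} \<in> sets perm_space"
      unfolding balanced_iff_charge by (rule level_set_event)
    show "AE \<omega> in M. balanced (\<lambda>i. \<omega> i + - c)"
      using AE_balanced_mixture_charge[OF q \<beta>, of c m] unfolding M_def by simp
  qed
  have "mallows0 q = N"
    unfolding mallows0_def
    using N bal q_exchangeable_balanced_unique[OF q(1)] by (intro the_equality) auto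
  then have "mallows q c = distr M perm_space ((\<lambda>\<sigma> i. \<sigma> i + c) \<circ> (\<lambda>\<omega> i. \<omega> i + (- c)))"
    unfolding mallows_def N_def by (simp only: distr_distr[OF measurable_shift meas])
  also have "\<dots> = distr M M (\<lambda>\<omega>. \<omega>)"
    by (rule distr_cong) (simp_all add: sets o_def)
  also have "\<dots> = M" by (rule distr_id)
  finally show ?thesis unfolding M_def .
qed

text \<open>The weights of the mixture are the probabilities of the charges, so summing the conditioned laws
removes the conditioning.\<close>

lemma mallows_product_eq_mixture:
  assumes q: "0 < q" "q < 1" and \<alpha>: "0 < \<alpha>"
  shows "mallows_product q \<alpha> = mixture q m (level_pmf q (\<alpha> * q powr (real_of_int m - 1/2)))"
proof -
  define \<beta> where "\<beta> = \<alpha> * q powr (real_of_int m - 1/2)"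
  have \<beta>: "0 < \<beta>" using q \<alpha> by (simp add: \<beta>_def)
  let ?\<mu> = "level_pmf q \<beta>"
  have "(\<integral>\<^sup>+c. ennreal (mallows_weight q \<alpha> c) * emeasure (mallows q c) A \<partial>count_space UNIV) =
      emeasure (mixture q m ?\<mu>) A" if A: "A \<in> sets perm_space" for A
  proof -
    define F where "F S = ennreal (measure (filling q m S) A)" for S
    have "ennreal (mallows_weight q \<alpha> c) * emeasure (mallows q c) A =
      (\<integral>\<^sup>+S. ennreal (pmf ?\<mu> S) * F S * indicator {charge S + m - 1} c \<partial>count_space UNIV)" for c
    proof -
      let ?w = "measure ?\<mu> {S. charge S = c - m + 1}"
      have "?w \<noteq> 0" using level_charge_nonempty[OF q \<beta>] by (simp add: measure_pmf_zero_iff)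
      then have w: "0 < ?w" by (simp add: zero_less_measure_iff)
      have "ennreal (mallows_weight q \<alpha> c) * emeasure (mallows q c) A = 
        ennreal ?w * (\<integral>\<^sup>+S. ennreal (pmf (cond_pmf ?\<mu> {S. charge S = c - m + 1}) S * measure (filling q m S) A) \<partial>count_space UNIV)"
        by (simp only: mallows_weight_eq_prob_charge[OF q \<alpha>, of c m] \<beta>_def[symmetric]
          mallows_eq_mixture[OF q \<beta>, of c m] emeasure_mixture_count_space[OF A])
      also have "\<dots> = (\<integral>\<^sup>+S. ennreal ?w * ennreal (pmf (cond_pmf ?\<mu> {S. charge S = c - m + 1}) S * measure (filling q m S) A) \<partial>count_space UNIV)"
        by (rule nn_integral_cmult[symmetric]) simp
      also have "\<dots> = (\<integral>\<^sup>+S. ennreal (pmf ?\<mu> S) * F S * indicator {charge S + m - 1} c \<partial>count_space UNIV)"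
      proof (rule nn_integral_cong)
        fix S
        show "ennreal ?w * ennreal (pmf (cond_pmf ?\<mu> {S. charge S = c - m + 1}) S * measure (filling q m S) A) =
          ennreal (pmf ?\<mu> S) * F S * indicator {charge S + m - 1} c"
        proof (cases "charge S = c - m + 1")
          case True
          then have "c = charge S + m - 1" by simp
          then show ?thesis using w True
            by (simp add: pmf_level_charge[OF q \<beta>] F_def ennreal_mult[symmetric])
        next
          case False
          then have "c \<noteq> charge S + m - 1" by simp
          then show ?thesis using False by (simp add: pmf_level_charge[OF q \<beta>])
        qed
      qed
      finally show ?thesis .
    qed
    then have "(\<integral>\<^sup>+c. ennreal (mallows_weight q \<alpha> c) * emeasure (mallows q c) A \<partial>count_space UNIV) =
      (\<integral>\<^sup>+c. \<integral>\<^sup>+S. ennreal (pmf ?\<mu> S) * F S * indicator {charge S + m - 1} c \<partial>count_space UNIV \<partial>count_space UNIV)"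
      by simp
    also have "\<dots> = (\<integral>\<^sup>+S. \<integral>\<^sup>+c. ennreal (pmf ?\<mu> S) * F S * indicator {charge S + m - 1} c \<partial>count_space UNIV \<partial>count_space UNIV)"
      using nn_integral_fst_count_space[of "\<lambda>(c, S). ennreal (pmf ?\<mu> S) * F S * indicator {charge S + m - 1} c"]
        nn_integral_snd_count_space[of "\<lambda>(c, S). ennreal (pmf ?\<mu> S) * F S * indicator {charge S + m - 1} c"]
      by simp
    also have "\<dots> = (\<integral>\<^sup>+S. ennreal (pmf ?\<mu> S) * F S \<partial>count_space UNIV)"
      by (simp add: nn_integral_cmult)
    also have "\<dots> = emeasure (mixture q m ?\<mu>) A"
      by (simp add: emeasure_mixture_count_space[OF A] F_def ennreal_mult)
    finally show ?thesis .
  qed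
  then have "mallows_product q \<alpha> = measure_of (space perm_space) (sets perm_space) (emeasure (mixture q m ?\<mu>))"
    unfolding mallows_product_def
    by (intro measure_of_eq sets.space_closed) (simp add: sets.sigma_sets_eq)
  also have "\<dots> = measure_of (space (mixture q m ?\<mu>)) (sets (mixture q m ?\<mu>)) (emeasure (mixture q m ?\<mu>))"
    using sets_eq_imp_space_eq[OF sets_mixture[of q m ?\<mu>]] by simp
  also have "\<dots> = mixture q m ?\<mu>" by (rule measure_of_of_measure)
  finally show ?thesis by (simp add: \<beta>_def)
qed

section \<open>Independence at a threshold\<close>

text \<open>Putting \<open>i\<close> into \<open>S\<close> or taking it out affects neither membership nor rank of positions to the left of
\<open>i\<close>, and \<open>y\<close> prescribes only values of positions that must lie in \<open>S\<close>. So toggling \<open>i\<close> leaves the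
conditional probability of the cylinder alone and multiplies the weight by the odds.\<close>

lemma mixture_level_independent:
  assumes q: "0 < q" "q < 1" and \<beta>: "0 < \<beta>"
    and I: "finite I" "\<And>j. j \<in> I \<Longrightarrow> j < i \<and> m \<le> y j"
  defines "P \<equiv> mixture q m (level_pmf q \<beta>)"
  shows "measure P {\<omega> \<in> cylinder I y. m \<le> \<omega> i} =
    odds q \<beta> i / (1 + odds q \<beta> i) * measure P (cylinder I y)"
proof -
  interpret prob_space P unfolding P_def by (rule prob_space_mixture)
  let ?\<mu> = "level_pmf q \<beta>" and ?o = "odds q \<beta> i"
  have o: "0 < ?o" by (rule odds_pos[OF q \<beta>])
  define F where "F S = pmf ?\<mu> S * measure (filling q m S) (cylinder I y)" for S
  have F: "0 \<le> F S" for S by (simp add: F_def)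
  have cyl: "cylinder I y \<in> sets perm_space" by (rule cylinder_in_sets[OF I(1)])
  have "{\<omega> \<in> space perm_space. m \<le> \<omega> i} \<in> sets perm_space"
    using measurable_coordinate_perm_space[measurable] by measurable
  then have "cylinder I y \<inter> {\<omega> \<in> space perm_space. m \<le> \<omega> i} \<in> sets perm_space" using cyl by blast
  moreover have "cylinder I y \<inter> {\<omega> \<in> space perm_space. m \<le> \<omega> i} = {\<omega> \<in> cylinder I y. m \<le> \<omega> i}"
    by (auto simp: cylinder_def space_perm_space)
  ultimately have E: "{\<omega> \<in> cylinder I y. m \<le> \<omega> i} \<in> sets perm_space" by simp
  have not_tame: "pmf ?\<mu> S = 0" if "\<not> tame S" for S
    using that set_pmf_level[OF q \<beta>] by (auto simp: set_pmf_iff)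
  have E_filling: "pmf ?\<mu> S * measure (filling q m S) {\<omega> \<in> cylinder I y. m \<le> \<omega> i} = F S * indicator {S. i \<in> S} S" for S
  proof (cases "tame S")
    case True
    have "{(g, h). fill m S (shuffle g) (shuffle h) \<in> {\<omega> \<in> cylinder I y. m \<le> \<omega> i}} =
      (if i \<in> S then {(g, h). fill m S (shuffle g) (shuffle h) \<in> cylinder I y} else {})"
      by (auto simp: fill_ge_iff)
    then show ?thesis by (simp add: F_def measure_filling[OF True E] measure_filling[OF True cyl])
  qed (simp add: F_def not_tame)
  have toggle: "F (insert i S) = ?o * F S" if S: "i \<notin> S" for S
  proof (cases "tame S")
    case True
    have "fill m (insert i S) b a j = y j \<longleftrightarrow> fill m S b a j = y j" if j: "j \<in> I" for j a b
    proof (cases "j \<in> S")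
      case True
      have "{l \<in> insert i S. l < j} = {l \<in> S. l < j}" using I(2)[OF j] by auto
      then show ?thesis using True by (simp add: fill_def rank_in_def)
    next
      case False
      then have "j \<notin> insert i S" using I(2)[OF j] by auto
      then show ?thesis using False I(2)[OF j] fill_ge_iff[of m S b a j] fill_ge_iff[of m "insert i S" b a j] by auto
    qed
    moreover have tame: "tame (insert i S)" using True by simp
    ultimately have "{(g, h). fill m (insert i S) (shuffle g) (shuffle h) \<in> cylinder I y} =
        {(g, h). fill m S (shuffle g) (shuffle h) \<in> cylinder I y}"
      using True by (simp add: cylinder_def bij_fill bij_shuffle)
    then have "measure (filling q m (insert i S)) (cylinder I y) = measure (filling q m S) (cylinder I y)"
      by (simp only: measure_filling[OF True cyl] measure_filling[OF tame cyl])
    then show ?thesis using weight_insert[OF q \<beta> S] by (simp add: F_def pmf_level[OF q \<beta>])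
  next
    case False
    then have "\<not> tame (insert i S)" by simp
    then show ?thesis using False by (simp add: F_def not_tame)
  qed
  let ?A = "\<integral>\<^sup>+S. ennreal (F S) \<partial>count_space {S. i \<in> S}" and ?B = "\<integral>\<^sup>+S. ennreal (F S) \<partial>count_space {S. i \<notin> S}"
  have A: "emeasure P {\<omega> \<in> cylinder I y. m \<le> \<omega> i} = ?A"
    unfolding P_def emeasure_mixture_count_space[OF E] E_filling
    by (subst (2) nn_integral_count_space_indicator) (auto intro!: nn_integral_cong simp: indicator_def)
  have "emeasure P (cylinder I y) = (\<integral>\<^sup>+S. ennreal (F S) * indicator {S. i \<in> S} S + ennreal (F S) * indicator {S. i \<notin> S} S \<partial>count_space UNIV)"
    unfolding P_def emeasure_mixture_count_space[OF cyl] F_def[symmetric]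
    by (intro nn_integral_cong) (simp add: indicator_def)
  also have "\<dots> = ?A + ?B"
    by (subst nn_integral_add) (simp_all add: nn_integral_count_space_indicator)
  finally have sum: "emeasure P (cylinder I y) = ?A + ?B" .
  have "bij_betw (insert i) {S. i \<notin> S} {S. i \<in> S}"
    by (rule bij_betw_byWitness[where f' = "\<lambda>S. S - {i}"]) auto
  then have "?A = (\<integral>\<^sup>+S. ennreal (F (insert i S)) \<partial>count_space {S. i \<notin> S})"
    by (rule nn_integral_bij_count_space[symmetric])
  also have "\<dots> = (\<integral>\<^sup>+S. ennreal ?o * ennreal (F S) \<partial>count_space {S. i \<notin> S})"
    using o F by (intro nn_integral_cong) (simp add: toggle ennreal_mult)
  also have "\<dots> = ennreal ?o * ?B" by (rule nn_integral_cmult) simp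
  finally have AB: "?A = ennreal ?o * ?B" .
  have fin: "?B < \<top>"
    using sum emeasure_finite[of "cylinder I y"] by (simp add: less_top[symmetric])
  obtain b where b: "?B = ennreal b" "0 \<le> b" using fin by (cases ?B) auto
  have "ennreal (prob {\<omega> \<in> cylinder I y. m \<le> \<omega> i}) = ennreal (?o * b)"
    using A AB b o by (simp add: emeasure_eq_measure ennreal_mult)
  then have 1: "prob {\<omega> \<in> cylinder I y. m \<le> \<omega> i} = ?o * b" using o b by simp
  have "ennreal (prob (cylinder I y)) = ennreal (?o * b + b)"
    using sum AB b o by (simp add: emeasure_eq_measure ennreal_mult ennreal_plus)
  then have 2: "prob (cylinder I y) = ?o * b + b"
    using o b by (simp add: ennreal_plus[symmetric] del: ennreal_plus)
  show ?thesis unfolding 1 2 using o by (simp add: field_simps)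
qed

text \<open>Both thresholds \<open>x\<close> and \<open>x + 1\<close> are at most all the prescribed values, so the independence applies to each
of them, with the level set adapted to that threshold.\<close>

lemma mallows_product_next:
  assumes q: "0 < q" "q < 1" and \<alpha>: "0 < \<alpha>"
    and I: "finite I" "\<And>j. j \<in> I \<Longrightarrow> j < i \<and> x < y j"
  defines "P \<equiv> mallows_product q \<alpha>"
  shows "measure P {\<omega> \<in> cylinder I y. \<omega> i = x} = measure P (cylinder I y) *
    ((1 - q) * \<alpha> * q powr (real_of_int (x - i) - 1/2) /
       ((1 + \<alpha> * q powr (real_of_int (x - i) - 1/2)) * (1 + \<alpha> * q powr (real_of_int (x - i) + 1/2))))"
proof -
  define t where "t = \<alpha> * q powr (real_of_int (x - i) - 1/2)"
  define t' where "t' = \<alpha> * q powr (real_of_int (x - i) + 1/2)"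
  have t: "0 < t" using q \<alpha> by (simp add: t_def)
  have "real_of_int (x - i) + 1/2 = (real_of_int (x - i) - 1/2) + 1" by simp
  then have t': "t' = t * q" using q by (simp only: t_def t'_def powr_add powr_one mult.assoc)
  have P: "prob_space P" "sets P = sets perm_space"
    unfolding P_def mallows_product_eq_mixture[OF q \<alpha>, of 0] by (simp_all add: prob_space_mixture)
  interpret prob_space P by fact
  have tail: "measure P {\<omega> \<in> cylinder I y. m \<le> \<omega> i} =
      (\<alpha> * q powr (real_of_int (m - i) - 1/2)) / (1 + \<alpha> * q powr (real_of_int (m - i) - 1/2)) * measure P (cylinder I y)"
    if m: "m \<le> x + 1" for m
  proof -
    let ?\<beta> = "\<alpha> * q powr (real_of_int m - 1/2)"
    have \<beta>: "0 < ?\<beta>" using q \<alpha> by simp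
    have "odds q ?\<beta> i = \<alpha> * q powr (real_of_int (m - i) - 1/2)"
      by (simp add: odds_def powr_add[symmetric] algebra_simps)
    moreover have "j < i \<and> m \<le> y j" if "j \<in> I" for j using I(2)[OF that] m by auto
    ultimately show ?thesis
      using mixture_level_independent[OF q \<beta> I(1), of i m y]
      unfolding P_def mallows_product_eq_mixture[OF q \<alpha>, of m] by simp
  qed
  have meas: "{\<omega> \<in> cylinder I y. m \<le> \<omega> i} \<in> events" for m
  proof -
    have "{\<omega> \<in> space perm_space. m \<le> \<omega> i} \<in> sets perm_space"
      using measurable_coordinate_perm_space[measurable] by measurable
    then have "cylinder I y \<inter> {\<omega> \<in> space perm_space. m \<le> \<omega> i} \<in> events"
      using cylinder_in_sets[OF I(1)] P(2) by auto
    moreover have "cylinder I y \<inter> {\<omega> \<in> space perm_space. m \<le> \<omega> i} = {\<omega> \<in> cylinder I y. m \<le> \<omega> i}"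
      by (auto simp: cylinder_def space_perm_space)
    ultimately show ?thesis by simp
  qed
  have split: "{\<omega> \<in> cylinder I y. \<omega> i = x} = {\<omega> \<in> cylinder I y. x \<le> \<omega> i} - {\<omega> \<in> cylinder I y. x + 1 \<le> \<omega> i}"
    by auto
  have "prob {\<omega> \<in> cylinder I y. \<omega> i = x} =
     prob {\<omega> \<in> cylinder I y. x \<le> \<omega> i} - prob {\<omega> \<in> cylinder I y. x + 1 \<le> \<omega> i}"
    unfolding split by (rule finite_measure_Diff[OF meas meas]) auto
  also have "\<dots> = t / (1 + t) * prob (cylinder I y) - t' / (1 + t') * prob (cylinder I y)"
  proof -
    have "real_of_int (x + 1 - i) - 1/2 = real_of_int (x - i) + 1/2" by simp
    then show ?thesis using tail[of x] tail[of "x + 1"] by (simp only: t_def t'_def order_refl)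
  qed
  also have "\<dots> = prob (cylinder I y) * ((1 - q) * t / ((1 + t) * (1 + t')))"
  proof -
    have "0 < 1 + t" "0 < 1 + t'" using t q by (simp_all add: t' add_pos_pos)
    then have "t / (1 + t) - t' / (1 + t') = (1 - q) * t / ((1 + t) * (1 + t'))"
      by (simp add: t' field_simps)
    then show ?thesis by (metis left_diff_distrib mult.commute)
  qed
  finally show ?thesis by (simp only: t_def t'_def mult.assoc)
qed

theorem theorem1p2:
  fixes q \<alpha> :: real and k :: nat and x i :: "nat \<Rightarrow> int"
  assumes "0 < q" "q < 1" "0 < \<alpha>" "1 \<le> k"
    and "\<And>a b. 1 \<le> a \<Longrightarrow> a < b \<Longrightarrow> b \<le> k \<Longrightarrow> x a > x b"
    and "\<And>a b. 1 \<le> a \<Longrightarrow> a < b \<Longrightarrow> b \<le> k \<Longrightarrow> i a < i b"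
  shows "\<P>(\<omega> in mallows_product q \<alpha>. \<forall>j\<in>{1..k}. \<omega> (i j) = x j) =
    (\<Prod>j=1..k.
       (1 - q) * \<alpha> * q powr (real_of_int (x j - i j) - 1/2) /
       ((1 + \<alpha> * q powr (real_of_int (x j - i j) - 1/2)) *
        (1 + \<alpha> * q powr (real_of_int (x j - i j) + 1/2))))"
proof -
  let ?P = "mallows_product q \<alpha>"
  have P: "prob_space ?P" "sets ?P = sets perm_space"
    unfolding mallows_product_eq_mixture[OF assms(1-3), of 0] by (simp_all add: prob_space_mixture)
  have space: "space ?P = {\<omega>. bij \<omega>}" using sets_eq_imp_space_eq[OF P(2)] space_perm_space by simp
  have inj: "inj_on i {1..k}"
  proof (rule linorder_inj_onI')
    fix a b assume "a \<in> {1..k}" "b \<in> {1..k}" "a < b"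
    then show "i a \<noteq> i b" using assms(6)[of a b] by simp
  qed
  define y where "y p = x (inv_into {1..k} i p)" for p
  have y: "y (i j) = x j" if "j \<in> {1..k}" for j using that inj by (simp add: y_def)
  define f where "f j = (1 - q) * \<alpha> * q powr (real_of_int (x j - i j) - 1/2) /
       ((1 + \<alpha> * q powr (real_of_int (x j - i j) - 1/2)) *
        (1 + \<alpha> * q powr (real_of_int (x j - i j) + 1/2)))" for j
  have "measure ?P (cylinder (i ` {1..n}) y) = (\<Prod>j=1..n. f j)" if "n \<le> k" for n
    using that
  proof (induction n)
    case 0
    have "cylinder {} y = space ?P" by (auto simp: cylinder_def space)
    then show ?case using prob_space.prob_space[OF P(1)] by simp
  next
    case (Suc n)
    have "cylinder (i ` {1..Suc n}) y = {\<omega> \<in> cylinder (i ` {1..n}) y. \<omega> (i (Suc n)) = x (Suc n)}"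
      using y[of "Suc n"] Suc.prems by (auto simp: cylinder_def atLeastAtMostSuc_conv)
    also have "measure ?P \<dots> = measure ?P (cylinder (i ` {1..n}) y) * f (Suc n)"
      unfolding f_def
    proof (rule mallows_product_next[OF assms(1-3)])
      fix p assume "p \<in> i ` {1..n}"
      then obtain j where j: "p = i j" "1 \<le> j" "j \<le> n" by auto
      then show "p < i (Suc n) \<and> x (Suc n) < y p"
        using assms(5)[of j "Suc n"] assms(6)[of j "Suc n"] y[of j] Suc.prems by simp
    qed simp
    finally show ?case using Suc by simp
  qed
  from this[of k] have "measure ?P (cylinder (i ` {1..k}) y) = (\<Prod>j=1..k. f j)" by simp
  moreover have "{\<omega> \<in> space ?P. \<forall>j\<in>{1..k}. \<omega> (i j) = x j} = cylinder (i ` {1..k}) y"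
    using y by (auto simp: cylinder_def space)
  ultimately show ?thesis by (simp add: f_def)
qed

end
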